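(* The following decision problem is NP-complete: given two ordered matchings $M$ and $N$, decide whether there exists an ordered homomorphism $N\to M$.
   Context: An ordered graph is a finite simple graph whose vertex set is equipped with a total (linear) order. An ordered matching is an ordered graph in which every vertex is incident to exactly one edge. For ordered graphs $G,H$, an ordered homomorphism $f:G\to H$ is a map $f:V(G)\to V(H)$ such that $uv\in E(G)$ implies $f(u)f(v)\in E(H)$, and $u\le v$ implies $f(u)\le f(v)$. *)

theory Defs
  imports "HOL-Computational_Algebra.Polynomial"
begin

text \<open>
  States and tape symbols are natural numbers. A machine is given by a finite set of transitions
  \<open>(q, reads, q', acts)\<close>, so only finitely many states and symbols are ever relevant.
  Several transitions may apply to one configuration (nondeterminism); a configuration to which
  none applies is halting. Tapes are infinite in both directions, and symbol 0 is the blank.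
\<close>

datatype direction = Left | Stay | Right

fun offset :: "direction \<Rightarrow> int" where
  "offset Left = -1"
| "offset Stay = 0"
| "offset Right = 1"

type_synonym transition = "nat \<times> nat list \<times> nat \<times> (nat \<times> direction) list"

record machine =
  tapes :: nat
  transitions :: "transition set"
  start :: nat
  accepting :: nat

definition turing_machine :: "machine \<Rightarrow> bool" where
  "turing_machine M \<longleftrightarrow>
     tapes M > 0 \<and> finite (transitions M) \<and>
     (\<forall>(q, reads, q', acts) \<in> transitions M.
        length reads = tapes M \<and> length acts = tapes M)"

definition deterministic :: "machine \<Rightarrow> bool" where
  "deterministic M \<longleftrightarrow>
     (\<forall>q reads q1 acts1 q2 acts2.
        (q, reads, q1, acts1) \<in> transitions M \<longrightarrow> (q, reads, q2, acts2) \<in> transitions M \<longrightarrow>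
        q1 = q2 \<and> acts1 = acts2)"

text \<open>A tape consists of the contents of its cells and the position of its head.\<close>

type_synonym tape = "(int \<Rightarrow> nat) \<times> int"
type_synonym config = "nat \<times> tape list"

fun read_tape :: "tape \<Rightarrow> nat" where
  "read_tape (cells, pos) = cells pos"

fun act_tape :: "nat \<times> direction \<Rightarrow> tape \<Rightarrow> tape" where
  "act_tape (s, d) (cells, pos) = (cells(pos := s), pos + offset d)"

definition step :: "machine \<Rightarrow> config \<Rightarrow> config \<Rightarrow> bool" where
  "step M c c' \<longleftrightarrow>
     (\<exists>acts. (fst c, map read_tape (snd c), fst c', acts) \<in> transitions M \<and>
             snd c' = map2 act_tape acts (snd c))"

definition halting :: "machine \<Rightarrow> config \<Rightarrow> bool" where
  "halting M c \<longleftrightarrow> \<not> (\<exists>c'. step M c c')"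

definition bit_symbol :: "bool \<Rightarrow> nat" where
  "bit_symbol b = (if b then 2 else 1)"

definition blank_tape :: tape where
  "blank_tape = (\<lambda>_. 0, 0)"

definition input_tape :: "bool list \<Rightarrow> tape" where
  "input_tape x =
     (\<lambda>i. if 0 \<le> i \<and> i < int (length x) then bit_symbol (x ! nat i) else 0, 0)"

definition initial :: "machine \<Rightarrow> bool list \<Rightarrow> config" where
  "initial M x = (start M, input_tape x # replicate (tapes M - 1) blank_tape)"

text \<open>
  The output is the word on the last tape that starts at cell 0 and ends before the first blank.
  Head positions and all remaining cells are irrelevant.
\<close>

definition has_output :: "config \<Rightarrow> bool list \<Rightarrow> bool" where
  "has_output c y \<longleftrightarrow>
     (let cells = fst (last (snd c)) in
        (\<forall>i < length y. cells (int i) = bit_symbol (y ! i)) \<and> cells (int (length y)) = 0)"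

definition polytime_computable :: "(bool list \<Rightarrow> bool list) \<Rightarrow> bool" where
  "polytime_computable f \<longleftrightarrow>
     (\<exists>M p. turing_machine M \<and> deterministic M \<and>
        (\<forall>x. \<exists>n \<le> poly (p :: nat poly) (length x). \<exists>c.
           (step M ^^ n) (initial M x) c \<and> halting M c \<and> has_output c (f x)))"

definition accepts :: "machine \<Rightarrow> bool list \<Rightarrow> bool" where
  "accepts M x \<longleftrightarrow> (\<exists>c. (step M)\<^sup>*\<^sup>* (initial M x) c \<and> fst c = accepting M)"

definition NP :: "bool list set set" where
  "NP = {A. \<exists>M p. turing_machine M \<and>
           (\<forall>x n c. (step M ^^ n) (initial M x) c \<longrightarrow> n \<le> poly (p :: nat poly) (length x)) \<and>
           A = {x. accepts M x}}"

definition polytime_reducible :: "bool list set \<Rightarrow> bool list set \<Rightarrow> bool" where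
  "polytime_reducible A B \<longleftrightarrow> (\<exists>f. polytime_computable f \<and> (\<forall>x. x \<in> A \<longleftrightarrow> f x \<in> B))"

definition NP_hard :: "bool list set \<Rightarrow> bool" where
  "NP_hard B \<longleftrightarrow> (\<forall>A \<in> NP. polytime_reducible A B)"

definition NP_complete :: "bool list set \<Rightarrow> bool" where
  "NP_complete B \<longleftrightarrow> B \<in> NP \<and> NP_hard B"

text \<open>The order on the vertices is the one of the vertex type.\<close>

record 'a graph =
  verts :: "'a set"
  edges :: "'a set set"

definition ordered_graph :: "'a :: linorder graph \<Rightarrow> bool" where
  "ordered_graph G \<longleftrightarrow>
     finite (verts G) \<and> (\<forall>e \<in> edges G. e \<subseteq> verts G \<and> card e = 2)"

definition ordered_matching :: "'a :: linorder graph \<Rightarrow> bool" where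
  "ordered_matching G \<longleftrightarrow>
     ordered_graph G \<and> (\<forall>v \<in> verts G. \<exists>!e. e \<in> edges G \<and> v \<in> e)"

definition ordered_hom ::
  "('a :: linorder \<Rightarrow> 'b :: linorder) \<Rightarrow> 'a graph \<Rightarrow> 'b graph \<Rightarrow> bool" where
  "ordered_hom f G H \<longleftrightarrow>
     f ` verts G \<subseteq> verts H \<and>
     (\<forall>u v. {u, v} \<in> edges G \<longrightarrow> {f u, f v} \<in> edges H) \<and>
     mono_on (verts G) f"

text \<open>
  A graph with \<open>n\<close> vertices is encoded by \<open>n\<close> in unary, a terminating \<open>False\<close>, and its adjacency
  matrix row by row, where rows and columns follow the vertex order. The encoding determines an
  ordered graph up to isomorphism, and it is prefix-free, so pairs can be encoded by concatenation.
  Every finite ordered graph is isomorphic to one whose vertices are natural numbers.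
\<close>

definition encode_graph :: "'a :: linorder graph \<Rightarrow> bool list" where
  "encode_graph G =
     (let vs = sorted_list_of_set (verts G) in
        replicate (length vs) True @ [False] @
        concat (map (\<lambda>u. map (\<lambda>v. {u, v} \<in> edges G) vs) vs))"

definition matching_hom_problem :: "bool list set" where
  "matching_hom_problem =
     {encode_graph M @ encode_graph N | (M :: nat graph) (N :: nat graph).
        ordered_matching M \<and> ordered_matching N \<and> (\<exists>f. ordered_hom f N M)}"

end

theory Submission
  imports Defs "HOL-Library.List_Lexorder" "HOL-Library.Product_Lexorder"
begin

text \<open>
  Hardness. A computation of a nondeterministic machine is determined by the following data for each
  time: the transition taken, the positions of the heads, and for each tape the time of the previous
  visit to the scanned cell. Whether such data describe an accepting computation can be tested on pairs
  of times, so acceptance is a binary constraint satisfaction problem with polynomially many groups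
  (the times) and items (the possible data): select one item per group such that any two selected
  items are compatible.

  Such a problem becomes a homomorphism question as follows. Both matchings consist of consecutive
  blocks, one for each group \<open>g\<close> and one for each pair of items \<open>a\<close>, \<open>b\<close> of two
  groups. Two edges between neighbouring vertices precede each block; they can only be mapped to
  themselves, hence every block is mapped to the block of the same name. In the block of \<open>g\<close> the
  source has vertices indexed by the items \<open>a\<close> of \<open>g\<close> (and by the items of the other
  groups), and the target has a copy of these vertices for every item \<open>j\<close>. A homomorphism thus
  gives a monotone map of the items of \<open>g\<close> to themselves; its fixed point is the selected item.
  Each of these vertices is matched with a vertex in a block of a pair, where the order of the target
  vertices excludes exactly that both items of an incompatible pair are fixed points.

  Machines. The adjacency matrices of this construction, and the verification of a homomorphism that has
  been guessed, are given by formulas whose quantifiers range below a polynomial. These are evaluated by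
  programs on unary counters, which are compiled to Turing machines.
\<close>

section \<open>Structured programs on tapes\<close>

text \<open>Every vertex has only one edge, so an item \<open>a\<close> of a group needs a separate
  vertex for each item of each other group. Nothing forces these copies to agree on a choice
  \<open>j\<close>, nor the choice to be the same for all \<open>a\<close>. What the order does
  enforce is monotonicity: in the target, the block of a group is sorted by \<open>j\<close> first,
  so every copy of a smaller item chooses at most what any copy of a larger item chooses. This
  already yields an item whose copies all choose it, and conversely a solution \<open>s\<close> is
  realised by the constant choice \<open>s g\<close>. An incompatible pair is excluded by order
  alone: the two vertices of the pair have a fixed order in the source, which the target reverses
  only for those copies in which both items choose themselves. On the machine side, all numbers are
  unary and polynomially bounded. Bounded quantifiers can therefore be evaluated by exhaustive
  search in polynomial time, and one formula language serves both for checking certificates and for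
  printing matrices.\<close>

datatype com =
    Skip
  | Do nat "nat option" direction
  | Seq com com (infixr ";;" 60)
  | Cond nat nat com com \<comment> \<open>\<open>Cond i s c c'\<close>: \<open>c\<close> if tape \<open>i\<close> reads \<open>s\<close>, otherwise \<open>c'\<close>\<close>
  | Until nat nat com \<comment> \<open>\<open>Until i s c\<close>: repeat \<open>c\<close> until tape \<open>i\<close> reads \<open>s\<close>\<close>

text \<open>
  Tapes are addressed by names rather than by positions; \<open>Do i w d\<close> writes \<open>w\<close> (nothing if
  \<open>None\<close>) and moves in direction \<open>d\<close>.
\<close>

type_synonym store = "nat \<Rightarrow> tape"

definition put :: "nat option \<Rightarrow> direction \<Rightarrow> tape \<Rightarrow> tape" where
  "put w d tp = act_tape (case w of None \<Rightarrow> read_tape tp | Some s \<Rightarrow> s, d) tp"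

text \<open>The step counts are those of the compiled code: the else branch of \<open>Cond\<close>
  comes first in memory and pays for the jump over the then branch, and each round of
  \<open>Until\<close> pays for the test and for the jump back.\<close>

inductive exec :: "com \<Rightarrow> store \<Rightarrow> nat \<Rightarrow> store \<Rightarrow> bool" where
  Skip: "exec Skip ts 0 ts"
| Do: "exec (Do i w d) ts 1 (ts(i := put w d (ts i)))"
| Seq: "exec c ts t ts1 \<Longrightarrow> exec c' ts1 t' ts2 \<Longrightarrow> exec (c ;; c') ts (t + t') ts2"
| CondT: "read_tape (ts i) = s \<Longrightarrow> exec c ts t ts1 \<Longrightarrow> exec (Cond i s c c') ts (1 + t) ts1"
| CondF: "read_tape (ts i) \<noteq> s \<Longrightarrow> exec c' ts t ts1 \<Longrightarrow> exec (Cond i s c c') ts (1 + (t + 1)) ts1"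
| UntilT: "read_tape (ts i) = s \<Longrightarrow> exec (Until i s c) ts 1 ts"
| UntilF: "read_tape (ts i) \<noteq> s \<Longrightarrow> exec c ts t ts1 \<Longrightarrow> exec (Until i s c) ts1 t' ts2 \<Longrightarrow>
    exec (Until i s c) ts (1 + (t + (1 + t'))) ts2"

datatype instr = Prim nat "nat option" direction | Jump nat nat nat | Goto nat

fun csize :: "com \<Rightarrow> nat" where
  "csize Skip = 0"
| "csize (Do i w d) = 1"
| "csize (c ;; c') = csize c + csize c'"
| "csize (Cond i s c c') = csize c + csize c' + 2"
| "csize (Until i s c) = csize c + 2"

fun code :: "com \<Rightarrow> nat \<Rightarrow> instr list" where
  "code Skip q = []"
| "code (Do i w d) q = [Prim i w d]"
| "code (c ;; c') q = code c q @ code c' (q + csize c)"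
| "code (Cond i s c c') q =
     Jump i s (q + csize c' + 2) # code c' (q + 1) @ Goto (q + csize c' + csize c + 2) #
     code c (q + csize c' + 2)"
| "code (Until i s c) q = Jump i s (q + csize c + 2) # code c (q + 1) @ [Goto q]"

lemma length_code [simp]: "length (code c q) = csize c"
  by (induction c arbitrary: q) auto

fun succ_state :: "instr \<Rightarrow> nat \<Rightarrow> (nat \<Rightarrow> nat) \<Rightarrow> nat" where
  "succ_state (Prim i w d) q r = Suc q"
| "succ_state (Jump i s q') q r = (if r i = s then q' else Suc q)"
| "succ_state (Goto q') q r = q'"

fun effect :: "instr \<Rightarrow> (nat \<Rightarrow> nat) \<Rightarrow> nat \<Rightarrow> nat \<times> direction" where
  "effect (Prim i w d) r n =
     (if n = i then (case w of None \<Rightarrow> r n | Some s \<Rightarrow> s, d) else (r n, Stay))"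
| "effect (Jump i s q') r n = (r n, Stay)"
| "effect (Goto q') r n = (r n, Stay)"

text \<open>The symbols are the blank and the two bits. The value 0 outside \<open>ns\<close> makes
  the set finite and lets \<open>r\<close> be recovered from \<open>map r ns\<close>.\<close>

definition readings :: "nat list \<Rightarrow> (nat \<Rightarrow> nat) set" where
  "readings ns = {r. (\<forall>n. (n \<in> set ns \<longrightarrow> r n \<in> {..2}) \<and> (n \<notin> set ns \<longrightarrow> r n = 0))}"

definition trans_of :: "nat list \<Rightarrow> instr list \<Rightarrow> transition set" where
  "trans_of ns P = {(q, map r ns, succ_state (P ! q) q r, map (effect (P ! q) r) ns) | q r.
     q < length P \<and> r \<in> readings ns}"

lemma finite_readings: "finite (readings ns)"
  unfolding readings_def using finite_set_of_finite_funs[of "set ns" "{..2}" "0::nat"] by simp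

lemma readings_eqI: "r \<in> readings ns \<Longrightarrow> r' \<in> readings ns \<Longrightarrow> map r ns = map r' ns \<Longrightarrow> r = r'"
  unfolding readings_def by (rule ext) (metis (mono_tags, lifting) map_eq_conv mem_Collect_eq)

lemma finite_trans_of: "finite (trans_of ns P)"
proof -
  have "trans_of ns P = (\<lambda>(q, r). (q, map r ns, succ_state (P ! q) q r, map (effect (P ! q) r) ns)) `
      ({..<length P} \<times> readings ns)"
    unfolding trans_of_def by auto
  then show ?thesis
    using finite_readings by simp
qed

definition wf_tapes :: "nat list \<Rightarrow> store \<Rightarrow> bool" where
  "wf_tapes ns ts \<longleftrightarrow> (\<forall>n \<in> set ns. \<forall>p. fst (ts n) p \<le> 2)"

definition reading :: "nat list \<Rightarrow> store \<Rightarrow> nat \<Rightarrow> nat" where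
  "reading ns ts n = (if n \<in> set ns then read_tape (ts n) else 0)"

lemma read_tape_eq: "read_tape tp = fst tp (snd tp)"
  by (cases tp) simp

lemma reading_in_readings: "wf_tapes ns ts \<Longrightarrow> reading ns ts \<in> readings ns"
  by (auto simp: wf_tapes_def reading_def readings_def read_tape_eq)

lemma map_reading: "map (read_tape \<circ> ts) ns = map (reading ns ts) ns"
  by (simp add: reading_def)

lemma map2_map: "map2 f (map g ns) (map h ns) = map (\<lambda>n. f (g n) (h n)) ns"
  by (induction ns) auto

fun wf_instr :: "nat list \<Rightarrow> instr \<Rightarrow> bool" where
  "wf_instr ns (Prim i w d) \<longleftrightarrow> i \<in> set ns \<and> (\<forall>s. w = Some s \<longrightarrow> s \<le> 2)"
| "wf_instr ns (Jump i s q) \<longleftrightarrow> i \<in> set ns"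
| "wf_instr ns (Goto q) \<longleftrightarrow> True"

fun after :: "instr \<Rightarrow> store \<Rightarrow> store" where
  "after (Prim i w d) ts = ts(i := put w d (ts i))"
| "after _ ts = ts"

lemma act_stay [simp]: "act_tape (read_tape tp, Stay) tp = tp"
  by (cases tp) simp

lemma map_after:
  assumes "wf_instr ns I"
  shows "map (\<lambda>n. act_tape (effect I (reading ns ts) n) (ts n)) ns = map (after I ts) ns"
  using assms by (cases I) (auto simp: reading_def put_def split: option.splits)

lemma step_program:
  assumes "transitions M = trans_of ns P \<union> X" "\<And>q z. (q, z) \<in> X \<Longrightarrow> length P \<le> q"
    and "q < length P" "wf_tapes ns ts" "wf_instr ns (P ! q)"
  shows "step M (q, map ts ns) c \<longleftrightarrow>
    c = (succ_state (P ! q) q (reading ns ts), map (after (P ! q) ts) ns)"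
proof -
  let ?r = "reading ns ts"
  have r: "?r \<in> readings ns"
    by (rule reading_in_readings) fact
  have "(q, z) \<in> transitions M \<longleftrightarrow> (q, z) \<in> trans_of ns P" for z
    using assms(1,3) assms(2)[of q z] by auto
  then have "step M (q, map ts ns) c \<longleftrightarrow> (\<exists>acts. (q, map ?r ns, fst c, acts) \<in> trans_of ns P \<and>
      snd c = map2 act_tape acts (map ts ns))"
    unfolding step_def by (simp only: fst_conv snd_conv map_map map_reading)
  also have "\<dots> \<longleftrightarrow> fst c = succ_state (P ! q) q ?r \<and>
      snd c = map2 act_tape (map (effect (P ! q) ?r) ns) (map ts ns)"
    unfolding trans_of_def using r assms(3) readings_eqI by fast
  also have "\<dots> \<longleftrightarrow> c = (succ_state (P ! q) q ?r, map (after (P ! q) ts) ns)"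
    unfolding map2_map map_after[OF assms(5)] by (cases c) auto
  finally show ?thesis .
qed

lemma wf_tapes_after:
  assumes "wf_tapes ns ts" "wf_instr ns I" shows "wf_tapes ns (after I ts)"
proof (cases I)
  case (Prim i w d)
  show ?thesis
    unfolding wf_tapes_def
  proof (intro ballI allI)
    fix n p assume n: "n \<in> set ns"
    obtain f q where f: "ts i = (f, q)" by fastforce
    have "i \<in> set ns" using assms(2) Prim by simp
    then have "\<forall>p. f p \<le> 2" using assms(1) f unfolding wf_tapes_def by (metis fst_conv)
    then show "fst (after I ts n) p \<le> 2"
      using assms n f Prim by (auto simp: wf_tapes_def put_def split: option.splits)
  qed
qed (use assms in auto)

fun wf_com :: "nat list \<Rightarrow> com \<Rightarrow> bool" where
  "wf_com ns Skip \<longleftrightarrow> True"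
| "wf_com ns (Do i w d) \<longleftrightarrow> i \<in> set ns \<and> (\<forall>s. w = Some s \<longrightarrow> s \<le> 2)"
| "wf_com ns (c ;; c') \<longleftrightarrow> wf_com ns c \<and> wf_com ns c'"
| "wf_com ns (Cond i s c c') \<longleftrightarrow> i \<in> set ns \<and> wf_com ns c \<and> wf_com ns c'"
| "wf_com ns (Until i s c) \<longleftrightarrow> i \<in> set ns \<and> wf_com ns c"

text \<open>
  \<open>X\<close> stands for additional transitions that cannot interfere with the program: they are used for
  the nondeterministic guessing phase.
\<close>

locale program =
  fixes M :: machine and ns :: "nat list" and P :: "instr list" and X :: "transition set"
  assumes trans: "transitions M = trans_of ns P \<union> X"
    and X: "\<And>q z. (q, z) \<in> X \<Longrightarrow> length P \<le> q"
begin

lemma step_instr: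
  assumes "P = pre @ I # post" "q = length pre" "wf_tapes ns ts" "wf_instr ns I"
  shows "(step M ^^ 1) (q, map ts ns) (succ_state I q (reading ns ts), map (after I ts) ns)"
  using step_program[OF trans, of q ts] X assms by (simp add: eq_OO)

lemma relpowp_cat: "(R ^^ m) x y \<Longrightarrow> (R ^^ n) y z \<Longrightarrow> (R ^^ (m + n)) x z"
  for R :: "'a \<Rightarrow> 'a \<Rightarrow> bool"
  by (auto simp: relpowp_add)

text \<open>The induction is over \<open>exec\<close> and not over the program, since
  \<open>Until\<close> executes the same code again. The context \<open>pre\<close>,
  \<open>post\<close> varies so that each subprogram is found at its own offset.\<close>

lemma exec_code:
  assumes "exec c ts t ts'" "wf_com ns c" "wf_tapes ns ts"
    "P = pre @ code c q @ post" "q = length pre"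
  shows "(step M ^^ t) (q, map ts ns) (q + csize c, map ts' ns) \<and> wf_tapes ns ts'"
  using assms
proof (induction arbitrary: pre q post rule: exec.induct)
  case (Do i w d ts)
  then show ?case
    using step_instr[of pre "Prim i w d" post q ts] wf_tapes_after[of ns ts "Prim i w d"]
    by (simp add: eq_OO fun_upd_def)
next
  case (Seq c ts t ts1 c' t' ts2)
  have 1: "(step M ^^ t) (q, map ts ns) (q + csize c, map ts1 ns) \<and> wf_tapes ns ts1"
    using Seq.prems by (intro Seq.IH(1)[of pre _ "code c' (q + csize c) @ post"]) auto
  have 2: "(step M ^^ t') (q + csize c, map ts1 ns) (q + csize c + csize c', map ts2 ns) \<and>
      wf_tapes ns ts2"
    using Seq.prems 1 by (intro Seq.IH(2)[of "pre @ code c q" _ post]) auto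
  show ?case using 1 2 relpowp_cat by (fastforce simp: add.assoc)
next
  case (CondT ts i s c t ts1 c')
  let ?J = "Jump i s (q + csize c' + 2)"
  have 1: "(step M ^^ 1) (q, map ts ns) (q + csize c' + 2, map ts ns)"
    using step_instr[of pre ?J _ q ts] CondT.prems CondT.hyps(1) by (simp add: reading_def)
  have 2: "(step M ^^ t) (q + csize c' + 2, map ts ns)
      (q + csize c' + 2 + csize c, map ts1 ns) \<and> wf_tapes ns ts1"
    using CondT.prems
    by (intro CondT.IH[of "pre @ ?J # code c' (q + 1) @ [Goto (q + csize c' + csize c + 2)]" _ post]) auto
  show ?case using relpowp_cat[OF 1 conjunct1[OF 2]] 2 by (simp add: algebra_simps)
next
  case (CondF ts i s c' t ts1 c)
  let ?J = "Jump i s (q + csize c' + 2)" and ?G = "Goto (q + csize c' + csize c + 2)"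
  have 1: "(step M ^^ 1) (q, map ts ns) (q + 1, map ts ns)"
    using step_instr[of pre ?J _ q ts] CondF.prems CondF.hyps(1) by (simp add: reading_def)
  have 2: "(step M ^^ t) (q + 1, map ts ns) (q + 1 + csize c', map ts1 ns) \<and> wf_tapes ns ts1"
    using CondF.prems
    by (intro CondF.IH[of "pre @ [?J]" _ "?G # code c (q + csize c' + 2) @ post"]) auto
  have 3: "(step M ^^ 1) (q + 1 + csize c', map ts1 ns) (q + csize c' + csize c + 2, map ts1 ns)"
    using step_instr[of "pre @ ?J # code c' (q + 1)" ?G "code c (q + csize c' + 2) @ post" _ ts1]
      CondF.prems 2 by (simp add: algebra_simps)
  show ?case
    using relpowp_cat[OF 1 relpowp_cat[OF conjunct1[OF 2] 3]] 2 by (simp add: algebra_simps)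
next
  case (UntilT ts i s c)
  let ?J = "Jump i s (q + csize c + 2)"
  show ?case
    using step_instr[of pre ?J _ q ts] UntilT by (simp add: reading_def)
next
  case (UntilF ts i s c t ts1 t' ts2)
  let ?J = "Jump i s (q + csize c + 2)"
  have 1: "(step M ^^ 1) (q, map ts ns) (q + 1, map ts ns)"
    using step_instr[of pre ?J _ q ts] UntilF.prems UntilF.hyps(1) by (simp add: reading_def)
  have 2: "(step M ^^ t) (q + 1, map ts ns) (q + 1 + csize c, map ts1 ns) \<and> wf_tapes ns ts1"
    using UntilF.prems
    by (intro UntilF.IH(1)[of "pre @ [?J]" _ "Goto q # post"]) auto
  have 3: "(step M ^^ 1) (q + 1 + csize c, map ts1 ns) (q, map ts1 ns)"
    using step_instr[of "pre @ ?J # code c (q + 1)" "Goto q" post _ ts1]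
      UntilF.prems 2 by (simp add: algebra_simps)
  have 4: "(step M ^^ t') (q, map ts1 ns) (q + csize (Until i s c), map ts2 ns) \<and> wf_tapes ns ts2"
    using UntilF.prems 2 by (intro UntilF.IH(2)[of pre _ post]) auto
  show ?case
    using relpowp_cat[OF 1 relpowp_cat[OF conjunct1[OF 2] relpowp_cat[OF 3 conjunct1[OF 4]]]] 4
    by simp
qed auto

end

section \<open>Upper bounds on running times\<close>

definition runs :: "com \<Rightarrow> store \<Rightarrow> nat \<Rightarrow> store \<Rightarrow> bool" where
  "runs c ts b ts' \<longleftrightarrow> (\<exists>t \<le> b. exec c ts t ts')"

lemma runs_mono: "runs c ts b ts' \<Longrightarrow> b \<le> b' \<Longrightarrow> runs c ts b' ts'"
  unfolding runs_def using le_trans by blast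

lemma runs_Skip: "runs Skip ts 0 ts"
  unfolding runs_def using exec.Skip by blast

lemma runs_Do: "ts' = ts(i := put w d (ts i)) \<Longrightarrow> runs (Do i w d) ts 1 ts'"
  unfolding runs_def using exec.Do by blast

lemma runs_Seq: "runs c ts b ts1 \<Longrightarrow> runs c' ts1 b' ts2 \<Longrightarrow> runs (c ;; c') ts (b + b') ts2"
  unfolding runs_def using exec.Seq add_le_mono by blast

lemma runs_CondT: "read_tape (ts i) = s \<Longrightarrow> runs c ts b ts' \<Longrightarrow> runs (Cond i s c c') ts (b + 2) ts'"
  unfolding runs_def by (metis exec.CondT add.commute add_le_mono one_le_numeral)

lemma runs_CondF: "read_tape (ts i) \<noteq> s \<Longrightarrow> runs c' ts b ts' \<Longrightarrow> runs (Cond i s c c') ts (b + 2) ts'"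
proof -
  assume "read_tape (ts i) \<noteq> s" "runs c' ts b ts'"
  then obtain t where "t \<le> b" "exec (Cond i s c c') ts (1 + (t + 1)) ts'"
    unfolding runs_def using exec.CondF by blast
  moreover have "1 + (t + 1) \<le> b + 2" using \<open>t \<le> b\<close> by simp
  ultimately show ?thesis unfolding runs_def by blast
qed

text \<open>\<open>f k\<close> is the store after \<open>k\<close> rounds. A round costs two steps
  besides its body, the test and the jump back, and the final test costs one.\<close>

lemma runs_Until:
  assumes "\<And>k. k < n \<Longrightarrow> read_tape (f k i) \<noteq> s" "read_tape (f n i) = s"
    and "\<And>k. k < n \<Longrightarrow> runs c (f k) b (f (Suc k))"
  shows "runs (Until i s c) (f 0) (n * (b + 2) + 1) (f n)"
  using assms
proof (induction n arbitrary: f)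
  case 0
  then show ?case unfolding runs_def using exec.UntilT[of "f 0" i s c] by auto
next
  case (Suc n)
  have "runs (Until i s c) (f (Suc 0)) (n * (b + 2) + 1) (f (Suc n))"
    using Suc.prems by (intro Suc.IH[of "\<lambda>k. f (Suc k)"]) auto
  moreover have "runs c (f 0) b (f (Suc 0))" "read_tape (f 0 i) \<noteq> s"
    using Suc.prems by auto
  ultimately obtain t t' where "t \<le> b" "t' \<le> n * (b + 2) + 1"
      "exec (Until i s c) (f 0) (1 + (t + (1 + t'))) (f (Suc n))"
    unfolding runs_def using exec.UntilF[of "f 0" i s c] by blast
  moreover have "1 + (t + (1 + t')) \<le> Suc n * (b + 2) + 1"
    using \<open>t \<le> b\<close> \<open>t' \<le> _\<close> by simp
  ultimately show ?case unfolding runs_def by blast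
qed

section \<open>Counters and bounded formulas\<close>

definition bits :: "bool list \<Rightarrow> int \<Rightarrow> nat" where
  "bits x = (\<lambda>i. if 0 \<le> i \<and> i < int (length x) then bit_symbol (x ! nat i) else 0)"

text \<open>
  A counter is a unary stack whose head is on the topmost symbol. Value 0 is thus a blank tape, so no
  initialisation is needed, and a counter is 0 iff its head reads a blank.
\<close>

definition ctr :: "nat \<Rightarrow> tape" where
  "ctr v = (\<lambda>i. if 1 \<le> i \<and> i \<le> int v then 1 else 0, int v)"

text \<open>
  Tape 0 holds the input, tape 1 the guessed certificate, tape 2 the output, and tape \<open>i + 3\<close> is the
  counter \<open>i\<close>.
\<close>

definition st :: "bool list \<Rightarrow> bool list \<Rightarrow> int \<Rightarrow> int \<Rightarrow> (nat \<Rightarrow> nat) \<Rightarrow> bool list \<Rightarrow> store" where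
  "st x g a b e w n =
     (if n = 0 then (bits x, a) else if n = 1 then (bits g, b)
      else if n = 2 then (bits w, int (length w)) else ctr (e (n - 3)))"

definition inc :: "nat \<Rightarrow> com" where
  "inc i = Do (i + 3) None Right ;; Do (i + 3) (Some 1) Stay"

definition dec :: "nat \<Rightarrow> com" where
  "dec i = Do (i + 3) (Some 0) Left"

definition out :: "bool \<Rightarrow> com" where
  "out b = Do 2 (Some (bit_symbol b)) Right"

definition loop :: "nat \<Rightarrow> com \<Rightarrow> com" where
  "loop i = Until (i + 3) 0"

lemma st_upd_ctr: "(st x g a b e w)(i + 3 := ctr v) = st x g a b (e(i := v)) w"
  by (rule ext) (auto simp: st_def)

lemma st_ctr [simp]: "st x g a b e w (i + 3) = ctr (e i)"
  by (simp add: st_def)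

lemma runs_inc: "runs (inc i) (st x g a b e w) 2 (st x g a b (e(i := Suc (e i))) w)"
proof -
  let ?s = "st x g a b e w"
  have "put (Some 1) Stay (put None Right (ctr (e i))) = ctr (Suc (e i))"
    by (auto simp: put_def ctr_def)
  then have "(?s(i + 3 := put None Right (?s (i + 3))))
      (i + 3 := put (Some 1) Stay ((?s(i + 3 := put None Right (?s (i + 3)))) (i + 3))) =
      st x g a b (e(i := Suc (e i))) w"
    by (simp add: st_upd_ctr)
  then show ?thesis
    unfolding inc_def using runs_Seq[OF runs_Do[OF refl] runs_Do[OF refl], of "i + 3" None Right "i + 3" "Some 1" Stay ?s]
    by (simp add: numeral_2_eq_2)
qed

lemma runs_dec: "0 < e i \<Longrightarrow> runs (dec i) (st x g a b e w) 1 (st x g a b (e(i := e i - 1)) w)"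
proof -
  assume "0 < e i"
  then have "put (Some 0) Left (ctr (e i)) = ctr (e i - 1)"
    by (auto simp: put_def ctr_def)
  then show ?thesis
    unfolding dec_def by (intro runs_Do) (simp only: st_ctr st_upd_ctr)
qed

lemma runs_incI: "e' = e(i := Suc (e i)) \<Longrightarrow> runs (inc i) (st x g a b e w) 2 (st x g a b e' w)"
  using runs_inc by simp

lemma runs_decI: "0 < e i \<Longrightarrow> e' = e(i := e i - 1) \<Longrightarrow> runs (dec i) (st x g a b e w) 1 (st x g a b e' w)"
  using runs_dec by simp

lemma read_ctr [simp]: "read_tape (ctr v) = (if v = 0 then 0 else 1)"
  by (simp add: ctr_def)

lemma read_st: "read_tape (st x g a b e w (i + 3)) = 0 \<longleftrightarrow> e i = 0"
  by simp

lemma runs_out: "runs (out c) (st x g a b e w) 1 (st x g a b e (w @ [c]))"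
  unfolding out_def by (rule runs_Do, rule ext)
    (auto simp: st_def put_def bits_def nth_append fun_eq_iff)

lemma runs_move0: "runs (Do 0 None d) (st x g a b e w) 1 (st x g (a + offset d) b e w)"
  by (rule runs_Do, rule ext) (auto simp: st_def put_def)

lemma runs_move1: "runs (Do (Suc 0) None d) (st x g a b e w) 1 (st x g a (b + offset d) e w)"
  by (rule runs_Do, rule ext) (auto simp: st_def put_def)

lemma runs_UntilT: "read_tape (ts i) = s \<Longrightarrow> runs (Until i s c) ts 1 ts"
  unfolding runs_def using exec.UntilT by blast

lemma runs_UntilF:
  assumes "read_tape (ts i) \<noteq> s" "runs c ts b ts1" "runs (Until i s c) ts1 b' ts2"
  shows "runs (Until i s c) ts (b + b' + 2) ts2"
proof -
  obtain t t' where "t \<le> b" "t' \<le> b'" "exec (Until i s c) ts (1 + (t + (1 + t'))) ts2"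
    using assms exec.UntilF unfolding runs_def by blast
  moreover have "1 + (t + (1 + t')) \<le> b + b' + 2" using \<open>t \<le> b\<close> \<open>t' \<le> b'\<close> by simp
  ultimately show ?thesis unfolding runs_def by blast
qed

lemma runs_loop:
  assumes "\<And>k. k < n \<Longrightarrow> f k i \<noteq> 0" "f n i = 0"
    and "\<And>k. k < n \<Longrightarrow> runs c (st x g (a k) (b k) (f k) (w k)) B
      (st x g (a (Suc k)) (b (Suc k)) (f (Suc k)) (w (Suc k)))"
  shows "runs (loop i c) (st x g (a 0) (b 0) (f 0) (w 0)) (n * (B + 2) + 1)
    (st x g (a n) (b n) (f n) (w n))"
  unfolding loop_def
  using assms by (intro runs_Until[of n "\<lambda>k. st x g (a k) (b k) (f k) (w k)"]) auto

lemma runs_loopF: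
  assumes "read_tape (ts (i + 3)) \<noteq> 0" "runs c ts b ts1" "runs (loop i c) ts1 b' ts2"
  shows "runs (loop i c) ts (b + b' + 2) ts2"
  using runs_UntilF assms unfolding loop_def .

lemma runs_clear:
  "runs (loop i (dec i)) (st x g a b e w) (3 * e i + 1) (st x g a b (e(i := 0)) w)"
proof -
  have "runs (loop i (dec i)) (st x g a b (e(i := e i - 0)) w) (e i * (1 + 2) + 1)
     (st x g a b (e(i := e i - e i)) w)"
  proof (rule runs_loop[where f = "\<lambda>k. e(i := e i - k)" and a = "\<lambda>_. a" and b = "\<lambda>_. b" and w = "\<lambda>_. w"])
    fix k assume "k < e i"
    then show "runs (dec i) (st x g a b (e(i := e i - k)) w) 1 (st x g a b (e(i := e i - Suc k)) w)"
      using runs_dec[of "e(i := e i - k)" i] by simp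
  qed auto
  from runs_mono[OF this, of "3 * e i + 1"] show ?thesis by simp
qed

text \<open>
  Variables are counters. In a formula at depth \<open>d\<close>, variables below \<open>d\<close> are in use and
  all counters from \<open>d\<close> on are 0; a quantifier binds variable \<open>d\<close>. Counter 0 contains the
  length of the input, counter 1 the bound of all quantifiers, and counter 2 receives the truth value.
\<close>

datatype tm = V nat | C nat | Plus tm tm | Mul tm tm

fun tval :: "(nat \<Rightarrow> nat) \<Rightarrow> tm \<Rightarrow> nat" where
  "tval e (V i) = e i"
| "tval e (C c) = c"
| "tval e (Plus t t') = tval e t + tval e t'"
| "tval e (Mul t t') = tval e t * tval e t'"

fun twf :: "nat \<Rightarrow> tm \<Rightarrow> bool" where
  "twf d (V i) \<longleftrightarrow> i < d"
| "twf d (C c) \<longleftrightarrow> True"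
| "twf d (Plus t t') \<longleftrightarrow> twf d t \<and> twf d t'"
| "twf d (Mul t t') \<longleftrightarrow> twf d t \<and> twf d t'"

lemma twf_mono: "twf d t \<Longrightarrow> d \<le> d' \<Longrightarrow> twf d' t"
  by (induction t) auto

lemma tval_cong: "twf d t \<Longrightarrow> (\<And>i. i < d \<Longrightarrow> e i = e' i) \<Longrightarrow> tval e t = tval e' t"
  by (induction t) auto

lemma tval_bound:
  assumes "twf d t"
  shows "\<exists>p :: nat poly. \<forall>e N. (\<forall>i<d. e i \<le> N) \<longrightarrow> tval e t \<le> poly p N"
  using assms
proof (induction t)
  case (V i)
  then show ?case by (intro exI[of _ "[:0, 1:]"]) auto
next
  case (C c)
  then show ?case by (intro exI[of _ "[:c:]"]) auto
next
  case (Plus t t')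
  then obtain p p' :: "nat poly" where
    "\<forall>e N. (\<forall>i<d. e i \<le> N) \<longrightarrow> tval e t \<le> poly p N" "\<forall>e N. (\<forall>i<d. e i \<le> N) \<longrightarrow> tval e t' \<le> poly p' N"
    by auto
  then show ?case by (intro exI[of _ "p + p'"]) (auto intro!: add_mono)
next
  case (Mul t t')
  then obtain p p' :: "nat poly" where
    "\<forall>e N. (\<forall>i<d. e i \<le> N) \<longrightarrow> tval e t \<le> poly p N" "\<forall>e N. (\<forall>i<d. e i \<le> N) \<longrightarrow> tval e t' \<le> poly p' N"
    by auto
  then show ?case by (intro exI[of _ "p * p'"]) (auto intro!: mult_le_mono)
qed

lemma nat_poly_mono: "m \<le> n \<Longrightarrow> poly (p :: nat poly) m \<le> poly p n"
  by (induction p) (auto intro!: add_mono mult_le_mono)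

text \<open>
  \<open>addt m r t\<close> adds the value of \<open>t\<close> to counter \<open>r\<close>, using counters from \<open>m\<close> on as
  scratch space.
\<close>

fun addt :: "nat \<Rightarrow> nat \<Rightarrow> tm \<Rightarrow> com" where
  "addt m r (V i) = loop i (dec i ;; inc r ;; inc m) ;; loop m (dec m ;; inc i)"
| "addt m r (C c) = ((\<lambda>p. inc r ;; p) ^^ c) Skip"
| "addt m r (Plus t t') = addt m r t ;; addt m r t'"
| "addt m r (Mul t t') = addt (m + 1) m t ;; loop m (dec m ;; addt (m + 1) r t')"

lemma runs_const:
  "runs (((\<lambda>p. inc r ;; p) ^^ c) Skip) (st x g a b e w) (2 * c) (st x g a b (e(r := e r + c)) w)"
proof (induction c arbitrary: e)
  case 0
  then show ?case by (simp add: runs_Skip)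
next
  case (Suc c)
  have s: "e(r := e r + Suc c) = (e(r := Suc (e r)))(r := (e(r := Suc (e r))) r + c)"
    by auto
  show ?case
    using runs_Seq[OF runs_inc[of r x g a b e w] Suc.IH[of "e(r := Suc (e r))"]]
    unfolding s by (simp del: fun_upd_apply fun_upd_upd)
qed

text \<open>Reading a unary counter destroys it. Its units are therefore moved to \<open>r\<close>
  and to the scratch counter \<open>m\<close> at the same time, and \<open>m\<close> is then emptied
  back into \<open>i\<close>.\<close>

lemma runs_copy:
  assumes "i < r" "r < m" "e m = 0"
  shows "runs (addt m r (V i)) (st x g a b e w) (12 * e i + 2) (st x g a b (e(r := e r + e i)) w)"
proof -
  let ?n = "e i"
  let ?f = "\<lambda>k. e(i := ?n - k, r := e r + k, m := k)"
  let ?h = "\<lambda>k. e(i := k, r := e r + ?n, m := ?n - k)"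
  have 1: "runs (loop i (dec i ;; inc r ;; inc m)) (st x g a b (?f 0) w) (?n * ((1 + (2 + 2)) + 2) + 1)
      (st x g a b (?f ?n) w)"
  proof (rule runs_loop[where f = ?f and a = "\<lambda>_. a" and b = "\<lambda>_. b" and w = "\<lambda>_. w"])
    fix k assume k: "k < ?n"
    let ?e1 = "e(i := ?n - Suc k, r := e r + k, m := k)"
    let ?e2 = "e(i := ?n - Suc k, r := e r + Suc k, m := k)"
    have "runs (dec i) (st x g a b (?f k) w) 1 (st x g a b ?e1 w)"
      by (rule runs_decI) (use assms k in auto)
    moreover have "runs (inc r) (st x g a b ?e1 w) 2 (st x g a b ?e2 w)"
      by (rule runs_incI) (use assms k in auto)
    moreover have "runs (inc m) (st x g a b ?e2 w) 2 (st x g a b (?f (Suc k)) w)"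
      by (rule runs_incI) (use assms k in auto)
    ultimately show "runs (dec i ;; inc r ;; inc m) (st x g a b (?f k) w) (1 + (2 + 2)) (st x g a b (?f (Suc k)) w)"
      by (intro runs_Seq)
  qed (use assms in auto)
  have 2: "runs (loop m (dec m ;; inc i)) (st x g a b (?h 0) w) (?n * ((1 + 2) + 2) + 1)
      (st x g a b (?h ?n) w)"
  proof (rule runs_loop[where f = ?h and a = "\<lambda>_. a" and b = "\<lambda>_. b" and w = "\<lambda>_. w"])
    fix k assume k: "k < ?n"
    let ?e1 = "e(i := k, r := e r + ?n, m := ?n - Suc k)"
    have "runs (dec m) (st x g a b (?h k) w) 1 (st x g a b ?e1 w)"
      by (rule runs_decI) (use assms k in auto)
    moreover have "runs (inc i) (st x g a b ?e1 w) 2 (st x g a b (?h (Suc k)) w)"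
      by (rule runs_incI) (use assms k in auto)
    ultimately show "runs (dec m ;; inc i) (st x g a b (?h k) w) (1 + 2) (st x g a b (?h (Suc k)) w)"
      by (rule runs_Seq)
  qed (use assms in auto)
  have "?f 0 = e" "?f ?n = ?h 0" "?h ?n = e(r := e r + e i)"
    using assms by (auto simp: fun_eq_iff)
  then show ?thesis
    using runs_mono[OF runs_Seq[OF 1[unfolded \<open>?f ?n = ?h 0\<close>] 2]] by simp
qed

text \<open>The polynomial is fixed before the input, the tapes and the environment, so one bound
  serves for all runs. Naming the property keeps this quantifier alternation out of the
  inductions.\<close>

definition adds :: "nat \<Rightarrow> nat \<Rightarrow> nat \<Rightarrow> tm \<Rightarrow> nat poly \<Rightarrow> bool" where
  "adds d m r t p \<longleftrightarrow> (\<forall>x g a b e w N. (\<forall>i<d. e i \<le> N) \<longrightarrow> (\<forall>i\<ge>m. e i = 0) \<longrightarrow>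
    runs (addt m r t) (st x g a b e w) (poly p N) (st x g a b (e(r := e r + tval e t)) w))"

lemma addsD:
  assumes "adds d m r t p" "\<forall>i<d. e i \<le> N" "\<forall>i\<ge>m. e i = 0"
  shows "runs (addt m r t) (st x g a b e w) (poly p N) (st x g a b (e(r := e r + tval e t)) w)"
  using assms unfolding adds_def by blast

lemma runs_addt:
  assumes "twf d t"
  shows "d \<le> r \<Longrightarrow> r < m \<Longrightarrow> \<exists>p. adds d m r t p"
  using assms
proof (induction t arbitrary: r m)
  case (V i)
  show ?case
    unfolding adds_def
  proof (intro exI[of _ "[:2, 12:]"] allI impI)
    fix x g a b w e N assume e: "\<forall>i<d. e i \<le> N" "\<forall>i\<ge>m. e i = (0 :: nat)"
    show "runs (addt m r (V i)) (st x g a b e w) (poly [:2, 12:] N) (st x g a b (e(r := e r + tval e (V i))) w)"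
      unfolding tval.simps
      by (rule runs_mono[OF runs_copy]) (use V e in auto)
  qed
next
  case (C c)
  show ?case
    unfolding adds_def
  proof (intro exI[of _ "[:2 * c:]"] allI impI)
    fix x g a b w N and e :: "nat \<Rightarrow> nat"
    show "runs (addt m r (C c)) (st x g a b e w) (poly [:2 * c:] N) (st x g a b (e(r := e r + tval e (C c))) w)"
      using runs_const[of c r x g a b e w] by simp
  qed
next
  case (Plus t t')
  have wf: "twf d t" "twf d t'" using Plus.prems by auto
  obtain p p' where p: "adds d m r t p" and p': "adds d m r t' p'"
    using Plus.IH(1)[OF Plus.prems(1,2) wf(1)] Plus.IH(2)[OF Plus.prems(1,2) wf(2)] by blast
  show ?case
    unfolding adds_def
  proof (intro exI[of _ "p + p'"] allI impI)
    fix x g a b w e N assume e: "\<forall>i<d. e i \<le> N" "\<forall>i\<ge>m. e i = (0 :: nat)"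
    let ?e = "e(r := e r + tval e t)"
    have "tval ?e t' = tval e t'"
      using Plus.prems by (intro tval_cong[of d]) auto
    then show "runs (addt m r (Plus t t')) (st x g a b e w) (poly (p + p') N)
        (st x g a b (e(r := e r + tval e (Plus t t'))) w)"
      using runs_Seq[OF addsD[OF p, of e N x g a b w] addsD[OF p', of ?e N x g a b w]] e Plus.prems by (simp add: add.assoc)
  qed
next
  case (Mul t t')
  have wf: "twf d t" "twf d t'" using Mul.prems by auto
  have "d \<le> m" "m < m + 1" "r < m + 1" using Mul.prems by auto
  then obtain p p' where p: "adds d (m + 1) m t p" and p': "adds d (m + 1) r t' p'"
    using Mul.IH(1)[OF _ _ wf(1)] Mul.IH(2)[OF Mul.prems(1) _ wf(2)] by blast
  obtain q :: "nat poly" where q: "\<And>e N. (\<forall>i<d. e i \<le> N) \<Longrightarrow> tval e t \<le> poly q N"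
    using tval_bound[OF wf(1)] by blast
  show ?case
    unfolding adds_def
  proof (intro exI[of _ "p + (q * ((1 + p') + 2) + 1)"] allI impI)
    fix x g a b w e N assume e: "\<forall>i<d. e i \<le> N" "\<forall>i\<ge>m. e i = (0 :: nat)"
    let ?n = "tval e t"
    let ?f = "\<lambda>k. e(m := ?n - k, r := e r + k * tval e t')"
    have 1: "runs (addt (m + 1) m t) (st x g a b e w) (poly p N) (st x g a b (?f 0) w)"
    proof -
      have "e(m := e m + ?n) = ?f 0"
        using e Mul.prems by (auto simp: fun_eq_iff)
      then show ?thesis
        using addsD[OF p, of e N x g a b w] e by simp
    qed
    have 2: "runs (loop m (dec m ;; addt (m + 1) r t')) (st x g a b (?f 0) w) (?n * ((1 + poly p' N) + 2) + 1)
      (st x g a b (?f ?n) w)"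
    proof (rule runs_loop[where f = ?f and a = "\<lambda>_. a" and b = "\<lambda>_. b" and w = "\<lambda>_. w"])
      fix k assume k: "k < ?n"
      let ?h = "e(m := ?n - Suc k, r := e r + k * tval e t')"
      have "(?f k)(m := ?f k m - 1) = ?h"
        using k Mul.prems by (auto simp: fun_eq_iff)
      then have h1: "runs (dec m) (st x g a b (?f k) w) 1 (st x g a b ?h w)"
        using runs_dec[of "?f k" m x g a b w] k Mul.prems by simp
      have "tval ?h t' = tval e t'"
        using Mul.prems by (intro tval_cong[of d]) auto
      then have "?h(r := ?h r + tval ?h t') = ?f (Suc k)"
        by (auto simp: fun_eq_iff)
      then have h2: "runs (addt (m + 1) r t') (st x g a b ?h w) (poly p' N) (st x g a b (?f (Suc k)) w)"
        using addsD[OF p', of ?h N x g a b w] e Mul.prems by simp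
      show "runs (dec m ;; addt (m + 1) r t') (st x g a b (?f k) w) (1 + poly p' N)
          (st x g a b (?f (Suc k)) w)"
        by (rule runs_Seq[OF h1 h2])
    qed (use e Mul.prems in auto)
    have eq: "?f ?n = e(r := e r + tval e (Mul t t'))"
      using e by (auto simp: fun_eq_iff)
    have le: "?n * ((1 + poly p' N) + 2) + 1 \<le> poly (q * ((1 + p') + 2) + 1) N"
      using mult_le_mono1[OF q[OF e(1)], of "(1 + poly p' N) + 2"] by simp
    show "runs (addt m r (Mul t t')) (st x g a b e w) (poly (p + (q * ((1 + p') + 2) + 1)) N)
        (st x g a b (e(r := e r + tval e (Mul t t'))) w)"
      unfolding addt.simps poly_add[of p] eq[symmetric]
      by (rule runs_Seq[OF 1 runs_mono[OF 2 le]])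
  qed
qed

section \<open>Evaluation of bounded formulas\<close>

datatype fm = Less tm tm | Sym nat nat tm | Neg fm | And fm fm | Ex fm

fun sat :: "bool list \<Rightarrow> bool list \<Rightarrow> nat \<Rightarrow> (nat \<Rightarrow> nat) \<Rightarrow> fm \<Rightarrow> bool" where
  "sat x g d e (Less t t') \<longleftrightarrow> tval e t < tval e t'"
| "sat x g d e (Sym i s t) \<longleftrightarrow> bits (if i = 0 then x else g) (int (tval e t)) = s"
| "sat x g d e (Neg \<phi>) \<longleftrightarrow> \<not> sat x g d e \<phi>"
| "sat x g d e (And \<phi> \<psi>) \<longleftrightarrow> sat x g d e \<phi> \<and> sat x g d e \<psi>"
| "sat x g d e (Ex \<phi>) \<longleftrightarrow> (\<exists>v < e 1. sat x g (Suc d) (e(d := v)) \<phi>)"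

fun fwf :: "nat \<Rightarrow> fm \<Rightarrow> bool" where
  "fwf d (Less t t') \<longleftrightarrow> twf d t \<and> twf d t'"
| "fwf d (Sym i s t) \<longleftrightarrow> i \<le> 1 \<and> twf d t"
| "fwf d (Neg \<phi>) \<longleftrightarrow> fwf d \<phi>"
| "fwf d (And \<phi> \<psi>) \<longleftrightarrow> fwf d \<phi> \<and> fwf d \<psi>"
| "fwf d (Ex \<phi>) \<longleftrightarrow> fwf (Suc d) \<phi>"

text \<open>\<open>Less\<close> decrements both values, the second one truncated at 0, until the
  first is used up; something is left of the second iff the first was smaller. \<open>Sym\<close>
  records in counter \<open>d + 1\<close> how far the head has moved, in order to bring it back to
  cell 0. In \<open>Ex\<close>, counter \<open>d\<close> is the loop counter and the bound variable
  at once, and a success empties it to end the loop.\<close>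

fun eval :: "nat \<Rightarrow> fm \<Rightarrow> com" where
  "eval d (Less t t') = addt (d + 2) d t ;; addt (d + 2) (d + 1) t' ;;
     loop d (dec d ;; Cond (d + 1 + 3) 0 Skip (dec (d + 1))) ;;
     Cond (d + 1 + 3) 0 Skip (inc 2 ;; loop (d + 1) (dec (d + 1)))"
| "eval d (Sym i s t) = addt (d + 1) d t ;; loop d (dec d ;; inc (d + 1) ;; Do i None Right) ;;
     Cond i s (inc 2) Skip ;; loop (d + 1) (dec (d + 1) ;; Do i None Left)"
| "eval d (Neg \<phi>) = eval d \<phi> ;; Cond (2 + 3) 0 (inc 2) (dec 2)"
| "eval d (And \<phi> \<psi>) = eval d \<phi> ;; Cond (2 + 3) 0 Skip (dec 2 ;; eval d \<psi>)"
| "eval d (Ex \<phi>) = addt (d + 1) d (V 1) ;;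
     loop d (dec d ;; eval (d + 1) \<phi> ;; Cond (2 + 3) 0 Skip (loop d (dec d)))"

definition good :: "nat \<Rightarrow> nat \<Rightarrow> (nat \<Rightarrow> nat) \<Rightarrow> bool" where
  "good d N e \<longleftrightarrow> 3 \<le> d \<and> (\<forall>i<d. e i \<le> N) \<and> (\<forall>i\<ge>d. e i = 0) \<and> e 1 = N \<and> e 2 = 0"

lemma runs_move:
  assumes "i \<le> 1"
  shows "runs (Do i None d) (st x g (if i = 0 then a else 0) (if i = 0 then 0 else a) e w) 1
    (st x g (if i = 0 then a + offset d else 0) (if i = 0 then 0 else a + offset d) e w)"
proof -
  have "i = 0 \<or> i = Suc 0" using assms by auto
  then show ?thesis
    using runs_move0[of d x g a 0 e w] runs_move1[of d x g 0 a e w] by auto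
qed

lemma runs_Less:
  assumes "good d N e" "twf d t" "twf d t'"
    and "\<And>e. (\<forall>i<d. e i \<le> N) \<Longrightarrow> (\<forall>i\<ge>d+2. e i = 0) \<Longrightarrow>
      runs (addt (d + 2) d t) (st x g a b e w) B (st x g a b (e(d := e d + tval e t)) w)"
    and "\<And>e. (\<forall>i<d. e i \<le> N) \<Longrightarrow> (\<forall>i\<ge>d+2. e i = 0) \<Longrightarrow>
      runs (addt (d + 2) (d + 1) t') (st x g a b e w) B' (st x g a b (e(d + 1 := e (d + 1) + tval e t')) w)"
  shows "runs (eval d (Less t t')) (st x g a b e w)
    (B + (B' + ((tval e t * 6 + 1) + (3 * tval e t' + 5))))
    (st x g a b (e(2 := of_bool (tval e t < tval e t'))) w)"
proof -
  note e = assms(1)[unfolded good_def]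
  let ?m = "tval e t" and ?n = "tval e t'"
  let ?e1 = "e(d := ?m)"
  let ?f = "\<lambda>k. e(d := ?m - k, d + 1 := ?n - k)"
  have 1: "runs (addt (d + 2) d t) (st x g a b e w) B (st x g a b ?e1 w)"
    using assms(4)[of e] e by simp
  have "tval ?e1 t' = ?n"
    using assms(3) by (intro tval_cong[of d]) auto
  then have 2: "runs (addt (d + 2) (d + 1) t') (st x g a b ?e1 w) B' (st x g a b (?f 0) w)"
    using assms(5)[of ?e1] e by simp
  have 3: "runs (loop d (dec d ;; Cond (d + 1 + 3) 0 Skip (dec (d + 1)))) (st x g a b (?f 0) w)
      (?m * ((1 + (1 + 2)) + 2) + 1) (st x g a b (?f ?m) w)"
  proof (rule runs_loop[where f = ?f and a = "\<lambda>_. a" and b = "\<lambda>_. b" and w = "\<lambda>_. w"])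
    fix k assume k: "k < ?m"
    let ?h = "e(d := ?m - Suc k, d + 1 := ?n - k)"
    have "(?f k)(d := ?f k d - 1) = ?h"
      using k by (auto simp: fun_eq_iff)
    then have h1: "runs (dec d) (st x g a b (?f k) w) 1 (st x g a b ?h w)"
      using runs_dec[of "?f k" d x g a b w] k by simp
    have h2: "runs (Cond (d + 1 + 3) 0 Skip (dec (d + 1))) (st x g a b ?h w) (1 + 2) (st x g a b (?f (Suc k)) w)"
    proof (cases "?n - k = 0")
      case True
      then have eq: "?f (Suc k) = ?h" by (auto simp: fun_eq_iff)
      have "read_tape (st x g a b ?h w (d + 1 + 3)) = 0"
        using True by (subst read_st) simp
      then show ?thesis
        unfolding eq by (intro runs_mono[OF runs_CondT[OF _ runs_Skip]]) auto
    next
      case False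
      have s: "?h(d + 1 := ?h (d + 1) - 1) = ?f (Suc k)" by (auto simp: fun_eq_iff)
      show ?thesis
        unfolding s[symmetric] using False by (intro runs_CondF runs_dec, subst read_st) auto
    qed
    show "runs (dec d ;; Cond (d + 1 + 3) 0 Skip (dec (d + 1))) (st x g a b (?f k) w) (1 + (1 + 2))
        (st x g a b (?f (Suc k)) w)"
      by (rule runs_Seq[OF h1 h2])
  qed auto
  let ?r = "e(2 := of_bool (?m < ?n))"
  have 4: "runs (Cond (d + 1 + 3) 0 Skip (inc 2 ;; loop (d + 1) (dec (d + 1)))) (st x g a b (?f ?m) w)
      (3 * ?n + 3 + 2) (st x g a b ?r w)"
  proof (cases "?m < ?n")
    case False
    then have eq: "?r = ?f ?m" using e by (auto simp: fun_eq_iff)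
    have "read_tape (st x g a b (?f ?m) w (d + 1 + 3)) = 0"
      using False by (subst read_st) simp
    then show ?thesis
      unfolding eq by (intro runs_mono[OF runs_CondT[OF _ runs_Skip]]) auto
  next
    case True
    let ?h = "(?f ?m)(2 := Suc (?f ?m 2))"
    have s: "?h(d + 1 := 0) = ?r"
      using e True by (auto simp: fun_eq_iff)
    have "runs (inc 2 ;; loop (d + 1) (dec (d + 1))) (st x g a b (?f ?m) w) (2 + (3 * ?h (d + 1) + 1))
        (st x g a b ?r w)"
      unfolding s[symmetric] by (rule runs_Seq[OF runs_inc runs_clear])
    then have "runs (inc 2 ;; loop (d + 1) (dec (d + 1))) (st x g a b (?f ?m) w) (3 * ?n + 3)
        (st x g a b ?r w)"
      by (rule runs_mono) (use e in auto)
    then show ?thesis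
      using True by (intro runs_CondF, subst read_st) auto
  qed
  show ?thesis
    using runs_Seq[OF 1 runs_Seq[OF 2 runs_Seq[OF 3 4]]] by (simp add: algebra_simps)
qed


lemma runs_Sym:
  assumes "good d N e" "i \<le> 1" "twf d t"
    and "\<And>e. (\<forall>i<d. e i \<le> N) \<Longrightarrow> (\<forall>i\<ge>d+1. e i = 0) \<Longrightarrow>
      runs (addt (d + 1) d t) (st x g 0 0 e w) B (st x g 0 0 (e(d := e d + tval e t)) w)"
  shows "runs (eval d (Sym i s t)) (st x g 0 0 e w)
    (B + ((tval e t * 6 + 1) + (4 + (tval e t * 4 + 1))))
    (st x g 0 0 (e(2 := of_bool (sat x g d e (Sym i s t)))) w)"
proof -
  note e = assms(1)[unfolded good_def]
  let ?m = "tval e t"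
  let ?S = "\<lambda>a e. st x g (if i = 0 then a else 0) (if i = 0 then 0 else a) e w"
  let ?f = "\<lambda>k. e(d := ?m - k, d + 1 := k)"
  let ?r = "of_bool (sat x g d e (Sym i s t))"
  let ?h = "\<lambda>k. e(2 := ?r, d + 1 := ?m - k)"
  have "?f 0 = e(d := ?m)" using e by (auto simp: fun_eq_iff)
  then have 1: "runs (addt (d + 1) d t) (?S 0 e) B (?S (int 0) (?f 0))"
    using assms(4)[of e] e by simp
  have 2: "runs (loop d (dec d ;; inc (d + 1) ;; Do i None Right)) (?S (int 0) (?f 0))
      (?m * ((1 + (2 + 1)) + 2) + 1) (?S (int ?m) (?f ?m))"
  proof (rule runs_loop[where f = ?f and w = "\<lambda>_. w"])
    fix k assume k: "k < ?m"
    let ?e1 = "e(d := ?m - Suc k, d + 1 := k)"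
    have 1: "runs (dec d) (?S (int k) (?f k)) 1 (?S (int k) ?e1)"
      by (rule runs_decI) (use k in auto)
    have 2: "runs (inc (d + 1)) (?S (int k) ?e1) 2 (?S (int k) (?f (Suc k)))"
      by (rule runs_incI) (use k in auto)
    have eq: "int k + offset Right = int (Suc k)"
      by simp
    have 3: "runs (Do i None Right) (?S (int k) (?f (Suc k))) 1 (?S (int (Suc k)) (?f (Suc k)))"
      using runs_move[OF assms(2), of Right x g "int k" "?f (Suc k)" w] eq by metis
    show "runs (dec d ;; inc (d + 1) ;; Do i None Right) (?S (int k) (?f k)) (1 + (2 + 1))
        (?S (int (Suc k)) (?f (Suc k)))"
      by (rule runs_Seq[OF 1 runs_Seq[OF 2 3]])
  qed auto
  have eq: "?h 0 = (?f ?m)(2 := ?r)"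
    using e by (auto simp: fun_eq_iff)
  have rd: "read_tape (?S (int ?m) (?f ?m) i) = s \<longleftrightarrow> sat x g d e (Sym i s t)"
    using assms(2) by (cases "i = 0") (auto simp: st_def)
  have 3: "runs (Cond i s (inc 2) Skip) (?S (int ?m) (?f ?m)) 4 (?S (int (?m - 0)) (?h 0))"
  proof (cases "sat x g d e (Sym i s t)")
    case True
    have "?h 0 = (?f ?m)(2 := Suc ((?f ?m) 2))"
      unfolding eq using True e by (auto simp: fun_eq_iff)
    then have "runs (inc 2) (?S (int ?m) (?f ?m)) 2 (?S (int ?m) (?h 0))"
      by (rule runs_incI)
    then have r: "runs (inc 2) (?S (int ?m) (?f ?m)) 2 (?S (int (?m - 0)) (?h 0))"
      by (simp only: diff_zero)
    show ?thesis
      by (rule runs_mono[OF runs_CondT[OF _ r]], rule rd[THEN iffD2, OF True]) simp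
  next
    case False
    have h: "?h 0 = ?f ?m"
      unfolding eq using False e by (auto simp: fun_eq_iff)
    have "runs (Cond i s (inc 2) Skip) (?S (int ?m) (?f ?m)) (0 + 2) (?S (int ?m) (?f ?m))"
      by (rule runs_CondF[OF _ runs_Skip]) (use rd False in blast)
    then show ?thesis
      unfolding h unfolding diff_zero by (rule runs_mono) simp
  qed
  have 4: "runs (loop (d + 1) (dec (d + 1) ;; Do i None Left)) (?S (int (?m - 0)) (?h 0))
      (?m * ((1 + 1) + 2) + 1) (?S (int (?m - ?m)) (?h ?m))"
  proof (rule runs_loop[where f = ?h and w = "\<lambda>_. w"])
    fix k assume k: "k < ?m"
    have 1: "runs (dec (d + 1)) (?S (int (?m - k)) (?h k)) 1 (?S (int (?m - k)) (?h (Suc k)))"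
      by (rule runs_decI) (use k in auto)
    have "int (?m - k) + offset Left = int (?m - Suc k)"
      using k by (simp add: of_nat_diff)
    then have 2: "runs (Do i None Left) (?S (int (?m - k)) (?h (Suc k))) 1
        (?S (int (?m - Suc k)) (?h (Suc k)))"
      using runs_move[OF assms(2), of Left x g "int (?m - k)" "?h (Suc k)" w]
      by metis
    show "runs (dec (d + 1) ;; Do i None Left) (?S (int (?m - k)) (?h k)) (1 + 1)
        (?S (int (?m - Suc k)) (?h (Suc k)))"
      by (rule runs_Seq[OF 1 2])
  qed auto
  have "?h ?m = e(2 := ?r)"
    using e by (auto simp: fun_eq_iff)
  moreover have "st x g 0 0 e w = ?S 0 e" "st x g 0 0 (?h ?m) w = ?S (int (?m - ?m)) (?h ?m)"
    by simp_all
  ultimately show ?thesis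
    using runs_mono[OF runs_Seq[OF 1 runs_Seq[OF 2 runs_Seq[OF 3 4]]]] by simp
qed

text \<open>With \<open>v\<close> in counter \<open>d\<close>, the values below \<open>v\<close>
  remain to be tested, the largest one first. This gives an induction on \<open>v\<close> in which a
  success ends the loop at once.\<close>

lemma runs_Ex:
  assumes "good d N e" "v \<le> N"
    and "\<And>v. v < N \<Longrightarrow> runs c (st x g 0 0 (e(d := v)) w) B
      (st x g 0 0 (e(d := v, 2 := of_bool (P v))) w)"
  shows "runs (loop d (dec d ;; c ;; Cond (2 + 3) 0 Skip (loop d (dec d))))
    (st x g 0 0 (e(d := v)) w) (v * (1 + (B + (3 * N + 1 + 2)) + 2) + 1)
    (st x g 0 0 (e(2 := of_bool (\<exists>u < v. P u))) w)"
  using assms(2)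
proof (induction v)
  case 0
  have eq: "e(2 := of_bool (\<exists>u < 0. P u)) = e(d := 0)"
    using assms(1) by (auto simp: good_def fun_eq_iff)
  show ?case
    unfolding eq loop_def by (rule runs_mono[OF runs_UntilT], subst read_st) auto
next
  case (Suc v)
  let ?L = "loop d (dec d ;; c ;; Cond (2 + 3) 0 Skip (loop d (dec d)))"
  let ?b = "1 + (B + (3 * N + 1 + 2))"
  let ?r = "e(2 := of_bool (\<exists>u < Suc v. P u))"
  have d: "3 \<le> d" "e 2 = 0" "e d = 0" using assms(1) by (auto simp: good_def)
  have 1: "runs (dec d) (st x g 0 0 (e(d := Suc v)) w) 1 (st x g 0 0 (e(d := v)) w)"
    by (rule runs_decI) auto
  have 2: "runs c (st x g 0 0 (e(d := v)) w) B (st x g 0 0 (e(d := v, 2 := of_bool (P v))) w)"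
    using assms(3) Suc.prems by simp
  have 3: "runs (dec d ;; c ;; Cond (2 + 3) 0 Skip (loop d (dec d))) (st x g 0 0 (e(d := Suc v)) w) ?b ts"
    if "runs (Cond (2 + 3) 0 Skip (loop d (dec d))) (st x g 0 0 (e(d := v, 2 := of_bool (P v))) w)
      (3 * N + 1 + 2) ts" for ts
    by (rule runs_Seq[OF 1 runs_Seq[OF 2 that]])
  have nz: "read_tape (st x g 0 0 (e(d := Suc v)) w (d + 3)) \<noteq> 0"
    by (subst read_st) simp
  have "\<exists>ts. runs (Cond (2 + 3) 0 Skip (loop d (dec d))) (st x g 0 0 (e(d := v, 2 := of_bool (P v))) w)
      (3 * N + 1 + 2) ts \<and> runs ?L ts (v * (?b + 2) + 1) (st x g 0 0 ?r w)"
  proof (cases "P v")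
    case True
    have "runs (loop d (dec d)) (st x g 0 0 (e(d := v, 2 := of_bool (P v))) w) (3 * N + 1)
       (st x g 0 0 ((e(d := v, 2 := of_bool (P v)))(d := 0)) w)"
      by (rule runs_mono[OF runs_clear]) (use d Suc.prems in auto)
    then have 1: "runs (Cond (2 + 3) 0 Skip (loop d (dec d))) (st x g 0 0 (e(d := v, 2 := of_bool (P v))) w)
       (3 * N + 1 + 2) (st x g 0 0 ((e(d := v, 2 := of_bool (P v)))(d := 0)) w)"
      by (intro runs_CondF, subst read_st) (use True in auto)
    have eq: "(e(d := v, 2 := of_bool (P v)))(d := 0) = ?r"
      using d True by (auto simp: fun_eq_iff)
    have 2: "runs ?L (st x g 0 0 ?r w) (v * (?b + 2) + 1) (st x g 0 0 ?r w)"
      unfolding loop_def by (rule runs_mono[OF runs_UntilT], subst read_st) (use d in auto)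
    show ?thesis
      by (rule exI, rule conjI[OF 1[unfolded eq] 2])
  next
    case False
    have eq: "e(d := v, 2 := of_bool (P v)) = e(d := v)"
      using d False by (auto simp: fun_eq_iff)
    have "read_tape (st x g 0 0 (e(d := v)) w (2 + 3)) = 0"
      by (subst read_st) (use d in simp)
    then have 1: "runs (Cond (2 + 3) 0 Skip (loop d (dec d))) (st x g 0 0 (e(d := v)) w)
       (3 * N + 1 + 2) (st x g 0 0 (e(d := v)) w)"
      by (intro runs_mono[OF runs_CondT[OF _ runs_Skip]]) auto
    have r: "(\<exists>u < Suc v. P u) = (\<exists>u < v. P u)"
      using False less_Suc_eq by auto
    have "v \<le> N" using Suc.prems by simp
    show ?thesis
      unfolding eq r by (rule exI, rule conjI[OF 1 Suc.IH[OF \<open>v \<le> N\<close>]])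
  qed
  then obtain ts where ts: "runs (Cond (2 + 3) 0 Skip (loop d (dec d)))
      (st x g 0 0 (e(d := v, 2 := of_bool (P v))) w) (3 * N + 1 + 2) ts"
      "runs ?L ts (v * (?b + 2) + 1) (st x g 0 0 ?r w)"
    by blast
  show ?case
    by (rule runs_mono[OF runs_loopF[OF nz 3[OF ts(1)] ts(2)]]) simp
qed

lemma good_upd: "good d N e \<Longrightarrow> v \<le> N \<Longrightarrow> good (Suc d) N (e(d := v))"
  by (auto simp: good_def less_Suc_eq)

definition evals :: "nat \<Rightarrow> fm \<Rightarrow> nat poly \<Rightarrow> bool" where
  "evals d \<phi> p \<longleftrightarrow> (\<forall>x g e w N. good d N e \<longrightarrow>
    runs (eval d \<phi>) (st x g 0 0 e w) (poly p N) (st x g 0 0 (e(2 := of_bool (sat x g d e \<phi>))) w))"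

lemma evalsD:
  assumes "evals d \<phi> p" "good d N e"
  shows "runs (eval d \<phi>) (st x g 0 0 e w) (poly p N) (st x g 0 0 (e(2 := of_bool (sat x g d e \<phi>))) w)"
  using assms unfolding evals_def by blast

lemma runs_eval:
  assumes "fwf d \<phi>"
  shows "\<exists>p. evals d \<phi> p"
  using assms
proof (induction \<phi> arbitrary: d)
  case (Less t t')
  have wf: "twf d t" "twf d t'" using Less by auto
  obtain p p' where p: "adds d (d + 2) d t p" and p': "adds d (d + 2) (d + 1) t' p'"
    using runs_addt[OF wf(1), of d "d + 2"] runs_addt[OF wf(2), of "d + 1" "d + 2"] by auto
  obtain q q' :: "nat poly" where q: "\<And>e N. (\<forall>i<d. e i \<le> N) \<Longrightarrow> tval e t \<le> poly q N"
      "\<And>e N. (\<forall>i<d. e i \<le> N) \<Longrightarrow> tval e t' \<le> poly q' N"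
    using tval_bound wf by metis
  show ?case
    unfolding evals_def
  proof (intro exI[of _ "p + (p' + ((q * 6 + 1) + (3 * q' + 5)))"] allI impI)
    fix x g e w N assume g: "good d N e"
    then have e: "\<forall>i<d. e i \<le> N" by (simp add: good_def)
    show "runs (eval d (Less t t')) (st x g 0 0 e w) (poly (p + (p' + ((q * 6 + 1) + (3 * q' + 5)))) N)
       (st x g 0 0 (e(2 := of_bool (sat x g d e (Less t t')))) w)"
      unfolding sat.simps
      by (rule runs_mono[OF runs_Less[OF g wf addsD[OF p] addsD[OF p']]]) (use q[OF e] in auto)
  qed
next
  case (Sym i s t)
  have wf: "i \<le> 1" "twf d t" using Sym by auto
  obtain p where p: "adds d (d + 1) d t p"
    using runs_addt[OF wf(2), of d "d + 1"] by auto
  obtain q :: "nat poly" where q: "\<And>e N. (\<forall>i<d. e i \<le> N) \<Longrightarrow> tval e t \<le> poly q N"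
    using tval_bound wf by metis
  show ?case
    unfolding evals_def
  proof (intro exI[of _ "p + ((q * 6 + 1) + (4 + (q * 4 + 1)))"] allI impI)
    fix x g e w N assume g: "good d N e"
    then have e: "\<forall>i<d. e i \<le> N" by (simp add: good_def)
    show "runs (eval d (Sym i s t)) (st x g 0 0 e w) (poly (p + ((q * 6 + 1) + (4 + (q * 4 + 1)))) N)
       (st x g 0 0 (e(2 := of_bool (sat x g d e (Sym i s t)))) w)"
      by (rule runs_mono[OF runs_Sym[OF g wf addsD[OF p]]]) (use q[OF e] in auto)
  qed
next
  case (Neg \<phi>)
  obtain p where p: "evals d \<phi> p"
    using Neg.IH[of d] Neg.prems by auto
  show ?case
    unfolding evals_def
  proof (intro exI[of _ "p + (2 + 2)"] allI impI)
    fix x g e w N assume g: "good d N e"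
    let ?b = "sat x g d e \<phi>"
    have "runs (Cond (2 + 3) 0 (inc 2) (dec 2)) (st x g 0 0 (e(2 := of_bool ?b)) w) (2 + 2)
        (st x g 0 0 (e(2 := of_bool (\<not> ?b))) w)"
    proof (cases ?b)
      case True
      have "runs (dec 2) (st x g 0 0 (e(2 := of_bool ?b)) w) 2 (st x g 0 0 (e(2 := of_bool (\<not> ?b))) w)"
        by (rule runs_mono[OF runs_decI]) (use True in auto)
      then show ?thesis
        by (intro runs_CondF, subst read_st) (use True in auto)
    next
      case False
      have "runs (inc 2) (st x g 0 0 (e(2 := of_bool ?b)) w) 2 (st x g 0 0 (e(2 := of_bool (\<not> ?b))) w)"
        by (rule runs_incI) (use False in auto)
      then show ?thesis
        by (intro runs_CondT, subst read_st) (use False in auto)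
    qed
    from runs_Seq[OF evalsD[OF p g] this]
    show "runs (eval d (Neg \<phi>)) (st x g 0 0 e w) (poly (p + (2 + 2)) N)
       (st x g 0 0 (e(2 := of_bool (sat x g d e (Neg \<phi>)))) w)"
      unfolding eval.simps sat.simps by (rule runs_mono) simp
  qed
next
  case (And \<phi> \<psi>)
  obtain p p' where p: "evals d \<phi> p" and p': "evals d \<psi> p'"
    using And.IH[of d] And.prems by auto
  show ?case
    unfolding evals_def
  proof (intro exI[of _ "p + ((1 + p') + 2)"] allI impI)
    fix x g e w N assume g: "good d N e"
    let ?b = "sat x g d e \<phi>" and ?b' = "sat x g d e \<psi>"
    have "runs (Cond (2 + 3) 0 Skip (dec 2 ;; eval d \<psi>)) (st x g 0 0 (e(2 := of_bool ?b)) w) ((1 + poly p' N) + 2)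
        (st x g 0 0 (e(2 := of_bool (?b \<and> ?b'))) w)"
    proof (cases ?b)
      case True
      have "runs (dec 2) (st x g 0 0 (e(2 := of_bool ?b)) w) 1 (st x g 0 0 e w)"
        by (rule runs_decI) (use True g in \<open>auto simp: good_def\<close>)
      from runs_Seq[OF this evalsD[OF p' g]] show ?thesis
        by (intro runs_CondF, subst read_st) (use True in auto)
    next
      case False
      then have eq: "e(2 := of_bool (?b \<and> ?b')) = e(2 := of_bool ?b)" by auto
      show ?thesis
        unfolding eq by (rule runs_mono[OF runs_CondT[OF _ runs_Skip]], subst read_st) (use False in auto)
    qed
    from runs_Seq[OF evalsD[OF p g] this]
    show "runs (eval d (And \<phi> \<psi>)) (st x g 0 0 e w) (poly (p + ((1 + p') + 2)) N)
       (st x g 0 0 (e(2 := of_bool (sat x g d e (And \<phi> \<psi>)))) w)"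
      unfolding eval.simps sat.simps by (rule runs_mono) simp
  qed
next
  case (Ex \<phi>)
  obtain p where p: "evals (Suc d) \<phi> p"
    using Ex.IH[of "Suc d"] Ex.prems by auto
  let ?X = "[:0, 1:] :: nat poly"
  show ?case
    unfolding evals_def
  proof (intro exI[of _ "(12 * ?X + 2) + (?X * (1 + (p + (3 * ?X + 1 + 2)) + 2) + 1)"] allI impI)
    fix x g e w N assume g: "good d N e"
    then have e: "3 \<le> d" "e d = 0" "e (d + 1) = 0" "e 1 = N" by (auto simp: good_def)
    have 1: "runs (addt (d + 1) d (V 1)) (st x g 0 0 e w) (12 * N + 2) (st x g 0 0 (e(d := N)) w)"
      using runs_copy[of 1 d "d + 1" e x g 0 0 w] e by simp
    have 2: "runs (loop d (dec d ;; eval (d + 1) \<phi> ;; Cond (2 + 3) 0 Skip (loop d (dec d))))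
      (st x g 0 0 (e(d := N)) w) (N * (1 + (poly p N + (3 * N + 1 + 2)) + 2) + 1)
      (st x g 0 0 (e(2 := of_bool (\<exists>u < N. sat x g (Suc d) (e(d := u)) \<phi>))) w)"
      by (rule runs_Ex[OF g]) (use evalsD[OF p] good_upd[OF g] in auto)
    show "runs (eval d (Ex \<phi>)) (st x g 0 0 e w)
        (poly ((12 * ?X + 2) + (?X * (1 + (p + (3 * ?X + 1 + 2)) + 2) + 1)) N)
       (st x g 0 0 (e(2 := of_bool (sat x g d e (Ex \<phi>)))) w)"
      unfolding eval.simps sat.simps e(4)
      by (rule runs_mono[OF runs_Seq[OF 1 2]]) (simp add: algebra_simps)
  qed
qed

section \<open>Generators of output words\<close>

text \<open>
  \<open>For G\<close> at depth \<open>d\<close> keeps the number of remaining iterations in counter \<open>d\<close> and the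
  loop variable in counter \<open>d + 1\<close>, since the output must be produced in increasing order.
\<close>

datatype gen = Emit fm | Guard fm gen | App gen gen | For gen

fun outs :: "bool list \<Rightarrow> nat \<Rightarrow> (nat \<Rightarrow> nat) \<Rightarrow> gen \<Rightarrow> bool list" where
  "outs x d e (Emit \<phi>) = [sat x [] d e \<phi>]"
| "outs x d e (Guard \<phi> G) = (if sat x [] d e \<phi> then outs x d e G else [])"
| "outs x d e (App G G') = outs x d e G @ outs x d e G'"
| "outs x d e (For G) =
     concat (map (\<lambda>v. outs x (d + 2) (e(d := e 1 - v, d + 1 := v)) G) [0..<e 1])"

fun gwf :: "nat \<Rightarrow> gen \<Rightarrow> bool" where
  "gwf d (Emit \<phi>) \<longleftrightarrow> fwf d \<phi>"
| "gwf d (Guard \<phi> G) \<longleftrightarrow> fwf d \<phi> \<and> gwf d G"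
| "gwf d (App G G') \<longleftrightarrow> gwf d G \<and> gwf d G'"
| "gwf d (For G) \<longleftrightarrow> gwf (d + 2) G"

fun gcom :: "nat \<Rightarrow> gen \<Rightarrow> com" where
  "gcom d (Emit \<phi>) = eval d \<phi> ;; Cond (2 + 3) 0 (out False) (dec 2 ;; out True)"
| "gcom d (Guard \<phi> G) = eval d \<phi> ;; Cond (2 + 3) 0 Skip (dec 2 ;; gcom d G)"
| "gcom d (App G G') = gcom d G ;; gcom d G'"
| "gcom d (For G) = addt (d + 2) d (V 1) ;; loop d (gcom (d + 2) G ;; dec d ;; inc (d + 1)) ;;
     loop (d + 1) (dec (d + 1))"

definition emits :: "nat \<Rightarrow> gen \<Rightarrow> nat poly \<Rightarrow> bool" where
  "emits d G p \<longleftrightarrow> (\<forall>x e w N. good d N e \<longrightarrow>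
    runs (gcom d G) (st x [] 0 0 e w) (poly p N) (st x [] 0 0 e (w @ outs x d e G)))"

lemma emitsD:
  assumes "emits d G p" "good d N e"
  shows "runs (gcom d G) (st x [] 0 0 e w) (poly p N) (st x [] 0 0 e (w @ outs x d e G))"
  using assms unfolding emits_def by blast

lemma runs_gcom:
  assumes "gwf d G"
  shows "\<exists>p. emits d G p"
  using assms
proof (induction G arbitrary: d)
  case (Emit \<phi>)
  then obtain p where p: "evals d \<phi> p"
    using runs_eval[of d \<phi>] by auto
  show ?case
    unfolding emits_def
  proof (intro exI[of _ "p + (2 + 2)"] allI impI)
    fix x e w N assume g: "good d N e"
    let ?b = "sat x [] d e \<phi>"
    have "runs (Cond (2 + 3) 0 (out False) (dec 2 ;; out True)) (st x [] 0 0 (e(2 := of_bool ?b)) w) (2 + 2)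
        (st x [] 0 0 e (w @ [?b]))"
    proof (cases ?b)
      case True
      have "runs (dec 2) (st x [] 0 0 (e(2 := of_bool ?b)) w) 1 (st x [] 0 0 e w)"
        by (rule runs_decI) (use True g in \<open>auto simp: good_def\<close>)
      from runs_Seq[OF this runs_out[where c = True]] show ?thesis
        by (intro runs_CondF, subst read_st) (use True in \<open>auto simp: numeral_2_eq_2\<close>)
    next
      case False
      then have eq: "e(2 := of_bool ?b) = e" using g by (auto simp: good_def)
      have "runs (out False) (st x [] 0 0 e w) 2 (st x [] 0 0 e (w @ [?b]))"
        using False runs_mono[OF runs_out] by simp
      then show ?thesis
        unfolding eq by (intro runs_CondT, subst read_st) (use g in \<open>auto simp: good_def\<close>)
    qed
    from runs_Seq[OF evalsD[OF p g] this]
    show "runs (gcom d (Emit \<phi>)) (st x [] 0 0 e w) (poly (p + (2 + 2)) N)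
       (st x [] 0 0 e (w @ outs x d e (Emit \<phi>)))"
      unfolding gcom.simps outs.simps by (rule runs_mono) simp
  qed
next
  case (Guard \<phi> G)
  obtain p p' where p: "evals d \<phi> p" and p': "emits d G p'"
    using runs_eval[of d \<phi>] Guard.IH[of d] Guard.prems by auto
  show ?case
    unfolding emits_def
  proof (intro exI[of _ "p + ((1 + p') + 2)"] allI impI)
    fix x e w N assume g: "good d N e"
    let ?b = "sat x [] d e \<phi>"
    have "runs (Cond (2 + 3) 0 Skip (dec 2 ;; gcom d G)) (st x [] 0 0 (e(2 := of_bool ?b)) w) ((1 + poly p' N) + 2)
        (st x [] 0 0 e (w @ outs x d e (Guard \<phi> G)))"
    proof (cases ?b)
      case True
      have "runs (dec 2) (st x [] 0 0 (e(2 := of_bool ?b)) w) 1 (st x [] 0 0 e w)"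
        by (rule runs_decI) (use True g in \<open>auto simp: good_def\<close>)
      from runs_Seq[OF this emitsD[OF p' g]] show ?thesis
        by (intro runs_CondF, subst read_st) (use True in auto)
    next
      case False
      then have eq: "e(2 := of_bool ?b) = e" using g by (auto simp: good_def)
      have "st x [] 0 0 e (w @ outs x d e (Guard \<phi> G)) = st x [] 0 0 e w"
        using False by simp
      then show ?thesis
        unfolding eq using g by (intro runs_mono[OF runs_CondT], subst read_st)
          (auto simp: good_def intro: runs_Skip)
    qed
    from runs_Seq[OF evalsD[OF p g] this]
    show "runs (gcom d (Guard \<phi> G)) (st x [] 0 0 e w) (poly (p + ((1 + p') + 2)) N)
       (st x [] 0 0 e (w @ outs x d e (Guard \<phi> G)))"
      unfolding gcom.simps by (rule runs_mono) simp
  qed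
next
  case (App G G')
  obtain p p' where p: "emits d G p" and p': "emits d G' p'"
    using App.IH[of d] App.prems by auto
  show ?case
    unfolding emits_def
  proof (intro exI[of _ "p + p'"] allI impI)
    fix x e w N assume g: "good d N e"
    show "runs (gcom d (App G G')) (st x [] 0 0 e w) (poly (p + p') N)
       (st x [] 0 0 e (w @ outs x d e (App G G')))"
      using runs_Seq[OF emitsD[OF p g] emitsD[OF p' g]] by simp
  qed
next
  case (For G)
  obtain p where p: "emits (d + 2) G p"
    using For.IH[of "d + 2"] For.prems by auto
  let ?X = "[:0, 1:] :: nat poly"
  show ?case
    unfolding emits_def
  proof (intro exI[of _ "(12 * ?X + 2) + ((?X * ((p + (1 + 2)) + 2) + 1) + (3 * ?X + 1))"] allI impI)
    fix x e w N assume g: "good d N e"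
    then have e: "3 \<le> d" "e d = 0" "e (d + 1) = 0" "e 1 = N" "e (d + 2) = 0" by (auto simp: good_def)
    let ?f = "\<lambda>k. e(d := N - k, d + 1 := k)"
    let ?w = "\<lambda>k. w @ concat (map (\<lambda>v. outs x (d + 2) (?f v) G) [0..<k])"
    have "?f 0 = e(d := e d + e 1)" using e by (auto simp: fun_eq_iff)
    moreover have "runs (addt (d + 2) d (V 1)) (st x [] 0 0 e w) (12 * e 1 + 2)
        (st x [] 0 0 (e(d := e d + e 1)) w)"
      by (rule runs_copy) (use e in auto)
    ultimately have 1: "runs (addt (d + 2) d (V 1)) (st x [] 0 0 e w) (12 * N + 2)
        (st x [] 0 0 (?f 0) (?w 0))"
      using e by simp
    have 2: "runs (loop d (gcom (d + 2) G ;; dec d ;; inc (d + 1))) (st x [] 0 0 (?f 0) (?w 0))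
      (N * ((poly p N + (1 + 2)) + 2) + 1) (st x [] 0 0 (?f N) (?w N))"
    proof (rule runs_loop[where f = ?f and w = ?w and a = "\<lambda>_. 0" and b = "\<lambda>_. 0"])
      fix k assume k: "k < N"
      have g': "good (d + 2) N (?f k)"
        using g k by (auto simp: good_def)
      have eq: "?w (Suc k) = ?w k @ outs x (d + 2) (?f k) G"
        by simp
      have 1: "runs (gcom (d + 2) G) (st x [] 0 0 (?f k) (?w k)) (poly p N)
          (st x [] 0 0 (?f k) (?w (Suc k)))"
        unfolding eq by (rule emitsD[OF p g'])
      let ?e1 = "e(d := N - Suc k, d + 1 := k)"
      have 2: "runs (dec d) (st x [] 0 0 (?f k) (?w (Suc k))) 1 (st x [] 0 0 ?e1 (?w (Suc k)))"
        by (rule runs_decI) (use k in auto)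
      have 3: "runs (inc (d + 1)) (st x [] 0 0 ?e1 (?w (Suc k))) 2 (st x [] 0 0 (?f (Suc k)) (?w (Suc k)))"
        by (rule runs_incI) auto
      show "runs (gcom (d + 2) G ;; dec d ;; inc (d + 1)) (st x [] 0 0 (?f k) (?w k)) (poly p N + (1 + 2))
         (st x [] 0 0 (?f (Suc k)) (?w (Suc k)))"
        by (rule runs_Seq[OF 1 runs_Seq[OF 2 3]])
    qed auto
    have "(?f N)(d + 1 := 0) = e" using e by (auto simp: fun_eq_iff)
    then have 3: "runs (loop (d + 1) (dec (d + 1))) (st x [] 0 0 (?f N) (?w N)) (3 * N + 1)
        (st x [] 0 0 e (?w N))"
      using runs_clear[of "d + 1" x "[]" 0 0 "?f N" "?w N"] by simp
    show "runs (gcom d (For G)) (st x [] 0 0 e w)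
        (poly ((12 * ?X + 2) + ((?X * ((p + (1 + 2)) + 2) + 1) + (3 * ?X + 1))) N)
       (st x [] 0 0 e (w @ outs x d e (For G)))"
      unfolding gcom.simps outs.simps e(4)
      by (rule runs_mono[OF runs_Seq[OF 1 runs_Seq[OF 2 3]]]) (simp add: algebra_simps)
  qed
qed

section \<open>Machines for formulas and generators\<close>

text \<open>
  The output tape comes last, as required by \<open>has_output\<close>.
\<close>

definition names :: "nat \<Rightarrow> nat list" where
  "names K = 0 # 1 # [3..<K] @ [2]"

text \<open>Only the symbols are restricted here. A finite list of tapes is found afterwards by
  \<open>binary_wf\<close>, so the number of counters that a compiled formula uses never has to be
  computed.\<close>

fun binary :: "com \<Rightarrow> bool" where
  "binary Skip \<longleftrightarrow> True"
| "binary (Do i w d) \<longleftrightarrow> (\<forall>s. w = Some s \<longrightarrow> s \<le> 2)"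
| "binary (c ;; c') \<longleftrightarrow> binary c \<and> binary c'"
| "binary (Cond i s c c') \<longleftrightarrow> binary c \<and> binary c'"
| "binary (Until i s c) \<longleftrightarrow> binary c"

lemma wf_com_mono: "wf_com ns c \<Longrightarrow> set ns \<subseteq> set ns' \<Longrightarrow> wf_com ns' c"
  by (induction c) auto

lemma names_mono: "K \<le> K' \<Longrightarrow> set (names K) \<subseteq> set (names K')"
  by (auto simp: names_def)

lemma binary_wf: "binary c \<Longrightarrow> \<exists>K. wf_com (names K) c"
proof (induction c)
  case (Do i w d)
  then show ?case by (intro exI[of _ "Suc i"]) (auto simp: names_def)
next
  case (Seq c c')
  then obtain K K' where "wf_com (names K) c" "wf_com (names K') c'" by auto
  then have "wf_com (names (max K K')) c" "wf_com (names (max K K')) c'"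
    using wf_com_mono names_mono max.cobounded1 max.cobounded2 by metis+
  then show ?case by auto
next
  case (Cond i s c c')
  then obtain K K' where "wf_com (names K) c" "wf_com (names K') c'" by auto
  then have "wf_com (names (max (Suc i) (max K K'))) c" "wf_com (names (max (Suc i) (max K K'))) c'"
    using wf_com_mono[OF _ names_mono] by simp_all
  moreover have "i \<in> set (names (max (Suc i) (max K K')))"
    by (auto simp: names_def)
  ultimately show ?case by (meson wf_com.simps(4))
next
  case (Until i s c)
  then obtain K where "wf_com (names K) c" by auto
  then have "wf_com (names (max (Suc i) K)) c"
    using wf_com_mono[OF _ names_mono] by simp
  moreover have "i \<in> set (names (max (Suc i) K))"
    by (auto simp: names_def)
  ultimately show ?case by (meson wf_com.simps(5))
qed auto

lemma binary_basic [simp]: "binary (inc i)" "binary (dec i)" "binary (out b)" "binary (loop i c) = binary c"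
  by (auto simp: inc_def dec_def out_def loop_def bit_symbol_def)

lemma binary_const [simp]: "binary (((\<lambda>p. inc r ;; p) ^^ c) Skip)"
  by (induction c) auto

lemma binary_addt [simp]: "binary (addt m r t)"
  by (induction t arbitrary: m r) auto

lemma binary_eval [simp]: "binary (eval d \<phi>)"
  by (induction \<phi> arbitrary: d) auto

lemma binary_gcom [simp]: "binary (gcom d G)"
  by (induction G arbitrary: d) auto

definition env :: "tm \<Rightarrow> bool list \<Rightarrow> nat \<Rightarrow> nat" where
  "env B x = (\<lambda>_. 0)(0 := length x, 1 := tval ((\<lambda>_. 0)(0 := length x)) B)"

text \<open>Counter 3 duplicates the length during the scan; emptying it leads the head back to cell
  0.\<close>

definition load :: "tm \<Rightarrow> com" where
  "load B = Until 0 0 (inc 0 ;; inc 3 ;; Do 0 None Right) ;;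
     loop 3 (dec 3 ;; Do 0 None Left) ;; addt 3 1 B"

lemma bits_eq_0: "bits x i = 0 \<longleftrightarrow> i < 0 \<or> int (length x) \<le> i"
  by (auto simp: bits_def bit_symbol_def)

lemma bits_le: "bits x i \<le> 2"
  by (auto simp: bits_def bit_symbol_def)

lemma runs_load:
  assumes "twf 1 B"
  shows "\<exists>p :: nat poly. \<forall>x g. runs (load B) (st x g 0 0 (\<lambda>_. 0) []) (poly p (length x))
    (st x g 0 0 (env B x) [])"
proof -
  obtain p where p: "adds 1 3 1 B p"
    using runs_addt[OF assms, of 1 3] by auto
  let ?X = "[:0, 1:] :: nat poly"
  show ?thesis
  proof (intro exI[of _ "(?X * ((2 + (2 + 1)) + 2) + 1) + ((?X * ((1 + 1) + 2) + 1) + p)"] allI)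
    fix x g :: "bool list"
    let ?n = "length x"
    let ?e = "\<lambda>_ :: nat. 0 :: nat"
    let ?f = "\<lambda>k. ?e(0 := k, 3 := k)"
    let ?h = "\<lambda>k. ?e(0 := ?n, 3 := ?n - k)"
    have u: "runs (Until 0 0 (inc 0 ;; inc 3 ;; Do 0 None Right)) (st x g (int 0) 0 (?f 0) [])
        (?n * ((2 + (2 + 1)) + 2) + 1) (st x g (int ?n) 0 (?f ?n) [])"
    proof (rule runs_Until[where f = "\<lambda>k. st x g (int k) 0 (?f k) []"])
      fix k assume k: "k < ?n"
      then show "read_tape (st x g (int k) 0 (?f k) [] 0) \<noteq> 0"
        using k by (simp add: st_def bits_eq_0)
      let ?e1 = "?e(0 := Suc k, 3 := k)"
      have 1: "runs (inc 0) (st x g (int k) 0 (?f k) []) 2 (st x g (int k) 0 ?e1 [])"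
        by (rule runs_incI) auto
      have 2: "runs (inc 3) (st x g (int k) 0 ?e1 []) 2 (st x g (int k) 0 (?f (Suc k)) [])"
        by (rule runs_incI) auto
      have eq: "int (Suc k) = int k + offset Right" by simp
      have 3: "runs (Do 0 None Right) (st x g (int k) 0 (?f (Suc k)) []) 1 (st x g (int (Suc k)) 0 (?f (Suc k)) [])"
        unfolding eq by (rule runs_move0)
      show "runs (inc 0 ;; inc 3 ;; Do 0 None Right) (st x g (int k) 0 (?f k) []) (2 + (2 + 1))
          (st x g (int (Suc k)) 0 (?f (Suc k)) [])"
        by (rule runs_Seq[OF 1 runs_Seq[OF 2 3]])
    next
      show "read_tape (st x g (int ?n) 0 (?f ?n) [] 0) = 0"
        by (simp add: st_def bits_eq_0)
    qed
    have h0: "?h 0 = ?f ?n" by simp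
    have f0: "?f 0 = ?e" by auto
    have 1: "runs (Until 0 0 (inc 0 ;; inc 3 ;; Do 0 None Right)) (st x g 0 0 ?e [])
        (?n * ((2 + (2 + 1)) + 2) + 1) (st x g (int (?n - 0)) 0 (?h 0) [])"
      unfolding h0 unfolding diff_zero using u unfolding f0 of_nat_0 .
    have 2: "runs (loop 3 (dec 3 ;; Do 0 None Left)) (st x g (int (?n - 0)) 0 (?h 0) [])
        (?n * ((1 + 1) + 2) + 1) (st x g (int (?n - ?n)) 0 (?h ?n) [])"
    proof (rule runs_loop[where f = ?h and w = "\<lambda>_. []" and a = "\<lambda>k. int (?n - k)" and b = "\<lambda>_. 0"])
      fix k assume k: "k < ?n"
      have 1: "runs (dec 3) (st x g (int (?n - k)) 0 (?h k) []) 1 (st x g (int (?n - k)) 0 (?h (Suc k)) [])"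
        by (rule runs_decI) (use k in auto)
      have eq: "int (?n - Suc k) = int (?n - k) + offset Left" using k by simp
      have 2: "runs (Do 0 None Left) (st x g (int (?n - k)) 0 (?h (Suc k)) []) 1 (st x g (int (?n - Suc k)) 0 (?h (Suc k)) [])"
        unfolding eq by (rule runs_move0)
      show "runs (dec 3 ;; Do 0 None Left) (st x g (int (?n - k)) 0 (?h k) []) (1 + 1)
          (st x g (int (?n - Suc k)) 0 (?h (Suc k)) [])"
        by (rule runs_Seq[OF 1 2])
    qed auto
    have h: "?h ?n = ?e(0 := ?n)" and z: "int (?n - ?n) = 0" by auto
    have e: "env B x = (?e(0 := ?n))(1 := (?e(0 := ?n)) 1 + tval (?e(0 := ?n)) B)"
      by (auto simp: env_def)
    have 3: "runs (addt 3 1 B) (st x g (int (?n - ?n)) 0 (?h ?n) []) (poly p ?n) (st x g 0 0 (env B x) [])"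
      unfolding h e unfolding z by (rule addsD[OF p]) auto
    show "runs (load B) (st x g 0 0 ?e []) (poly ((?X * ((2 + (2 + 1)) + 2) + 1) + ((?X * ((1 + 1) + 2) + 1) + p)) ?n)
        (st x g 0 0 (env B x) [])"
      unfolding load_def by (rule runs_mono[OF runs_Seq[OF 1 runs_Seq[OF 2 3]]]) simp
  qed
qed

lemma env_bound:
  assumes "twf 1 B"
  shows "\<exists>q :: nat poly. \<forall>x. env B x 1 \<le> poly q (length x)"
proof -
  obtain q :: "nat poly" where "\<forall>e N. (\<forall>i<1. e i \<le> N) \<longrightarrow> tval e B \<le> poly q N"
    using tval_bound[OF assms] by blast
  then show ?thesis
    by (intro exI[of _ q]) (simp add: env_def)
qed

lemma good_env: "length x \<le> env B x 1 \<Longrightarrow> good 3 (env B x 1) (env B x)"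
  by (auto simp: good_def env_def less_Suc_eq numeral_3_eq_3)

lemma initial_eq:
  fixes M :: machine
  assumes "tapes M = length (names K)"
  shows "initial M x = (start M, map (st x [] 0 0 (\<lambda>_. 0) []) (names K))"
proof -
  let ?s = "st x [] 0 0 (\<lambda>_. 0) []"
  have "?s n = blank_tape" if "n \<noteq> 0" for n
    using that by (auto simp: st_def blank_tape_def ctr_def bits_def)
  then have "map ?s (1 # [3..<K] @ [2]) = replicate (length (1 # [3..<K] @ [2 :: nat])) blank_tape"
    by (intro nth_equalityI) (auto simp: nth_append nth_Cons split: nat.splits)
  moreover have "?s 0 = input_tape x"
    by (simp add: st_def input_tape_def bits_def)
  ultimately show ?thesis
    using assms by (simp add: initial_def names_def)
qed

lemma wf_tapes_st: "wf_tapes ns (st x g a b e w)"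
  by (auto simp: wf_tapes_def st_def ctr_def bits_le)

lemma trans_of_lengths:
  "(q, rs, q', acts) \<in> trans_of ns P \<Longrightarrow> length rs = length ns \<and> length acts = length ns"
  by (auto simp: trans_of_def)

lemma trans_of_det:
  "(q, rs, q1, a1) \<in> trans_of ns P \<Longrightarrow> (q, rs, q2, a2) \<in> trans_of ns P \<Longrightarrow> q1 = q2 \<and> a1 = a2"
  unfolding trans_of_def using readings_eqI by blast

lemma trans_of_state: "(q, z) \<in> trans_of ns P \<Longrightarrow> q < length P"
  by (auto simp: trans_of_def)

text \<open>All loops and quantifiers range below \<open>env B x 1\<close>, so the time is
  polynomial in this number, which is itself polynomial in the length of the input; hence
  \<open>pcompose pg q\<close>. The assumption \<open>le\<close> makes it a bound for counter 0 as
  well.\<close>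

theorem polytime_computable_outs:
  assumes G: "gwf 3 G" and B: "twf 1 B" and le: "\<And>x. length x \<le> env B x 1"
  shows "polytime_computable (\<lambda>x. outs x 3 (env B x) G)"
proof -
  let ?c = "load B ;; gcom 3 G"
  have "binary ?c" by (simp add: load_def)
  then obtain K where K: "wf_com (names K) ?c" using binary_wf by blast
  define M where "M = \<lparr>tapes = length (names K), transitions = trans_of (names K) (code ?c 0),
    start = 0, accepting = 0\<rparr>"
  interpret program M "names K" "code ?c 0" "{}"
    by unfold_locales (auto simp: M_def)
  obtain p where p: "\<forall>x g. runs (load B) (st x g 0 0 (\<lambda>_. 0) []) (poly p (length x)) (st x g 0 0 (env B x) [])"
    using runs_load[OF B] by blast
  obtain pg where pg: "emits 3 G pg"
    using runs_gcom[OF G] by blast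
  obtain q :: "nat poly" where q: "\<And>x. env B x 1 \<le> poly q (length x)"
    using env_bound[OF B] by blast
  have tm: "turing_machine M" "deterministic M"
    using finite_trans_of trans_of_lengths trans_of_det
    unfolding turing_machine_def deterministic_def M_def by (auto simp: names_def)
  \<comment> \<open>The state \<open>csize ?c\<close> lies just behind the last instruction, so no
    transition starts there.\<close>
  have halt: "halting M (csize ?c, ts)" for ts
    using trans_of_state[of "csize ?c" _ "names K" "code ?c 0"]
    unfolding halting_def step_def M_def length_code by auto
  have "\<exists>n \<le> poly (p + pcompose pg q) (length x). \<exists>c. (step M ^^ n) (initial M x) c \<and> halting M c \<and>
      has_output c (outs x 3 (env B x) G)" for x
  proof -
    let ?y = "outs x 3 (env B x) G"
    let ?s = "st x [] 0 0 (env B x) ?y"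
    have "runs ?c (st x [] 0 0 (\<lambda>_. 0) []) (poly p (length x) + poly pg (env B x 1)) ?s"
      using runs_Seq[OF p[rule_format] emitsD[OF pg good_env[OF le]]] by simp
    then obtain t where t: "t \<le> poly p (length x) + poly pg (env B x 1)"
        "exec ?c (st x [] 0 0 (\<lambda>_. 0) []) t ?s"
      unfolding runs_def by blast
    have "(step M ^^ t) (0, map (st x [] 0 0 (\<lambda>_. 0) []) (names K)) (csize ?c, map ?s (names K))"
      using exec_code[OF t(2) K wf_tapes_st, of "[]" 0 "[]"] by simp
    then have 1: "(step M ^^ t) (initial M x) (csize ?c, map ?s (names K))"
      using initial_eq[of M K x] by (simp add: M_def)
    have 2: "has_output (csize ?c, map ?s (names K)) ?y"
      by (simp add: has_output_def names_def st_def bits_def)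
    have "t \<le> poly (p + pcompose pg q) (length x)"
      using t(1) nat_poly_mono[OF q[of x], of pg] by (simp add: poly_pcompose)
    with 1 2 halt show ?thesis by blast
  qed
  with tm show ?thesis
    unfolding polytime_computable_def by blast
qed

section \<open>Guessing a certificate and verifying it\<close>

text \<open>These bounds show that the verifier never re-enters the guessing state, which is
  numbered beyond all targets.\<close>

lemma code_targets:
  "Jump i s t \<in> set (code c q) \<Longrightarrow> t \<le> q + csize c"
  "Goto t \<in> set (code c q) \<Longrightarrow> t \<le> q + csize c"
  by (induction c arbitrary: q) fastforce+

definition rewind :: "nat \<Rightarrow> com" where
  "rewind i = Do i None Left ;; Until i 0 (Do i None Left) ;; Do i None Right"

lemma runs_rewind0:
  "runs (rewind 0) (st x g (int (length x)) b e w) (1 + ((length x * (1 + 2) + 1) + 1)) (st x g 0 b e w)"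
proof -
  let ?n = "length x"
  let ?f = "\<lambda>k. st x g (int ?n - 1 - int k) b e w"
  have 1: "runs (Do 0 None Left) (st x g (int ?n) b e w) 1 (?f 0)"
    using runs_move0[of Left x g "int ?n" b e w] by simp
  have 2: "runs (Until 0 0 (Do 0 None Left)) (?f 0) (?n * (1 + 2) + 1) (?f ?n)"
  proof (rule runs_Until[where f = ?f])
    fix k assume k: "k < ?n"
    show "read_tape (?f k 0) \<noteq> 0" using k by (simp add: st_def bits_eq_0)
    show "runs (Do 0 None Left) (?f k) 1 (?f (Suc k))"
      using runs_move0[of Left x g "int ?n - 1 - int k" b e w] by (simp add: algebra_simps)
  qed (simp add: st_def bits_eq_0)
  have 3: "runs (Do 0 None Right) (?f ?n) 1 (st x g 0 b e w)"
    using runs_move0[of Right x g "int ?n - 1 - int ?n" b e w] by simp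
  show ?thesis
    unfolding rewind_def by (rule runs_Seq[OF 1 runs_Seq[OF 2 3]])
qed

lemma runs_rewind1:
  "runs (rewind (Suc 0)) (st x g a (int (length g)) e w) (1 + ((length g * (1 + 2) + 1) + 1)) (st x g a 0 e w)"
proof -
  let ?n = "length g"
  let ?f = "\<lambda>k. st x g a (int ?n - 1 - int k) e w"
  have 1: "runs (Do (Suc 0) None Left) (st x g a (int ?n) e w) 1 (?f 0)"
    using runs_move1[of Left x g a "int ?n" e w] by simp
  have 2: "runs (Until (Suc 0) 0 (Do (Suc 0) None Left)) (?f 0) (?n * (1 + 2) + 1) (?f ?n)"
  proof (rule runs_Until[where f = ?f])
    fix k assume k: "k < ?n"
    show "read_tape (?f k (Suc 0)) \<noteq> 0" using k by (simp add: st_def bits_eq_0)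
    show "runs (Do (Suc 0) None Left) (?f k) 1 (?f (Suc k))"
      using runs_move1[of Left x g a "int ?n - 1 - int k" e w] by (simp add: algebra_simps)
  qed (simp add: st_def bits_eq_0)
  have 3: "runs (Do (Suc 0) None Right) (?f ?n) 1 (st x g a 0 e w)"
    using runs_move1[of Right x g a "int ?n - 1 - int ?n" e w] by simp
  show ?thesis
    unfolding rewind_def by (rule runs_Seq[OF 1 runs_Seq[OF 2 3]])
qed

text \<open>
  While moving right over the input, the machine writes an arbitrary bit on tape 1 for each input bit.
\<close>

definition guess :: "nat list \<Rightarrow> nat \<Rightarrow> transition set" where
  "guess ns S =
     {(S, map r ns, S, map (\<lambda>n. if n = 0 then (r n, Right) else if n = 1 then (bit_symbol b, Right)
         else (r n, Stay)) ns) | r b. r \<in> readings ns \<and> r 0 \<noteq> 0} \<union>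
     {(S, map r ns, 0, map (\<lambda>n. (r n, Stay)) ns) | r. r \<in> readings ns \<and> r 0 = 0}"

lemma finite_guess: "finite (guess ns S)"
proof -
  have "guess ns S \<subseteq> (\<lambda>(r, b). (S, map r ns, S, map (\<lambda>n. if n = 0 then (r n, Right)
      else if n = 1 then (bit_symbol b, Right) else (r n, Stay)) ns)) ` (readings ns \<times> UNIV) \<union>
    (\<lambda>r. (S, map r ns, 0, map (\<lambda>n. (r n, Stay)) ns)) ` readings ns"
    unfolding guess_def by auto
  then show ?thesis
    by (rule finite_subset) (simp add: finite_readings)
qed

lemma guess_lengths:
  "(q, rs, q', acts) \<in> guess ns S \<Longrightarrow> length rs = length ns \<and> length acts = length ns"
  by (auto simp: guess_def)

lemma guess_iff:
  assumes r: "r \<in> readings ns"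
  shows "(S, map r ns, q, acts) \<in> guess ns S \<longleftrightarrow>
    (if r 0 = 0 then q = 0 \<and> acts = map (\<lambda>n. (r n, Stay)) ns
     else q = S \<and> (\<exists>b. acts = map (\<lambda>n. if n = 0 then (r n, Right)
       else if n = 1 then (bit_symbol b, Right) else (r n, Stay)) ns))"
proof -
  have eq: "r' = r" if "map r ns = map r' ns" "r' \<in> readings ns" for r'
    using readings_eqI[OF that(2) r] that(1) by simp
  show ?thesis (is "?L \<longleftrightarrow> ?R")
  proof
    assume ?L
    then show ?R
      unfolding guess_def Un_iff mem_Collect_eq prod.inject
    proof (elim disjE exE conjE, goal_cases)
      case (1 r' b)
      have "r' = r" by (rule eq) fact+
      with 1 show ?case by auto
    next
      case (2 r')
      have "r' = r" by (rule eq) fact+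
      with 2 show ?case by auto
    qed
  next
    assume ?R
    then show ?L
      unfolding guess_def using r by (cases "r 0 = 0") auto
  qed
qed

lemma bits_snoc: "bits (g @ [b]) = (bits g)(int (length g) := bit_symbol b)"
  by (auto simp: bits_def nth_append fun_eq_iff)

locale guess_machine =
  fixes M :: machine and K S :: nat and P :: "instr list"
  assumes M: "transitions M = trans_of (names K) P \<union> guess (names K) S" and S: "length P < S"
begin

lemma step_S:
  assumes "wf_tapes (names K) ts"
  shows "step M (S, map ts (names K)) c \<longleftrightarrow>
    (if read_tape (ts 0) = 0 then c = (0, map ts (names K))
     else \<exists>b. c = (S, map (ts(0 := put None Right (ts 0), 1 := put (Some (bit_symbol b)) Right (ts 1))) (names K)))"
proof -
  let ?r = "reading (names K) ts"
  have r: "?r \<in> readings (names K)" by (rule reading_in_readings) fact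
  have r0: "?r 0 = read_tape (ts 0)" by (simp add: reading_def names_def)
  have "(S, z) \<in> transitions M \<longleftrightarrow> (S, z) \<in> guess (names K) S" for z
    using M S trans_of_state by fastforce
  then have "step M (S, map ts (names K)) c \<longleftrightarrow> (\<exists>acts. (S, map ?r (names K), fst c, acts) \<in> guess (names K) S \<and>
      snd c = map2 act_tape acts (map ts (names K)))"
    unfolding step_def by (simp only: fst_conv snd_conv map_map map_reading)
  also have "\<dots> \<longleftrightarrow> (if ?r 0 = 0 then fst c = 0 \<and> snd c = map2 act_tape (map (\<lambda>n. (?r n, Stay)) (names K)) (map ts (names K))
     else \<exists>b. fst c = S \<and> snd c = map2 act_tape (map (\<lambda>n. if n = 0 then (?r n, Right)
       else if n = 1 then (bit_symbol b, Right) else (?r n, Stay)) (names K)) (map ts (names K)))"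
  proof (cases "?r 0 = 0")
    case True
    then have "(S, map ?r (names K), fst c, acts) \<in> guess (names K) S \<longleftrightarrow>
        fst c = 0 \<and> acts = map (\<lambda>n. (?r n, Stay)) (names K)" for acts
      unfolding guess_iff[OF r] by simp
    then show ?thesis using True by auto
  next
    case False
    then have "(S, map ?r (names K), fst c, acts) \<in> guess (names K) S \<longleftrightarrow>
        (\<exists>b. fst c = S \<and> acts = map (\<lambda>n. if n = 0 then (?r n, Right)
       else if n = 1 then (bit_symbol b, Right) else (?r n, Stay)) (names K))" for acts
      unfolding guess_iff[OF r] by simp
    then show ?thesis using False by auto
  qed
  finally have chain: "step M (S, map ts (names K)) c \<longleftrightarrow> \<dots>" .
  have m1: "map2 act_tape (map (\<lambda>n. (?r n, Stay)) (names K)) (map ts (names K)) = map ts (names K)"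
    unfolding map2_map by (auto simp: reading_def)
  have m2: "map2 act_tape (map (\<lambda>n. if n = 0 then (?r n, Right)
       else if n = 1 then (bit_symbol b, Right) else (?r n, Stay)) (names K)) (map ts (names K)) =
     map (ts(0 := put None Right (ts 0), 1 := put (Some (bit_symbol b)) Right (ts 1))) (names K)" for b
    unfolding map2_map by (auto simp: reading_def put_def)
  show ?thesis
    unfolding chain m1 m2 r0 by (cases c) auto
qed

definition conf :: "nat \<Rightarrow> bool list \<Rightarrow> bool list \<Rightarrow> config" where
  "conf q x g = (q, map (st x g (int (length g)) (int (length g)) (\<lambda>_. 0) []) (names K))"

lemma step_conf:
  assumes "length g \<le> length x"
  shows "step M (conf S x g) c \<longleftrightarrow>
    (if length g = length x then c = conf 0 x g else \<exists>b. c = conf S x (g @ [b]))"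
proof -
  let ?ts = "st x g (int (length g)) (int (length g)) (\<lambda>_. 0) []"
  have upd: "?ts(0 := put None Right (?ts 0), 1 := put (Some (bit_symbol b)) Right (?ts 1)) =
      st x (g @ [b]) (int (length (g @ [b]))) (int (length (g @ [b]))) (\<lambda>_. 0) []" for b
    by (auto simp: st_def put_def bits_snoc fun_eq_iff)
  have "read_tape (?ts 0) = 0 \<longleftrightarrow> length g = length x"
    using assms by (auto simp: st_def bits_eq_0)
  then show ?thesis
    unfolding conf_def step_S[OF wf_tapes_st] upd by (simp only:)
qed

text \<open>\<open>NP\<close> bounds the length of every path and not only of the accepting ones, so
  the branches of the guessing phase have to be described completely.\<close>

lemma guess_paths:
  assumes "(step M ^^ m) (conf S x g) c" "length g \<le> length x"
  shows "m \<le> length x - length g \<and> fst c = S \<or>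
    (\<exists>g' m'. length g' = length x \<and> m = length x - length g + 1 + m' \<and> (step M ^^ m') (conf 0 x g') c)"
  using assms
proof (induction m arbitrary: g)
  case 0
  then show ?case by (auto simp: conf_def)
next
  case (Suc m)
  then obtain c' where c': "step M (conf S x g) c'" "(step M ^^ m) c' c"
    by (meson relpowp_Suc_D2)
  show ?case
  proof (cases "length g = length x")
    case True
    then have "c' = conf 0 x g" using c'(1) step_conf[OF Suc.prems(2)] by simp
    then show ?thesis using c'(2) True by auto
  next
    case False
    then obtain b where "c' = conf S x (g @ [b])"
      using c'(1) step_conf[OF Suc.prems(2)] by auto
    then have "m \<le> length x - length (g @ [b]) \<and> fst c = S \<or>
    (\<exists>g' m'. length g' = length x \<and> m = length x - length (g @ [b]) + 1 + m' \<and> (step M ^^ m') (conf 0 x g') c)"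
      using c'(2) False Suc.prems(2) by (intro Suc.IH) auto
    moreover have "length x - length g = Suc (length x - length (g @ [b]))"
      using False Suc.prems(2) by simp
    ultimately show ?thesis by auto
  qed
qed

lemma guess_reach:
  assumes "length g = length x"
  shows "(step M)\<^sup>*\<^sup>* (conf S x []) (conf 0 x g)"
proof -
  have "k \<le> length g \<Longrightarrow> (step M)\<^sup>*\<^sup>* (conf S x []) (conf S x (take k g))" for k
  proof (induction k)
    case (Suc k)
    then have "step M (conf S x (take k g)) (conf S x (take k g @ [g ! k]))"
      using assms by (subst step_conf) auto
    with Suc show ?case
      by (simp add: take_Suc_conv_app_nth rtranclp.rtrancl_into_rtrancl)
  qed simp
  from this[of "length g"] have "(step M)\<^sup>*\<^sup>* (conf S x []) (conf S x g)" by simp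
  moreover have "step M (conf S x g) (conf 0 x g)"
    using assms by (subst step_conf) auto
  ultimately show ?thesis by (rule rtranclp.rtrancl_into_rtrancl)
qed

lemma step_det:
  assumes "fst c \<noteq> S" "step M c c1" "step M c c2" shows "c1 = c2"
proof -
  have "(fst c, z) \<in> transitions M \<Longrightarrow> (fst c, z) \<in> trans_of (names K) P" for z
    using M assms(1) unfolding guess_def by auto
  with assms(2,3) show ?thesis
    unfolding step_def using trans_of_det by (metis prod_eqI)
qed

text \<open>Outside the guessing state the machine is deterministic, and \<open>tgt\<close> prevents
  a return to it. Every path is thus a prefix of the one halting path, so a time bound and an
  outcome established for one run hold for all.\<close>

lemma det_paths:
  assumes tgt: "\<And>q r. q < length P \<Longrightarrow> succ_state (P ! q) q r \<noteq> S"
    and "(step M ^^ t) c c'" "halting M c'" "(step M ^^ m) c c''" "fst c \<noteq> S"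
  shows "m \<le> t \<and> (step M ^^ (t - m)) c'' c'"
  using assms(2-)
proof (induction t arbitrary: c m)
  case 0
  then have "m = 0"
    unfolding halting_def by (metis relpowp_E2 relpowp_0_E)
  with 0 show ?case by simp
next
  case (Suc t)
  show ?case
  proof (cases m)
    case 0
    with Suc.prems show ?thesis by auto
  next
    case (Suc m')
    obtain c1 where c1: "step M c c1" "(step M ^^ t) c1 c'"
      using Suc.prems(1) by (meson relpowp_Suc_D2)
    obtain c2 where c2: "step M c c2" "(step M ^^ m') c2 c''"
      using Suc.prems(3) Suc by (meson relpowp_Suc_D2)
    have "c1 = c2" using step_det Suc.prems(4) c1(1) c2(1) by blast
    moreover have "fst c1 \<noteq> S"
    proof -
      obtain rs acts where "(fst c, rs, fst c1, acts) \<in> transitions M"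
        using c1(1) unfolding step_def by blast
      then have "(fst c, rs, fst c1, acts) \<in> trans_of (names K) P"
        using M Suc.prems(4) unfolding guess_def by auto
      then obtain r where "fst c1 = succ_state (P ! fst c) (fst c) r" "fst c < length P"
        unfolding trans_of_def by auto
      then show ?thesis
        using tgt by metis
    qed
    ultimately show ?thesis
      using Suc.IH[OF c1(2) Suc.prems(2), of m'] c2(2) Suc by simp
  qed
qed

end

theorem NP_sat:
  assumes \<phi>: "fwf 3 \<phi>" and B: "twf 1 B" and le: "\<And>x. length x \<le> env B x 1"
  shows "{x. \<exists>g. length g = length x \<and> sat x g 3 (env B x) \<phi>} \<in> NP"
proof -
  let ?c = "rewind 0 ;; rewind (Suc 0) ;; load B ;; eval 3 \<phi>"
  let ?J = "Jump (2 + 3) 0 (csize ?c + 3)"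
  have "binary ?c" by (simp add: load_def rewind_def)
  then obtain K where K: "wf_com (names K) ?c" using binary_wf by blast
  \<comment> \<open>The final test reads counter 2, that is tape 5, which is among the names only
    from 6 on.\<close>
  define K' where "K' = max 6 K"
  have K: "wf_com (names K') ?c"
    using wf_com_mono[OF K names_mono] by (simp only: K'_def max.cobounded2)
  have wfJ: "wf_instr (names K') ?J"
    by (auto simp: K'_def names_def)
  define P where "P = code ?c 0 @ [?J]"
  have lenP: "length P = csize ?c + 1" by (simp only: P_def length_append length_code) simp
  \<comment> \<open>State \<open>csize ?c\<close> tests the truth value, \<open>csize ?c + 1\<close>
    accepts, \<open>csize ?c + 2\<close> guesses and \<open>csize ?c + 3\<close> rejects. Neither of
    the two final states has transitions.\<close>
  define S where "S = csize ?c + 2"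
  define M where "M = \<lparr>tapes = length (names K'), transitions = trans_of (names K') P \<union> guess (names K') S,
    start = S, accepting = csize ?c + 1\<rparr>"
  interpret program M "names K'" P "guess (names K') S"
    by unfold_locales (auto simp: M_def guess_def S_def lenP)
  interpret guess_machine M K' S P
    by unfold_locales (auto simp: M_def S_def lenP)
  obtain p where p: "\<forall>x g. runs (load B) (st x g 0 0 (\<lambda>_. 0) []) (poly p (length x)) (st x g 0 0 (env B x) [])"
    using runs_load[OF B] by blast
  obtain pg where pg: "evals 3 \<phi> pg"
    using runs_eval[OF \<phi>] by blast
  obtain q :: "nat poly" where q: "\<And>x. env B x 1 \<le> poly q (length x)"
    using env_bound[OF B] by blast
  let ?X = "[:0, 1:] :: nat poly"
  let ?R = "1 + ((?X * (1 + 2) + 1) + 1)"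
  define T where "T = ?R + (?R + (p + pcompose pg q)) + 1"
  have tgt: "succ_state (P ! i) i r \<noteq> S" if "i < length P" for i r
  proof -
    have I: "P ! i \<in> set (code ?c 0) \<union> {?J}"
      using nth_mem[OF that] unfolding P_def by auto
    have "Suc i \<noteq> S" "i \<noteq> S" using that by (auto simp: S_def lenP)
    moreover have "t \<noteq> S" if "P ! i = Jump a s t" for a s t
      using I code_targets(1)[of a s t ?c 0] unfolding that S_def by auto
    moreover have "t \<noteq> S" if "P ! i = Goto t" for t
      using I code_targets(2)[of t ?c 0] unfolding that S_def by auto
    ultimately show ?thesis by (cases "P ! i") auto
  qed
  have halt: "halting M (n, ts)" if "n = csize ?c + 1 \<or> n = csize ?c + 3" for n ts
    using that trans_of_state[of n _ "names K'" P] lenP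
    unfolding halting_def step_def M_def guess_def S_def by auto
  have run: "\<exists>t \<le> poly T (length x). \<exists>ts. (step M ^^ t) (conf 0 x g)
      (if sat x g 3 (env B x) \<phi> then csize ?c + 1 else csize ?c + 3, ts)" if g: "length g = length x" for x g
  proof -
    let ?n = "length x"
    let ?b = "sat x g 3 (env B x) \<phi>"
    let ?s = "st x g 0 0 ((env B x)(2 := of_bool ?b)) []"
    let ?ini = "st x g (int ?n) (int ?n) (\<lambda>_. 0) []"
    have 1: "runs (rewind 0) ?ini (1 + ((?n * (1 + 2) + 1) + 1)) (st x g 0 (int ?n) (\<lambda>_. 0) [])"
      by (rule runs_rewind0)
    have 2: "runs (rewind (Suc 0)) (st x g 0 (int ?n) (\<lambda>_. 0) []) (1 + ((?n * (1 + 2) + 1) + 1)) (st x g 0 0 (\<lambda>_. 0) [])"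
      using runs_rewind1[of x g 0 "\<lambda>_. 0" "[]"] unfolding g .
    have "runs ?c ?ini ((1 + ((?n * (1 + 2) + 1) + 1)) + ((1 + ((?n * (1 + 2) + 1) + 1)) + (poly p ?n + poly pg (env B x 1)))) ?s"
      by (rule runs_Seq[OF 1 runs_Seq[OF 2 runs_Seq[OF p[rule_format] evalsD[OF pg good_env[OF le]]]]])
    then obtain t where t: "t \<le> (1 + ((?n * (1 + 2) + 1) + 1)) + ((1 + ((?n * (1 + 2) + 1) + 1)) + (poly p ?n + poly pg (env B x 1)))"
        "exec ?c ?ini t ?s"
      unfolding runs_def by blast
    have 3: "(step M ^^ t) (0, map ?ini (names K')) (csize ?c, map ?s (names K'))"
      using exec_code[OF t(2) K wf_tapes_st, of "[]" 0 "[?J]"] by (simp add: P_def)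
    have rd: "reading (names K') ?s (2 + 3) = of_bool ?b"
      using wfJ by (simp add: reading_def st_def env_def)
    have "(step M ^^ 1) (csize ?c, map ?s (names K'))
        (succ_state ?J (csize ?c) (reading (names K') ?s), map (after ?J ?s) (names K'))"
      by (rule step_instr[of "code ?c 0" _ "[]"]) (use wfJ in \<open>simp_all only: P_def length_code wf_tapes_st\<close>)
    moreover have "succ_state ?J (csize ?c) (reading (names K') ?s) = (if ?b then csize ?c + 1 else csize ?c + 3)"
      unfolding succ_state.simps rd by simp
    ultimately have 4: "(step M ^^ 1) (csize ?c, map ?s (names K'))
        (if ?b then csize ?c + 1 else csize ?c + 3, map (after ?J ?s) (names K'))"
      by (simp only:)
    have "t + 1 \<le> poly T ?n"
      using t(1) nat_poly_mono[OF q[of x], of pg] by (simp add: poly_pcompose T_def)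
    moreover have "(step M ^^ (t + 1)) (conf 0 x g)
      (if ?b then csize ?c + 1 else csize ?c + 3, map (after ?J ?s) (names K'))"
      unfolding conf_def g by (rule relpowp_cat[OF 3 4])
    ultimately show ?thesis by blast
  qed
  have init: "initial M x = conf S x []" for x
    using initial_eq[of M K' x] by (simp add: M_def conf_def)
  have S0: "fst (conf 0 x g) \<noteq> S" for x g by (simp add: conf_def S_def)
  have bound: "n \<le> poly (?X + 1 + T) (length x)" if "(step M ^^ n) (initial M x) c" for x n c
  proof -
    have "n \<le> length x \<and> fst c = S \<or> (\<exists>g m. length g = length x \<and> n = length x + 1 + m \<and>
        (step M ^^ m) (conf 0 x g) c)"
      using guess_paths[OF that[unfolded init]] by simp
    then show ?thesis
    proof (elim disjE exE conjE, goal_cases)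
      case (2 g m)
      obtain t ts where t: "t \<le> poly T (length x)" "(step M ^^ t) (conf 0 x g)
        (if sat x g 3 (env B x) \<phi> then csize ?c + 1 else csize ?c + 3, ts)"
        using run[OF 2(1)] by blast
      have "m \<le> t"
        using det_paths[OF tgt t(2) halt 2(3) S0] by (auto split: if_splits)
      then show ?case using 2 t(1) by simp
    qed simp_all
  qed
  have acc: "accepts M x \<longleftrightarrow> (\<exists>g. length g = length x \<and> sat x g 3 (env B x) \<phi>)" for x
  proof
    assume "accepts M x"
    then obtain n c where c: "(step M ^^ n) (conf S x []) c" "fst c = csize ?c + 1"
      unfolding accepts_def init by (auto simp: M_def dest!: rtranclp_imp_relpowp)
    have "fst c \<noteq> S" using c(2) by (simp only: S_def)
    then obtain g m where g: "length g = length x" "(step M ^^ m) (conf 0 x g) c"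
      using guess_paths[OF c(1)] by auto
    obtain t ts where t: "(step M ^^ t) (conf 0 x g)
      (if sat x g 3 (env B x) \<phi> then csize ?c + 1 else csize ?c + 3, ts)"
      using run[OF g(1)] by blast
    have r: "(step M ^^ (t - m)) c (if sat x g 3 (env B x) \<phi> then csize ?c + 1 else csize ?c + 3, ts)"
      using det_paths[OF tgt t halt g(2) S0] by (auto split: if_splits)
    have "halting M c" using halt[of "fst c" "snd c"] c(2) unfolding prod.collapse by blast
    with r have "c = (if sat x g 3 (env B x) \<phi> then csize ?c + 1 else csize ?c + 3, ts)"
      unfolding halting_def by (metis relpowp_E2 relpowp_0_E)
    with c(2) have "sat x g 3 (env B x) \<phi>" by (auto split: if_splits)
    with g(1) show "\<exists>g. length g = length x \<and> sat x g 3 (env B x) \<phi>" by blast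
  next
    assume "\<exists>g. length g = length x \<and> sat x g 3 (env B x) \<phi>"
    then obtain g where g: "length g = length x" "sat x g 3 (env B x) \<phi>" by blast
    obtain t ts where "(step M ^^ t) (conf 0 x g) (csize ?c + 1, ts)"
      using run[OF g(1)] g(2) by auto
    then have "(step M)\<^sup>*\<^sup>* (conf S x []) (csize ?c + 1, ts)"
      using guess_reach[OF g(1)] by (meson relpowp_imp_rtranclp rtranclp_trans)
    then show "accepts M x"
      unfolding accepts_def init by (auto simp: M_def)
  qed
  have "length rs = length (names K') \<and> length acts = length (names K')"
    if "(q, rs, q', acts) \<in> transitions M" for q rs q' acts
    using that trans_of_lengths guess_lengths unfolding trans by blast
  moreover have "finite (transitions M)"
    unfolding trans by (simp add: finite_trans_of finite_guess)
  moreover have "tapes M = length (names K')" "0 < length (names K')"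
    by (simp_all add: M_def names_def)
  ultimately have "turing_machine M"
    unfolding turing_machine_def by auto
  then show ?thesis
    unfolding NP_def using bound acc by (intro CollectI exI[of _ M] exI[of _ "?X + 1 + T"]) auto
qed

section \<open>Constraint satisfaction problems as ordered matchings\<close>

definition morphism :: "'a :: linorder set \<Rightarrow> 'b :: linorder set \<Rightarrow> ('a \<Rightarrow> 'a \<Rightarrow> bool) \<Rightarrow> ('b \<Rightarrow> 'b \<Rightarrow> bool) \<Rightarrow>
    ('a \<Rightarrow> 'b) \<Rightarrow> bool" where
  "morphism S T E E' f \<longleftrightarrow> f ` S \<subseteq> T \<and> mono_on S f \<and> (\<forall>u\<in>S. \<forall>v\<in>S. E u v \<longrightarrow> E' (f u) (f v))"

text \<open>
  \<open>Sep b s\<close> with \<open>s < 4\<close> are the separators in front of block \<open>b\<close>. \<open>U g j a g' b\<close> is the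
  vertex in the block of group \<open>g\<close> for item \<open>a\<close> and the item \<open>b\<close> of group \<open>g'\<close>; it
  belongs to the choice \<open>j\<close>. Its partner \<open>W g j a g' b\<close> lies in the block of the pair. The source has
  the single choice \<open>j = 0\<close> only.
\<close>

datatype vertex =
    Sep "nat list" nat
  | U nat nat nat nat nat
  | W nat nat nat nat nat

fun swap :: "nat \<Rightarrow> nat" where
  "swap s = (if s = 0 then 1 else if s = 1 then 0 else if s = 2 then 3 else 2)"

fun partner :: "vertex \<Rightarrow> vertex" where
  "partner (Sep b s) = Sep b (swap s)"
| "partner (U g j a g' b) = W g j a g' b"
| "partner (W g j a g' b) = U g j a g' b"

fun block :: "vertex \<Rightarrow> nat list" where
  "block (Sep b s) = b"
| "block (U g j a g' b) = [0, g]"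
| "block (W g j a g' b) = (if g < g' then [1, g, a, g', b] else [1, g', b, g, a])"

fun level :: "vertex \<Rightarrow> nat" where
  "level (Sep b s) = s"
| "level _ = 4"

type_synonym compat = "nat \<Rightarrow> nat \<Rightarrow> nat \<Rightarrow> nat \<Rightarrow> bool"

text \<open>
  The vertices are ordered lexicographically by their keys. Within the block of an incompatible pair, the
  ranks 4 to 7 place the vertices for \<open>j = a\<close> of the first item behind those of the second item, so
  that not both choices are possible. The source arises from the relation that is always true.
\<close>

fun key :: "compat \<Rightarrow> vertex \<Rightarrow> nat list" where
  "key R (Sep b s) = b @ s # replicate (6 - length b) 0"
| "key R (U g j a g' b) = [0, g, 4, j, a, g', b]"
| "key R (W g j a g' b) =
     (if g < g' then [1, g, a, g', b, if \<not> R g a g' b \<and> j = a then 6 else 4, j]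
      else [1, g', b, g, a, if \<not> R g' b g a \<and> j = a then 5 else 7, j])"

definition blocks :: "nat \<Rightarrow> nat \<Rightarrow> nat list set" where
  "blocks G D = {[0, g] | g. g < G} \<union> {[1, g, a, g', b] | g a g' b. g < g' \<and> g' < G \<and> a < D \<and> b < D}"

definition vertices :: "nat \<Rightarrow> nat \<Rightarrow> nat \<Rightarrow> vertex set" where
  "vertices G D J = {Sep b s | b s. b \<in> blocks G D \<and> s < 4} \<union>
     {U g j a g' b | g j a g' b. g < G \<and> g' < G \<and> g \<noteq> g' \<and> j < J \<and> a < D \<and> b < D} \<union>
     {W g j a g' b | g j a g' b. g < G \<and> g' < G \<and> g \<noteq> g' \<and> j < J \<and> a < D \<and> b < D}"

lemma vertices_simps [simp]:
  "Sep b s \<in> vertices G D J \<longleftrightarrow> b \<in> blocks G D \<and> s < 4"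
  "U g j a g' b' \<in> vertices G D J \<longleftrightarrow> g < G \<and> g' < G \<and> g \<noteq> g' \<and> j < J \<and> a < D \<and> b' < D"
  "W g j a g' b' \<in> vertices G D J \<longleftrightarrow> g < G \<and> g' < G \<and> g \<noteq> g' \<and> j < J \<and> a < D \<and> b' < D"
  by (auto simp: vertices_def)

lemma blocks_cases:
  assumes "b \<in> blocks G D"
  obtains g where "b = [0, g]" "g < G"
  | g a g' c where "b = [1, g, a, g', c]" "g < g'" "g' < G" "a < D" "c < D"
  using assms unfolding blocks_def by auto

lemma blocks_simps [simp]:
  "[0, g] \<in> blocks G D \<longleftrightarrow> g < G"
  "[Suc 0, g, a, g', c] \<in> blocks G D \<longleftrightarrow> g < g' \<and> g' < G \<and> a < D \<and> c < D"
  by (auto simp: blocks_def)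

lemma finite_blocks: "finite (blocks G D)"
proof -
  have "blocks G D \<subseteq> (\<lambda>g. [0, g]) ` {..<G} \<union>
      (\<lambda>(g, a, g', b). [1, g, a, g', b]) ` ({..<G} \<times> {..<D} \<times> {..<G} \<times> {..<D})"
    unfolding blocks_def by (auto simp: image_iff)
  then show ?thesis by (rule finite_subset) auto
qed

lemma partner_vertices: "v \<in> vertices G D J \<Longrightarrow> partner v \<in> vertices G D J"
  by (cases v) auto

lemma partner_partner: "v \<in> vertices G D J \<Longrightarrow> partner (partner v) = v"
  by (cases v) auto

lemma partner_neq: "v \<in> vertices G D J \<Longrightarrow> partner v \<noteq> v"
  by (cases v) auto

lemma block_in_blocks: "v \<in> vertices G D J \<Longrightarrow> block v \<in> blocks G D"
  by (cases v) auto

lemma level_le: "v \<in> vertices G D J \<Longrightarrow> level v \<le> 4"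
  by (cases v) auto

lemma level_less: "v \<in> vertices G D J \<Longrightarrow> level v < 4 \<Longrightarrow> v = Sep (block v) (level v)"
  by (cases v) auto

lemma level_4:
  "v \<in> vertices G D J \<Longrightarrow> level v = 4 \<Longrightarrow> level (partner v) = 4 \<and> block (partner v) \<noteq> block v"
  by (cases v) auto

text \<open>A key consists of the block, then the level of a separator or a number that is at least
  4 for any other vertex. Blocks of different lengths already differ in their first entry.\<close>

lemma key_position:
  assumes "u \<in> vertices G D J" "v \<in> vertices G D J" "key R u \<le> key R v"
  shows "(block u, level u) \<le> (block v, level v)"
proof -
  have "[0 :: nat, g] < [Suc 0, g1, a, g', c]" for g g1 a g' c by simp
  then show ?thesis
    using assms by (cases u; cases v) (auto split: if_splits elim!: blocks_cases)
qed

text \<open>The two vertices of a pair with equal \<open>j\<close> are told apart by the parity of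
  the rank: 4 or 6 for the smaller group, 5 or 7 for the larger one.\<close>

lemma key_inj:
  assumes "u \<in> vertices G D J" "v \<in> vertices G D J" "key R u = key R v"
  shows "u = v"
  using assms by (cases u; cases v) (auto split: if_splits elim!: blocks_cases)

text \<open>The lexicographic order on lists is not well-founded, so induction along the blocks
  relies on the finiteness of their set.\<close>

lemma finite_linorder_induct:
  fixes B :: "'b :: linorder set"
  assumes "finite B" "b \<in> B" "\<And>b. b \<in> B \<Longrightarrow> (\<And>c. c \<in> B \<Longrightarrow> c < b \<Longrightarrow> P c) \<Longrightarrow> P b"
  shows "P b"
proof (rule ccontr)
  assume "\<not> P b"
  then have ne: "{b \<in> B. \<not> P b} \<noteq> {}" using assms(2) by auto
  have fin: "finite {b \<in> B. \<not> P b}" using assms(1) by auto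
  have "\<not> P (Min {b \<in> B. \<not> P b})" "Min {b \<in> B. \<not> P b} \<in> B"
    using Min_in[OF fin ne] by auto
  then show False
    using assms(3) Min_le[OF fin] by (metis (mono_tags, lifting) leD mem_Collect_eq)
qed

lemma finite_linorder_induct_down:
  fixes B :: "'b :: linorder set"
  assumes "finite B" "b \<in> B" "\<And>b. b \<in> B \<Longrightarrow> (\<And>c. c \<in> B \<Longrightarrow> b < c \<Longrightarrow> P c) \<Longrightarrow> P b"
  shows "P b"
proof (rule ccontr)
  assume "\<not> P b"
  then have ne: "{b \<in> B. \<not> P b} \<noteq> {}" using assms(2) by auto
  have fin: "finite {b \<in> B. \<not> P b}" using assms(1) by auto
  have "\<not> P (Max {b \<in> B. \<not> P b})" "Max {b \<in> B. \<not> P b} \<in> B"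
    using Max_in[OF fin ne] by auto
  then show False
    using assms(3) Max_ge[OF fin] by (metis (mono_tags, lifting) leD mem_Collect_eq)
qed

section \<open>Rigidity of the separators\<close>

text \<open>The pairs of positions, given as block and level, that the ends of an edge can have in
  increasing order: the first two separators of a block, the last two, or inner vertices of two
  different blocks.\<close>

definition linked :: "'b :: linorder \<times> nat \<Rightarrow> 'b \<times> nat \<Rightarrow> bool" where
  "linked p q \<longleftrightarrow> p < q \<and> ((\<exists>c. p = (c, 0) \<and> q = (c, 1)) \<or> (\<exists>c. p = (c, 2) \<and> q = (c, 3)) \<or>
     (\<exists>c c'. p = (c, 4) \<and> q = (c', 4)))"

text \<open>
  By induction on the blocks from below and from above, the image of a separator edge reaches at least as
  far to the right and to the left as the edge itself. Since there are two such edges in a row, the end of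
  the first and the start of the second are squeezed, which leaves no freedom.
\<close>

lemma separators_fixed:
  fixes x :: "'b :: linorder \<Rightarrow> nat \<Rightarrow> 'b \<times> nat"
  assumes fin: "finite B"
    and mem: "\<And>b s. b \<in> B \<Longrightarrow> s < 4 \<Longrightarrow> fst (x b s) \<in> B \<and> snd (x b s) \<le> 4"
    and mono: "\<And>b s c t. b \<in> B \<Longrightarrow> c \<in> B \<Longrightarrow> s < 4 \<Longrightarrow> t < 4 \<Longrightarrow> (b, s) \<le> (c, t) \<Longrightarrow> x b s \<le> x c t"
    and l0: "\<And>b. b \<in> B \<Longrightarrow> linked (x b 0) (x b 1)"
    and l2: "\<And>b. b \<in> B \<Longrightarrow> linked (x b 2) (x b 3)"
    and b: "b \<in> B"
  shows "x b 0 = (b, 0) \<and> x b 1 = (b, 1) \<and> x b 2 = (b, 2) \<and> x b 3 = (b, 3)"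
proof -
  have up: "b \<in> B \<Longrightarrow> (b, 1) \<le> x b 1 \<and> (b, 3) \<le> x b 3" for b
  proof (induction b rule: finite_linorder_induct[OF fin, consumes 1, case_names step])
    case (step b)
    obtain c l where q: "x b 1 = (c, l)" by fastforce
    have cl: "c \<in> B" "l \<le> 4" using mem[of b 1] step(1) q by auto
    have 1: "(b, 1) \<le> x b 1"
    proof (rule ccontr)
      assume n: "\<not> (b, 1) \<le> x b 1"
      show False
      proof (cases "c = b")
        case True
        with n q have "l = 0" by auto
        with q l0[OF step(1)] show False unfolding linked_def by auto
      next
        \<comment> \<open>Now \<open>x b 0\<close> is at least \<open>(c, 3)\<close> and below
          \<open>(c, l)\<close> with \<open>l \<le> 4\<close>. The edge would join the last
          separator of a block to an inner vertex of that block.\<close>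
        case False
        with n q have "c < b" by auto
        then have "(c, 3) \<le> x c 3" "x c 3 \<le> x b 0"
          using step(2)[OF cl(1)] mono[of c b 3 0] step(1) cl(1) by auto
        then have "(c, 3) \<le> x b 0" by (rule order_trans)
        with q cl(2) l0[OF step(1)] show False unfolding linked_def by auto
      qed
    qed
    have "(b, 1) \<le> x b 2" using 1 mono[of b b 1 2] step(1) order_trans by auto
    then have "(b, 3) \<le> x b 3"
      using l2[OF step(1)] unfolding linked_def by auto
    with 1 show ?case by simp
  qed
  have down: "b \<in> B \<Longrightarrow> x b 0 \<le> (b, 0) \<and> x b 2 \<le> (b, 2)" for b
  proof (induction b rule: finite_linorder_induct_down[OF fin, consumes 1, case_names step])
    case (step b)
    have lim: "x b 3 \<le> (c, 0)" if "c \<in> B" "b < c" for c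
      using step(2)[OF that(1,2)] mono[of b c 3 0] step(1) that order_trans by auto
    obtain c l where p: "x b 2 = (c, l)" by fastforce
    obtain c' l' where q: "x b 3 = (c', l')" by fastforce
    have cl: "c \<in> B" "l \<le> 4" "c' \<in> B" using mem[of b 2] mem[of b 3] step(1) p q by auto
    have 1: "x b 2 \<le> (b, 2)"
    proof (rule ccontr)
      assume n: "\<not> x b 2 \<le> (b, 2)"
      show False
      proof (cases "c = b")
        \<comment> \<open>An edge that starts in block \<open>b\<close> above level 2 starts at an
          inner vertex. Its other end is then an inner vertex of a later block, beyond the
          separators that \<open>lim\<close> says it cannot pass.\<close>
        case True
        with n p q l2[OF step(1)] have "l' = 4" "b < c'" unfolding linked_def by auto
        with lim[of c'] cl q show False by auto
      next
        case False
        with n p have "b < c" by auto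
        from lim[OF cl(1) this] p l2[OF step(1)] show False unfolding linked_def by auto
      qed
    qed
    have "x b 1 \<le> (b, 2)" using 1 mono[of b b 1 2] step(1) order_trans by auto
    then have "x b 0 \<le> (b, 0)"
      using l0[OF step(1)] unfolding linked_def by auto
    with 1 show ?case by simp
  qed
  have "x b 1 \<le> x b 2" using mono[of b b 1 2] b by auto
  moreover from this have "x b 1 \<le> (b, 2)" using down[OF b] order_trans by blast
  ultimately have 1: "x b 1 = (b, 1)"
    using up[OF b] down[OF b] l0[OF b] unfolding linked_def by auto
  then have 2: "x b 2 = (b, 2)"
    using \<open>x b 1 \<le> x b 2\<close> down[OF b] l2[OF b] unfolding linked_def by auto
  show ?thesis
    using 1 2 l0[OF b] l2[OF b] unfolding linked_def by auto
qed

section \<open>Equivalence of solutions and morphisms\<close>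

definition solvable :: "nat \<Rightarrow> nat \<Rightarrow> compat \<Rightarrow> bool" where
  "solvable G D R \<longleftrightarrow> (\<exists>s. (\<forall>g<G. s g < D) \<and> (\<forall>g g'. g < g' \<longrightarrow> g' < G \<longrightarrow> R g (s g) g' (s g')))"

text \<open>
  Knaster and Tarski for a finite chain, with several copies \<open>i\<close> of the map: at the largest
  \<open>a\<close> that all copies map to at least \<open>a\<close>, monotonicity forces all copies to be equal to \<open>a\<close>.
\<close>

lemma fixed_choice:
  fixes z :: "nat \<Rightarrow> 'i \<Rightarrow> nat"
  assumes "0 < D" "\<And>a i. a < D \<Longrightarrow> i \<in> I \<Longrightarrow> z a i < D"
    and mono: "\<And>a a' i i'. a < a' \<Longrightarrow> a' < D \<Longrightarrow> i \<in> I \<Longrightarrow> i' \<in> I \<Longrightarrow> z a i \<le> z a' i'"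
  shows "\<exists>a<D. \<forall>i\<in>I. z a i = a"
proof -
  let ?P = "\<lambda>a. a < D \<and> (\<forall>i\<in>I. a \<le> z a i)"
  have "?P 0" using assms(1) by simp
  then have P: "?P (Greatest ?P)"
    by (rule GreatestI_nat[where b = D]) simp
  let ?a = "Greatest ?P"
  have "z ?a i \<le> ?a" if i: "i \<in> I" for i
  proof (cases "Suc ?a < D")
    case True
    \<comment> \<open>By maximality some copy of \<open>Suc ?a\<close> has a value of at most
      \<open>?a\<close>, and monotonicity passes this bound on to every copy of
      \<open>?a\<close>.\<close>
    have "\<not> ?P (Suc ?a)"
      using Greatest_le_nat[of ?P "Suc ?a" D] by auto
    then obtain i' where "i' \<in> I" "z (Suc ?a) i' \<le> ?a" using True by auto
    then show ?thesis using mono[of ?a "Suc ?a" i i'] True i by simp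
  next
    case False
    then show ?thesis using assms(2)[of ?a i] P i by linarith
  qed
  with P show ?thesis by (intro exI[of _ ?a]) (auto intro!: antisym)
qed

definition adjacent :: "compat \<Rightarrow> vertex set \<Rightarrow> nat list \<Rightarrow> nat list \<Rightarrow> bool" where
  "adjacent R vs x y \<longleftrightarrow> (\<exists>v\<in>vs. x = key R v \<and> y = key R (partner v))"

text \<open>A constant choice within each group keeps the order of the remaining entries. Inside the
  block of a pair the ranks are reversed only if they are 6 and 5, which means that \<open>s\<close>
  selects both items of an incompatible pair.\<close>

lemma mono_lift:
  assumes "u \<in> vertices G D 1" "v \<in> vertices G D 1"
    and s: "\<And>g g'. g < g' \<Longrightarrow> g' < G \<Longrightarrow> R g (s g) g' (s g')"
    and le: "key (\<lambda>_ _ _ _. True) u \<le> key (\<lambda>_ _ _ _. True) v"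
    and lift: "lift = case_vertex Sep (\<lambda>g j. U g (s g)) (\<lambda>g j. W g (s g))"
  shows "key R (lift u) \<le> key R (lift v)"
  using assms(1,2) le unfolding lift
  by (cases u; cases v) (auto split: if_splits elim!: blocks_cases dest: s)

theorem solvable_iff_morphism:
  assumes D: "0 < D"
  defines "T \<equiv> \<lambda>_ _ _ _. True"
  shows "solvable G D R \<longleftrightarrow>
    (\<exists>f. morphism (key T ` vertices G D 1) (key R ` vertices G D D)
      (adjacent T (vertices G D 1)) (adjacent R (vertices G D D)) f)"
    (is "_ \<longleftrightarrow> (\<exists>f. morphism ?S ?T ?E ?E' f)")
proof
  assume "solvable G D R"
  then obtain s where s: "\<And>g. g < G \<Longrightarrow> s g < D"
    "\<And>g g'. g < g' \<Longrightarrow> g' < G \<Longrightarrow> R g (s g) g' (s g')"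
    unfolding solvable_def by blast
  define lift where "lift = case_vertex Sep (\<lambda>g j. U g (s g)) (\<lambda>g j. W g (s g))"
  define f where "f x = key R (lift (inv_into (vertices G D 1) (key T) x))" for x
  have inj: "inj_on (key T) (vertices G D 1)"
    using key_inj by (intro inj_onI)
  have f: "f (key T v) = key R (lift v)" if "v \<in> vertices G D 1" for v
    using inv_into_f_f[OF inj that] by (simp add: f_def)
  have lift_in: "lift v \<in> vertices G D D" if "v \<in> vertices G D 1" for v
    using that s(1) by (cases v) (auto simp: lift_def)
  have lift_partner: "lift (partner v) = partner (lift v)" for v
    by (cases v) (auto simp: lift_def)
  have "morphism ?S ?T ?E ?E' f"
    unfolding morphism_def
  proof (intro conjI ballI impI mono_onI)
    show "f ` ?S \<subseteq> ?T" using f lift_in by auto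
  next
    fix x y assume "x \<in> ?S" "y \<in> ?S" "x \<le> y"
    then obtain u v where uv: "u \<in> vertices G D 1" "v \<in> vertices G D 1" "x = key T u" "y = key T v"
      "key T u \<le> key T v"
      by auto
    have "key R (lift u) \<le> key R (lift v)"
      by (rule mono_lift[where s = s, OF uv(1,2) _ uv(5)[unfolded T_def] lift_def]) (rule s(2))
    then show "f x \<le> f y"
      using f uv by simp
  next
    fix x y assume "?E x y"
    then obtain v where v: "v \<in> vertices G D 1" "x = key T v" "y = key T (partner v)"
      unfolding adjacent_def by blast
    then show "?E' (f x) (f y)"
      unfolding adjacent_def using f[of v] f[OF partner_vertices] lift_in[of v] lift_partner by auto
  qed
  then show "\<exists>f. morphism ?S ?T ?E ?E' f" by blast
next
  assume "\<exists>f. morphism ?S ?T ?E ?E' f"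
  then obtain f where "morphism ?S ?T ?E ?E' f" ..
  note f = this[unfolded morphism_def, THEN conjunct1]
    this[unfolded morphism_def, THEN conjunct2, THEN conjunct1]
    this[unfolded morphism_def, THEN conjunct2, THEN conjunct2, rule_format]
  let ?V = "vertices G D 1" and ?V' = "vertices G D D"
  have "\<exists>w\<in>?V'. f (key T v) = key R w" if "v \<in> ?V" for v
    using f(1) that by auto
  then obtain F where F: "\<And>v. v \<in> ?V \<Longrightarrow> F v \<in> ?V' \<and> f (key T v) = key R (F v)" by metis
  have partner: "F (partner v) = partner (F v)" if v: "v \<in> ?V" for v
  proof -
    have "?E (key T v) (key T (partner v))" using v by (auto simp: adjacent_def)
    then have "?E' (key R (F v)) (key R (F (partner v)))"
      using f(3)[of "key T v" "key T (partner v)"] F v partner_vertices by auto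
    then obtain w where w: "w \<in> ?V'" "key R (F v) = key R w" "key R (F (partner v)) = key R (partner w)"
      unfolding adjacent_def by blast
    have "F v = w"
      by (rule key_inj[OF _ w(1,2)]) (use F v in blast)
    moreover have "F (partner v) = partner w"
      by (rule key_inj[OF _ partner_vertices[OF w(1)] w(3)]) (use F partner_vertices[OF v] in blast)
    ultimately show ?thesis by simp
  qed
  have mono: "key R (F u) \<le> key R (F v)" if "u \<in> ?V" "v \<in> ?V" "key T u \<le> key T v" for u v
    using mono_onD[OF f(2), of "key T u" "key T v"] that F by auto
  define x where "x v = (block (F v), level (F v))" for v
  have xmono: "x u \<le> x v" if "u \<in> ?V" "v \<in> ?V" "(block u, level u) < (block v, level v)" for u v
  proof -
    \<comment> \<open>Contrapositive of \<open>key_position\<close>: the total order of the keys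
      refines the order of the positions.\<close>
    have "\<not> key T v \<le> key T u"
      using key_position[OF that(2,1), of T] that(3) unfolding not_le[symmetric] by blast
    then have "key T u \<le> key T v" by simp
    from mono[OF that(1,2) this] show ?thesis
      unfolding x_def by (rule key_position[rotated 2]) (use F that in blast)+
  qed
  have xneq: "x u \<noteq> x (partner u)" if "u \<in> ?V" for u
  proof
    assume eq: "x u = x (partner u)"
    have Fu: "F u \<in> ?V'" "partner (F u) \<in> ?V'" using F that partner_vertices by auto
    have "partner (F u) \<noteq> F u" using partner_neq Fu by blast
    then show False
      using eq Fu unfolding x_def partner[OF that] by (cases "F u") (auto split: if_splits)
  qed
  have xlinked: "linked (x u) (x (partner u))" if u: "u \<in> ?V" "(block u, level u) < (block (partner u), level (partner u))" for u
  proof -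
    have "x u \<le> x (partner u)" using xmono[OF u(1) partner_vertices[OF u(1)] u(2)] .
    then have lt: "x u < x (partner u)" using xneq[OF u(1)] by simp
    have Fu: "F u \<in> ?V'" using F u(1) by auto
    show ?thesis
    proof (cases "F u")
      case (Sep b s)
      then show ?thesis using Fu lt unfolding linked_def x_def partner[OF u(1)]
        by (auto split: if_splits)
    qed (use lt in \<open>auto simp: linked_def x_def partner[OF u(1)]\<close>)
  qed
  have sep: "x (Sep b 0) = (b, 0) \<and> x (Sep b 1) = (b, 1) \<and> x (Sep b 2) = (b, 2) \<and> x (Sep b 3) = (b, 3)"
    if b: "b \<in> blocks G D" for b
  proof (rule separators_fixed[where B = "blocks G D" and x = "\<lambda>b s. x (Sep b s)"])
    show "finite (blocks G D)" by (rule finite_blocks)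
    show "fst (x (Sep b s)) \<in> blocks G D \<and> snd (x (Sep b s)) \<le> 4" if "b \<in> blocks G D" "s < 4" for b s
      unfolding x_def using F[of "Sep b s"] that block_in_blocks level_le by fastforce
    show "x (Sep b s) \<le> x (Sep c t)"
      if "b \<in> blocks G D" "c \<in> blocks G D" "s < 4" "t < 4" "(b, s) \<le> (c, t)" for b s c t
    proof (cases "(b, s) = (c, t)")
      case False
      then have "(b, s) < (c, t)" using that(5) by (metis order_le_imp_less_or_eq)
      then show ?thesis using xmono[of "Sep b s" "Sep c t"] that(1-4) by simp
    qed simp
    show "linked (x (Sep b 0)) (x (Sep b 1))" if "b \<in> blocks G D" for b
      using xlinked[of "Sep b 0"] that by simp
    show "linked (x (Sep b 2)) (x (Sep b 3))" if "b \<in> blocks G D" for b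
      using xlinked[of "Sep b 2"] that by simp
  qed (rule b)
  \<comment> \<open>An inner vertex is caught between the last separator of its own block and the
    first separator of any later one. If it were mapped to a separator, the image of its partner
    would be a separator of the same block, but the partner is caught in the same way at a different
    block.\<close>
  have inner: "x u = (block u, 4)" if u: "u \<in> ?V" "level u = 4" for u
  proof -
    have ub: "block u \<in> blocks G D" using block_in_blocks u by blast
    have pu: "partner u \<in> ?V" "level (partner u) = 4" "block (partner u) \<noteq> block u"
      "block (partner u) \<in> blocks G D"
      using partner_vertices[OF u(1)] level_4[OF u] block_in_blocks[OF partner_vertices[OF u(1)]] by auto
    have low: "(block v, 3) \<le> x v" if "v \<in> ?V" "level v = 4" for v
    proof -
      have "block v \<in> blocks G D" using block_in_blocks that by blast
      then show ?thesis using xmono[of "Sep (block v) 3" v] sep[of "block v"] that by simp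
    qed
    have high: "x v \<le> (c, 0)" if "v \<in> ?V" "c \<in> blocks G D" "block v < c" for v c
      using xmono[of v "Sep c 0"] sep[of c] that by simp
    obtain c l where cl: "x u = (c, l)" by fastforce
    obtain c' l' where cl': "x (partner u) = (c', l')" by fastforce
    have Fu: "F u \<in> ?V'" "block (F u) = c" "level (F u) = l" "c \<in> blocks G D"
      using F[OF u(1)] cl block_in_blocks unfolding x_def by auto
    have l4: "l \<le> 4" using level_le Fu by blast
    have small: "l < 4 \<Longrightarrow> c' = c \<and> l' = swap l"
      using level_less[OF Fu(1)] cl' Fu(2,3) unfolding x_def partner[OF u(1)]
      by (metis block.simps(1) level.simps(1) partner.simps(1) prod.inject)
    note lu = low[OF u] and lp = low[OF pu(1,2)]
    note hu = high[OF u(1) Fu(4)] and hp = high[OF pu(1) Fu(4)]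
    have "c = block u"
    proof (rule ccontr)
      assume "c \<noteq> block u"
      with lu cl have "block u < c" by auto
      with hu cl have "l = 0" by auto
      with small have "c' = c" "l' = 1" by auto
      with hp lp cl' show False by (cases "block (partner u) < c") auto
    qed
    moreover have "l = 4"
    proof (rule ccontr)
      assume "l \<noteq> 4"
      then have "l = 3" using lu cl l4 \<open>c = block u\<close> by auto
      with small have "c' = c" "l' = 2" by auto
      with hp lp cl' pu(3) \<open>c = block u\<close> show False by (cases "block (partner u) < c") auto
    qed
    ultimately show ?thesis using cl by simp
  qed
  \<comment> \<open>The image of the \<open>W\<close> vertex stays in the block of the pair, which
    fixes both groups and both items; the image of the \<open>U\<close> vertex stays in block
    \<open>[0, g]\<close>, which tells the two groups apart. Only \<open>j\<close> remains
    free.\<close>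
  have ex: "\<exists>j<D. F (U g 0 a g' b) = U g j a g' b \<and> F (W g 0 a g' b) = W g j a g' b"
    if v: "g < G" "g' < G" "g \<noteq> g'" "a < D" "b < D" for g a g' b
  proof -
    let ?u = "U g 0 a g' b"
    have u: "?u \<in> ?V" using v by simp
    have bl: "x ?u = ([0, g], 4)" "x (W g 0 a g' b) = (block (W g 0 a g' b), 4)"
      using inner[of ?u] inner[of "W g 0 a g' b"] v by auto
    have Fu: "F ?u \<in> ?V'" "F (W g 0 a g' b) = partner (F ?u)"
      using F[OF u] partner[OF u] by auto
    show ?thesis
    proof (cases "F ?u")
      case (U g1 j a1 g1' b1)
      then show ?thesis using Fu bl v unfolding x_def by (auto split: if_splits)
    qed (use Fu bl in \<open>auto simp: x_def split: if_splits\<close>)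
  qed
  \<comment> \<open>The copies of item \<open>a\<close> are indexed by the pairs
    \<open>i = (g', b)\<close>; \<open>z g a i\<close> is the choice made by such a copy.\<close>
  define z where "z g a i = (THE j. F (U g 0 a (fst i) (snd i)) = U g j a (fst i) (snd i))" for g a and i :: "nat \<times> nat"
  have z: "z g a (g', b) < D \<and> F (U g 0 a g' b) = U g (z g a (g', b)) a g' b \<and>
      F (W g 0 a g' b) = W g (z g a (g', b)) a g' b"
    if v: "g < G" "g' < G" "g \<noteq> g'" "a < D" "b < D" for g a g' b
    using ex[OF v] by (auto simp: z_def)
  have "\<exists>a<D. \<forall>i\<in>{(g', b). g' < G \<and> g \<noteq> g' \<and> b < D}. z g a i = a" if g: "g < G" for g
  proof (rule fixed_choice[OF D])
    fix a a' i i' assume h: "a < a'" "a' < D" "i \<in> {(g', b). g' < G \<and> g \<noteq> g' \<and> b < D}"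
      "i' \<in> {(g', b). g' < G \<and> g \<noteq> g' \<and> b < D}"
    obtain g1 b1 g2 b2 where i: "i = (g1, b1)" "i' = (g2, b2)" by fastforce
    \<comment> \<open>In the source every copy of \<open>a\<close> precedes every copy of
      \<open>a'\<close>, and in the target the keys of the block compare the choices first.\<close>
    have "key R (F (U g 0 a g1 b1)) \<le> key R (F (U g 0 a' g2 b2))"
      using h g i by (intro mono) auto
    then show "z g a i \<le> z g a' i'"
      using z[of g g1 a b1] z[of g g2 a' b2] h g i by auto
  qed (use z g in auto)
  then obtain s where s: "\<And>g. g < G \<Longrightarrow> s g < D \<and> (\<forall>g' b. g' < G \<longrightarrow> g \<noteq> g' \<longrightarrow> b < D \<longrightarrow> z g (s g) (g', b) = s g)"
    by simp metis
  have "R g (s g) g' (s g')" if g: "g < g'" "g' < G" for g g'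
  proof (rule ccontr)
    assume n: "\<not> R g (s g) g' (s g')"
    have "g < G" using g by simp
    have p: "F (W g 0 (s g) g' (s g')) = W g (s g) (s g) g' (s g')"
      using z[of g g' "s g" "s g'"] s[of g] s[of g'] g \<open>g < G\<close> by auto
    have q: "F (W g' 0 (s g') g (s g)) = W g' (s g') (s g') g (s g)"
      using z[of g' g "s g'" "s g"] s[of g] s[of g'] g \<open>g < G\<close> by auto
    \<comment> \<open>The ranks of these two vertices are 4 and 7 in the source, but those of their
      images would be 6 and 5.\<close>
    have "key R (F (W g 0 (s g) g' (s g'))) \<le> key R (F (W g' 0 (s g') g (s g)))"
      using s[of g] s[of g'] g by (intro mono) (auto simp: T_def)
    then show False
      unfolding p q using g n by simp
  qed
  with s show "solvable G D R"
    unfolding solvable_def by blast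
qed

section \<open>Computations as constraint satisfaction problems\<close>

definition dig :: "nat \<Rightarrow> nat \<Rightarrow> nat \<Rightarrow> nat" where
  "dig P a i = a div P ^ i mod P"

lemma digits_exist:
  assumes "\<And>i. i < m \<Longrightarrow> f i < P"
  shows "\<exists>a < P ^ m. \<forall>i<m. dig P a i = f i"
  using assms
proof (induction m arbitrary: f)
  case (Suc m)
  have P: "0 < P" using Suc.prems[of 0] by auto
  obtain a where a: "a < P ^ m" "\<forall>i<m. dig P a i = f (Suc i)"
    using Suc.IH[of "\<lambda>i. f (Suc i)"] Suc.prems by auto
  let ?a = "f 0 + P * a"
  have f0: "f 0 < P" using Suc.prems by simp
  have "Suc a * P \<le> P ^ m * P" using a(1) by (intro mult_le_mono1) simp
  then have "?a < P ^ Suc m" using f0 by (simp add: algebra_simps)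
  moreover have "dig P ?a i = f i" if "i < Suc m" for i
  proof (cases i)
    case 0
    then show ?thesis using f0 by (simp add: dig_def)
  next
    case (Suc i')
    have "?a div P = a" using f0 P by simp
    then have "?a div P ^ Suc i' = a div P ^ i'"
      by (simp add: div_mult2_eq)
    then show ?thesis using a(2) that Suc by (simp add: dig_def)
  qed
  ultimately show ?case by blast
qed simp

text \<open>
  The contents of a tape at time \<open>t\<close>, given the initial contents, the head positions and the symbols
  written.
\<close>

primrec cont :: "(int \<Rightarrow> nat) \<Rightarrow> (nat \<Rightarrow> int) \<Rightarrow> (nat \<Rightarrow> nat) \<Rightarrow> nat \<Rightarrow> int \<Rightarrow> nat" where
  "cont c h w 0 = c"
| "cont c h w (Suc t) = (cont c h w t)(h t := w t)"

lemma cont_unvisited: "(\<And>s. s < t \<Longrightarrow> h s \<noteq> p) \<Longrightarrow> cont c h w t p = c p"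
  by (induction t) auto

text \<open>Together with \<open>cont_unvisited\<close>: the symbol in a cell depends only on the
  last visit to it. Once the item names that visit, reading the right symbol is a condition on two
  times.\<close>

lemma cont_last:
  "s < t \<Longrightarrow> h s = p \<Longrightarrow> (\<And>s'. s < s' \<Longrightarrow> s' < t \<Longrightarrow> h s' \<noteq> p) \<Longrightarrow> cont c h w t p = w s"
proof (induction t)
  case (Suc t)
  show ?case
  proof (cases "s = t")
    case False
    then have "s < t" using Suc.prems by simp
    then have "h t \<noteq> p" using Suc.prems(3)[of t] by simp
    moreover have "cont c h w t p = w s"
      by (rule Suc.IH) (use \<open>s < t\<close> Suc.prems in auto)
    ultimately show ?thesis by simp
  qed (use Suc.prems in auto)
qed simp

text \<open>The base \<open>P\<close> exceeds every digit: the actions up to \<open>r\<close>, the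
  positions shifted by \<open>T\<close>, and the times. Having at least two times puts each of them
  into some pair, so that conditions on a single item can be made part of a binary relation.\<close>

locale tableau =
  fixes M :: machine and trs :: "transition list" and T P :: nat
  assumes tm: "turing_machine M" and trs: "set trs = transitions M"
    and T: "2 \<le> T" and P: "length trs < P" "2 * T < P"
begin

abbreviation "k \<equiv> tapes M"
abbreviation "r \<equiv> length trs"

definition src :: "nat \<Rightarrow> nat" where "src i = fst (trs ! i)"
definition rd :: "nat \<Rightarrow> nat \<Rightarrow> nat" where "rd i j = fst (snd (trs ! i)) ! j"
definition dst :: "nat \<Rightarrow> nat" where "dst i = fst (snd (snd (trs ! i)))"
definition wr :: "nat \<Rightarrow> nat \<Rightarrow> nat" where "wr i j = fst (snd (snd (snd (trs ! i))) ! j)"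
definition mv :: "nat \<Rightarrow> nat \<Rightarrow> direction" where "mv i j = snd (snd (snd (snd (trs ! i))) ! j)"

text \<open>
  The item chosen for time \<open>t\<close> is a number in base \<open>P\<close>. Its digits are the index of the transition
  taken (or \<open>r\<close> once the accepting state has been reached), and for each tape the head position,
  shifted by \<open>T\<close> to be nonnegative, and the time of the last visit to the cell under the head
  (any number \<open>\<ge> t\<close> if there is none).
\<close>

definition act :: "nat \<Rightarrow> nat" where "act a = dig P a 0"
definition pos :: "nat \<Rightarrow> nat \<Rightarrow> nat" where "pos j a = dig P a (2 * j + 1)"
definition lst :: "nat \<Rightarrow> nat \<Rightarrow> nat" where "lst j a = dig P a (2 * j + 2)"

definition init_cells :: "bool list \<Rightarrow> nat \<Rightarrow> int \<Rightarrow> nat" where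
  "init_cells x j = (if j = 0 then bits x else (\<lambda>_. 0))"

text \<open>Action \<open>r\<close> stands for the accepting state. The equation for time 0
  therefore says \<open>start M = accepting M\<close> if the action is \<open>r\<close>, and
  otherwise that the transition leaves the start state.\<close>

definition admissible :: "bool list \<Rightarrow> nat \<Rightarrow> nat \<Rightarrow> bool" where
  "admissible x t a \<longleftrightarrow> act a \<le> r \<and>
     (t = 0 \<longrightarrow> (\<forall>j<k. pos j a = T) \<and> (if act a = r then start M else src (act a)) =
        (if act a = r then accepting M else start M)) \<and>
     (Suc t = T \<longrightarrow> act a = r) \<and>
     (act a < r \<longrightarrow> (\<forall>j<k. t \<le> lst j a \<longrightarrow> init_cells x j (int (pos j a) - int T) = rd (act a) j))"

text \<open>Besides the link between successive times, each earlier time \<open>s\<close> is checked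
  against the last visit claimed by \<open>b\<close>: it concerns the same cell if it is that visit,
  and another cell if it comes later or if no visit is claimed. Over all \<open>s < t\<close> this
  verifies the claim.\<close>

definition consistent :: "nat \<Rightarrow> nat \<Rightarrow> nat \<Rightarrow> nat \<Rightarrow> bool" where
  "consistent s a t b \<longleftrightarrow>
     (Suc s = t \<longrightarrow> (act a = r \<longrightarrow> act b = r) \<and>
        (act a < r \<longrightarrow> dst (act a) = (if act b = r then accepting M else src (act b)) \<and>
           (\<forall>j<k. int (pos j b) = int (pos j a) + offset (mv (act a) j)))) \<and>
     (act b < r \<longrightarrow> (\<forall>j<k.
        (lst j b = s \<longrightarrow> pos j a = pos j b \<and> wr (act a) j = rd (act b) j) \<and>
        (lst j b < s \<or> t \<le> lst j b \<longrightarrow> pos j a \<noteq> pos j b)))"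

definition compatible :: "bool list \<Rightarrow> compat" where
  "compatible x s a t b \<longleftrightarrow> admissible x s a \<and> admissible x t b \<and> consistent s a t b"

lemma trs_lengths: "i < r \<Longrightarrow> length (fst (snd (trs ! i))) = k \<and> length (snd (snd (snd (trs ! i)))) = k"
proof -
  assume "i < r"
  then have i: "trs ! i \<in> transitions M" using trs nth_mem by blast
  show ?thesis
    using bspec[OF tm[unfolded turing_machine_def, THEN conjunct2, THEN conjunct2] i]
    by (simp add: case_prod_beta)
qed

lemma trs_eq: "i < r \<Longrightarrow> trs ! i = (src i, map (rd i) [0..<k], dst i, map (\<lambda>j. (wr i j, mv i j)) [0..<k])"
proof -
  assume i: "i < r"
  obtain q rs q' acts where e: "trs ! i = (q, rs, q', acts)" by (cases "trs ! i")
  have l: "length rs = k" "length acts = k" using trs_lengths[OF i] e by auto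
  have "map (rd i) [0..<k] = rs" "map (\<lambda>j. (wr i j, mv i j)) [0..<k] = acts"
    by (rule nth_equalityI; use l e in \<open>simp add: rd_def wr_def mv_def\<close>)+
  then show ?thesis
    by (simp add: src_def dst_def e)
qed

lemma initial_tapes: "initial M x = (start M, map (\<lambda>j. (init_cells x j, 0)) [0..<k])"
proof -
  have "0 < k" using tm by (simp add: turing_machine_def)
  then have "input_tape x # replicate (k - 1) blank_tape = map (\<lambda>j. (init_cells x j, 0)) [0..<k]"
    by (intro nth_equalityI)
      (auto simp: nth_Cons input_tape_def blank_tape_def init_cells_def bits_def split: nat.splits)
  then show ?thesis by (simp add: initial_def)
qed

lemma step_iff_index:
  assumes "length tps = k"
  shows "step M (q, tps) (q', tps') \<longleftrightarrow>
    (\<exists>i<r. src i = q \<and> dst i = q' \<and> (\<forall>j<k. read_tape (tps ! j) = rd i j) \<and>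
       tps' = map (\<lambda>j. act_tape (wr i j, mv i j) (tps ! j)) [0..<k])"
proof -
  have tps: "tps = map ((!) tps) [0..<k]" using assms by (auto intro: nth_equalityI)
  have "step M (q, tps) (q', tps') \<longleftrightarrow>
      (\<exists>i<r. \<exists>acts. trs ! i = (q, map read_tape tps, q', acts) \<and> tps' = map2 act_tape acts tps)"
    unfolding step_def using trs by (auto simp: in_set_conv_nth simp flip: trs)
  also have "\<dots> \<longleftrightarrow> (\<exists>i<r. src i = q \<and> dst i = q' \<and> map (rd i) [0..<k] = map read_tape tps \<and>
       tps' = map2 act_tape (map (\<lambda>j. (wr i j, mv i j)) [0..<k]) tps)"
    using trs_eq by auto
  also have "\<dots> \<longleftrightarrow> (\<exists>i<r. src i = q \<and> dst i = q' \<and> (\<forall>j<k. read_tape (tps ! j) = rd i j) \<and>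
       tps' = map (\<lambda>j. act_tape (wr i j, mv i j) (tps ! j)) [0..<k])"
  proof -
    have "map (rd i) [0..<k] = map read_tape tps \<longleftrightarrow> (\<forall>j<k. read_tape (tps ! j) = rd i j)" for i
      by (subst tps) auto
    moreover have "map2 act_tape (map (\<lambda>j. (wr i j, mv i j)) [0..<k]) tps =
        map (\<lambda>j. act_tape (wr i j, mv i j) (tps ! j)) [0..<k]" for i
      by (subst tps) (rule map2_map)
    ultimately show ?thesis by simp
  qed
  finally show ?thesis .
qed

lemma act_tape_eq: "act_tape (s, d) tp = ((fst tp)(snd tp := s), snd tp + offset d)"
  by (cases tp) simp

lemma solvable_imp_accepts:
  assumes "solvable T (P ^ (2 * k + 1)) (compatible x)"
  shows "accepts M x"
proof -
  obtain s where R: "\<And>g g'. g < g' \<Longrightarrow> g' < T \<Longrightarrow> compatible x g (s g) g' (s g')"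
    using assms unfolding solvable_def by blast
  have adm: "admissible x t (s t)" if "t < T" for t
  proof (cases "t = 0")
    case True
    then show ?thesis using R[of 0 1] T unfolding compatible_def by auto
  next
    case False
    then show ?thesis using R[of 0 t] that unfolding compatible_def by auto
  qed
  have con: "consistent t (s t) t' (s t')" if "t < t'" "t' < T" for t t'
    using R[OF that] unfolding compatible_def by auto
  define A where "A t = act (s t)" for t
  define h where "h j t = int (pos j (s t)) - int T" for j t
  have "A (T - 1) = r"
    using adm[of "T - 1"] T unfolding admissible_def A_def by auto
  \<comment> \<open>The run is read off only up to the first time at which acceptance is
    claimed.\<close>
  define n where "n = (LEAST t. A t = r)"
  have n: "A n = r" "n \<le> T - 1" "\<And>t. t < n \<Longrightarrow> A t \<noteq> r"
    using LeastI[of "\<lambda>t. A t = r" "T - 1"] Least_le[of "\<lambda>t. A t = r" "T - 1"] not_less_Least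
      \<open>A (T - 1) = r\<close> unfolding n_def by auto
  have nT: "n < T" using n(2) T by simp
  have A: "A t < r" if "t < n" for t
    using adm[of t] n(3)[OF that] that nT unfolding admissible_def A_def by simp
  \<comment> \<open>At time \<open>n\<close> no transition is taken, so the state is supplied by
    \<open>accepting M\<close>.\<close>
  define c where "c t = (if t = n then accepting M else src (A t),
     map (\<lambda>j. (cont (init_cells x j) (h j) (\<lambda>t. wr (A t) j) t, h j t)) [0..<k])" for t
  have reading: "cont (init_cells x j) (h j) (\<lambda>t. wr (A t) j) t (h j t) = rd (A t) j"
    if t: "t < n" and j: "j < k" for t j
  proof -
    have vis: "lst j (s t) = u \<longrightarrow> h j u = h j t \<and> wr (A u) j = rd (A t) j"
        "lst j (s t) < u \<or> t \<le> lst j (s t) \<longrightarrow> h j u \<noteq> h j t" if "u < t" for u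
      using con[OF that] t nT A[OF t] j unfolding consistent_def A_def h_def by auto
    show ?thesis
    proof (cases "lst j (s t) < t")
      case True
      have "cont (init_cells x j) (h j) (\<lambda>t. wr (A t) j) t (h j t) = wr (A (lst j (s t))) j"
        by (rule cont_last) (use True vis in auto)
      then show ?thesis using vis(1)[OF True] by simp
    next
      case False
      have "cont (init_cells x j) (h j) (\<lambda>t. wr (A t) j) t (h j t) = init_cells x j (h j t)"
        by (rule cont_unvisited) (use False vis in auto)
      then show ?thesis
        using adm[of t] t nT A[OF t] j False unfolding admissible_def A_def h_def by auto
    qed
  qed
  have step: "step M (c t) (c (Suc t))" if t: "t < n" for t
  proof -
    have link: "dst (A t) = (if A (Suc t) = r then accepting M else src (A (Suc t)))"
        "\<And>j. j < k \<Longrightarrow> h j (Suc t) = h j t + offset (mv (A t) j)"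
      using con[of t "Suc t"] t nT A[OF t] unfolding consistent_def A_def h_def by auto
    have "A (Suc t) = r \<longleftrightarrow> Suc t = n"
      using n(1,3) t by (metis Suc_lessI)
    with link have d: "dst (A t) = (if Suc t = n then accepting M else src (A (Suc t)))" by simp
    show ?thesis
      unfolding c_def
      by (subst step_iff_index) (use t d link(2) A[OF t] reading[OF t] in \<open>auto simp: act_tape_eq intro!: exI[of _ "A t"]\<close>)
  qed
  have "c 0 = initial M x"
    using adm[of 0] T A[of 0] n(1) unfolding initial_tapes c_def admissible_def A_def h_def
    by (cases "n = 0") auto
  moreover have "(step M)\<^sup>*\<^sup>* (c 0) (c t)" if "t \<le> n" for t
    using that
  proof (induction t)
    case (Suc t)
    then show ?case using step[of t] by (auto intro: rtranclp.rtrancl_into_rtrancl)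
  qed simp
  moreover have "fst (c n) = accepting M" by (simp add: c_def)
  ultimately show ?thesis
    unfolding accepts_def by (metis order_refl)
qed

text \<open>The items record an accepting run of \<open>n\<close> steps; all times from
  \<open>n\<close> on get the action \<open>r\<close>. The slack of 2 places \<open>n\<close> before
  time \<open>T - 1\<close>, which must have this action.\<close>

lemma accepts_imp_solvable:
  assumes "accepts M x" and bound: "\<And>n c. (step M ^^ n) (initial M x) c \<Longrightarrow> n + 2 \<le> T"
  shows "solvable T (P ^ (2 * k + 1)) (compatible x)"
proof -
  obtain c' where "(step M)\<^sup>*\<^sup>* (initial M x) c'" and acc: "fst c' = accepting M"
    using assms(1) unfolding accepts_def by blast
  then obtain n where path: "(step M ^^ n) (initial M x) c'"
    by (meson rtranclp_imp_relpowp)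
  have nT: "n + 2 \<le> T" using bound[OF path] .
  obtain f where f: "f 0 = initial M x" "f n = c'" "\<And>i. i < n \<Longrightarrow> step M (f i) (f (Suc i))"
    using path unfolding relpowp_fun_conv by blast
  have len: "i \<le> n \<Longrightarrow> length (snd (f i)) = k" for i
  proof (induction i)
    case 0
    then show ?case unfolding f(1) initial_tapes by simp
  next
    case (Suc i)
    then have l: "length (snd (f i)) = k" by simp
    have "step M (fst (f i), snd (f i)) (fst (f (Suc i)), snd (f (Suc i)))"
      using f(3)[of i] Suc.prems by simp
    then show ?case unfolding step_iff_index[OF l] by auto
  qed
  define Q where "Q i m \<longleftrightarrow> m < r \<and> src m = fst (f i) \<and> dst m = fst (f (Suc i)) \<and>
       (\<forall>j<k. read_tape (snd (f i) ! j) = rd m j) \<and>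
       snd (f (Suc i)) = map (\<lambda>j. act_tape (wr m j, mv m j) (snd (f i) ! j)) [0..<k]" for i m
  have "\<exists>m. Q i m" if "i < n" for i
    using f(3)[OF that] step_iff_index[OF len[of i], of "fst (f i)" "fst (f (Suc i))" "snd (f (Suc i))"] that
    unfolding Q_def by simp
  then obtain m where "\<And>i. i < n \<Longrightarrow> Q i (m i)" by metis
  then have m: "m i < r \<and> src (m i) = fst (f i) \<and> dst (m i) = fst (f (Suc i)) \<and>
       (\<forall>j<k. read_tape (snd (f i) ! j) = rd (m i) j) \<and>
       snd (f (Suc i)) = map (\<lambda>j. act_tape (wr (m i) j, mv (m i) j) (snd (f i) ! j)) [0..<k]" if "i < n" for i
    using that
    unfolding Q_def .
  define h where "h j i = snd (snd (f i) ! j)" for j i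
  have cells: "i \<le> n \<Longrightarrow> fst (snd (f i) ! j) = cont (init_cells x j) (h j) (\<lambda>t. wr (m t) j) i" if "j < k" for i j
  proof (induction i)
    case 0
    then show ?case using that unfolding f(1) initial_tapes by simp
  next
    case (Suc i)
    then show ?case using m[of i] that by (simp add: act_tape_eq h_def)
  qed
  have h_Suc: "h j (Suc i) = h j i + offset (mv (m i) j)" if "i < n" "j < k" for i j
    using m[OF that(1)] that(2) by (simp add: h_def act_tape_eq)
  have h0: "h j 0 = 0" if "j < k" for j
    using that by (simp add: h_def f(1) initial_tapes)
  have h_bound: "i \<le> n \<Longrightarrow> \<bar>h j i\<bar> \<le> int i" if "j < k" for i j
  proof (induction i)
    case (Suc i)
    then show ?case using h_Suc[of i j] that by (cases "mv (m i) j") auto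
  qed (use h0 that in simp)
  \<comment> \<open>The heads are frozen after time \<open>n\<close>. Up to then they move by at
    most \<open>n < T\<close> cells, so the shifted positions are nonnegative and below
    \<open>2 * T\<close>.\<close>
  define hh where "hh j t = nat (int T + h j (min t n))" for j t
  have hh: "int (hh j t) = int T + h j (min t n)" "hh j t < P" if "j < k" for j t
    using h_bound[OF that, of "min t n"] nT P unfolding hh_def by auto
  define A where "A t = (if t < n then m t else r)" for t
  \<comment> \<open>The default \<open>t\<close> claims that there is no earlier visit. In every
    case the value is at most \<open>t\<close>, hence a valid digit.\<close>
  define last where "last j t = (if \<exists>s<t. h j s = h j t then Max {s. s < t \<and> h j s = h j t} else t)" for j t
  have last: "(last j t = s \<longrightarrow> h j s = h j t) \<and> (last j t < s \<or> t \<le> last j t \<longrightarrow> h j s \<noteq> h j t)" if "s < t" for j s t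
  proof (cases "\<exists>s<t. h j s = h j t")
    case True
    let ?S = "{s. s < t \<and> h j s = h j t}"
    define mx where "mx = Max ?S"
    have S: "?S \<noteq> {}" "finite ?S" using True by auto
    have "mx \<in> ?S" "s \<in> ?S \<Longrightarrow> s \<le> mx"
      using Max_in[OF S(2,1)] Max_ge[OF S(2)] unfolding mx_def by blast+
    moreover have "last j t = mx"
      unfolding last_def mx_def using True by (rule if_P)
    ultimately show ?thesis using that by auto
  next
    case False
    then show ?thesis using that unfolding last_def by auto
  qed
  have last_le: "last j t \<le> t" for j t
  proof (cases "\<exists>s<t. h j s = h j t")
    case True
    then have "Max {s. s < t \<and> h j s = h j t} \<in> {s. s < t \<and> h j s = h j t}"
      by (intro Max_in) auto
    then show ?thesis using True unfolding last_def by auto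
  qed (auto simp: last_def)
  define Z where "Z t a \<longleftrightarrow> a < P ^ (2 * k + 1) \<and> act a = A t \<and>
      (\<forall>j<k. pos j a = hh j t \<and> lst j a = last j t)" for t a
  have "\<exists>a. Z t a" if "t < T" for t
  proof -
    let ?f = "\<lambda>i. if i = 0 then A t else if odd i then hh ((i - 1) div 2) t else last ((i - 2) div 2) t"
    have "?f i < P" if i: "i < 2 * k + 1" for i
    proof -
      have "A t < P" using m[of t] P unfolding A_def by auto
      moreover have "odd i \<Longrightarrow> (i - 1) div 2 < k" using i by (auto elim!: oddE)
      moreover have "last ((i - 2) div 2) t < P" using last_le[of "(i - 2) div 2" t] \<open>t < T\<close> P by linarith
      ultimately show ?thesis using hh(2) by auto
    qed
    then obtain a where a: "a < P ^ (2 * k + 1)" "\<forall>i<2 * k + 1. dig P a i = ?f i"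
      using digits_exist[of "2 * k + 1" ?f P] by blast
    have "act a = A t" using a(2) by (simp add: act_def)
    moreover have "pos j a = hh j t \<and> lst j a = last j t" if "j < k" for j
      using a(2)[rule_format, of "2 * j + 1"] a(2)[rule_format, of "2 * j + 2"] that
      by (simp add: pos_def lst_def)
    ultimately show ?thesis using a(1) unfolding Z_def by blast
  qed
  then obtain s where "\<And>t. t < T \<Longrightarrow> Z t (s t)" by metis
  then have s: "s t < P ^ (2 * k + 1) \<and> act (s t) = A t \<and>
      (\<forall>j<k. pos j (s t) = hh j t \<and> lst j (s t) = last j t)" if "t < T" for t
    using that unfolding Z_def .
  have rdc: "rd (m t) j = cont (init_cells x j) (h j) (\<lambda>t. wr (m t) j) t (h j t)" if "t < n" "j < k" for t j
  proof -
    have "read_tape (snd (f t) ! j) = rd (m t) j" using m[OF that(1)] that(2) by simp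
    then show ?thesis
      using cells[OF that(2), of t] that(1) unfolding read_tape_eq h_def by simp
  qed
  have adm: "admissible x t (s t)" if t: "t < T" for t
    unfolding admissible_def
  proof (intro conjI impI allI, goal_cases)
    case 1
    then show ?case using s[OF t] m[of t] by (auto simp: A_def)
  next
    case (2 j)
    then show ?case using s[OF t] hh(1)[of j 0] h0[of j] by simp
  next
    case 3
    have "fst (f 0) = start M" unfolding f(1) initial_tapes by simp
    then show ?case
      using s[OF t] m[of 0] acc f(2) 3 by (auto simp: A_def)
  next
    case 4
    then show ?case using s[OF t] nT by (simp add: A_def)
  next
    case (5 j)
    then have tn: "t < n" using s[OF t] by (auto simp: A_def split: if_splits)
    have "h j u \<noteq> h j t" if "u < t" for u
      using last[OF that, of j] 5 s[OF t] by auto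
    then have "cont (init_cells x j) (h j) (\<lambda>t. wr (m t) j) t (h j t) = init_cells x j (h j t)"
      by (rule cont_unvisited)
    then show ?case
      using rdc[OF tn] 5 s[OF t] tn hh(1)[of j t] by (simp add: A_def min_def)
  qed
  have con: "consistent t (s t) t' (s t')" if tt: "t < t'" "t' < T" for t t'
    unfolding consistent_def
  proof (intro conjI impI allI, goal_cases)
    case 1
    then show ?case using s[of t] s[of t'] tt m[of t] by (auto simp: A_def split: if_splits)
  next
    case 2
    then have tn: "t < n" using s[of t] tt by (auto simp: A_def split: if_splits)
    then have "dst (A t) = (if A t' = r then accepting M else src (A t'))"
    proof (cases "Suc t = n")
      case True
      then show ?thesis using m[of t] 2(1) acc f(2) tn by (auto simp: A_def)
    next
      case False
      then have "t' < n" using tn 2(1) by simp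
      then show ?thesis using m[of t] m[of t'] 2(1) tn by (auto simp: A_def)
    qed
    then show ?case using s[of t] s[of t'] tt by simp
  next
    case (3 j)
    then have tn: "t < n" using s[of t] tt by (auto simp: A_def split: if_splits)
    have "int (hh j t') = int (hh j t) + offset (mv (m t) j)"
      using hh(1)[of j t] hh(1)[of j t'] h_Suc[OF tn] 3 tn by (auto simp: min_def)
    then show ?case using s[of t] s[of t'] tt 3 tn by (simp add: A_def)
  next
    case (4 j)
    then have tn: "t' < n" using s[of t'] tt by (auto simp: A_def split: if_splits)
    then show ?case
      using last[OF tt(1), of j] hh(1)[of j t] hh(1)[of j t'] 4 s[of t] s[of t'] tt by auto
  next
    case (5 j)
    then have tn: "t' < n" using s[of t'] tt by (auto simp: A_def split: if_splits)
    have l: "last j t' = t" using 5 s[of t'] tt by auto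
    have "cont (init_cells x j) (h j) (\<lambda>t. wr (m t) j) t' (h j t') = wr (m t) j"
      by (rule cont_last[OF tt(1)]) (use last[of _ t' j] l tt in auto)
    then show ?case using rdc[OF tn, of j] 5 s[of t] s[of t'] tt tn by (simp add: A_def)
  next
    case (6 j)
    then have tn: "t' < n" using s[of t'] tt by (auto simp: A_def split: if_splits)
    have "h j t \<noteq> h j t'" using 6 last[OF tt(1), of j] s[of t'] tt by auto
    then show ?case using hh(1)[of j t] hh(1)[of j t'] 6 s[of t] s[of t'] tt tn by auto
  qed
  show ?thesis
    unfolding solvable_def compatible_def
    using s adm con by (intro exI[of _ s]) (meson order.strict_trans)
qed

end

section \<open>Membership in NP\<close>

definition rows :: "nat \<Rightarrow> nat \<Rightarrow> (nat \<Rightarrow> nat \<Rightarrow> bool) \<Rightarrow> bool list" where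
  "rows n k A = concat (map (\<lambda>u. map (A u) [0..<n]) [0..<k])"

text \<open>The encoding of a graph whose vertices have been replaced by their ranks. Ordered graphs
  have unique representatives of this kind, on which all further arguments work.\<close>

definition matrix_code :: "nat \<Rightarrow> (nat \<Rightarrow> nat \<Rightarrow> bool) \<Rightarrow> bool list" where
  "matrix_code n A = replicate n True @ [False] @ rows n n A"

definition matching_matrix :: "nat \<Rightarrow> (nat \<Rightarrow> nat \<Rightarrow> bool) \<Rightarrow> bool" where
  "matching_matrix n A \<longleftrightarrow> (\<forall>u<n. \<not> A u u \<and> (\<forall>v<n. A u v \<longrightarrow> A v u) \<and> (\<exists>v<n. A u v) \<and>
     (\<forall>v<n. \<forall>w<n. A u v \<and> A u w \<longrightarrow> v = w))"

lemma matching_matrix_cong: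
  "(\<And>u v. u < n \<Longrightarrow> v < n \<Longrightarrow> A u v = B u v) \<Longrightarrow> matching_matrix n A = matching_matrix n B"
  unfolding matching_matrix_def by (simp cong: conj_cong)

definition matrix_hom :: "nat \<Rightarrow> (nat \<Rightarrow> nat \<Rightarrow> bool) \<Rightarrow> nat \<Rightarrow> (nat \<Rightarrow> nat \<Rightarrow> bool) \<Rightarrow> (nat \<Rightarrow> nat) \<Rightarrow> bool" where
  "matrix_hom m B n A f \<longleftrightarrow> (\<forall>u<m. f u < n) \<and> (\<forall>u<m. \<forall>v<m. u \<le> v \<longrightarrow> f u \<le> f v) \<and>
     (\<forall>u<m. \<forall>v<m. B u v \<longrightarrow> A (f u) (f v))"

lemma length_rows [simp]: "length (rows n k A) = k * n"
  by (induction k) (simp_all add: rows_def)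

lemma rows_Suc: "rows n (Suc k) A = rows n k A @ map (A k) [0..<n]"
  by (simp add: rows_def)

lemma nth_rows: "u < k \<Longrightarrow> v < n \<Longrightarrow> rows n k A ! (u * n + v) = A u v"
proof (induction k)
  case (Suc k)
  show ?case
  proof (cases "u = k")
    case False
    then have "u < k" using Suc by simp
    then have "Suc u * n \<le> k * n" by (intro mult_le_mono1) simp
    then have "u * n + v < k * n" using Suc.prems by simp
    then show ?thesis
      using Suc \<open>u < k\<close> by (simp add: rows_Suc nth_append)
  qed (use Suc.prems in \<open>simp add: rows_Suc nth_append\<close>)
qed simp

lemma rows_self: "length y = k * n \<Longrightarrow> rows n k (\<lambda>u v. y ! (u * n + v)) = y"
proof (induction k arbitrary: y)
  case 0
  then show ?case by (simp add: rows_def)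
next
  case (Suc k)
  have "rows n k (\<lambda>u v. y ! (u * n + v)) = rows n k (\<lambda>u v. take (k * n) y ! (u * n + v))"
    unfolding rows_def
  proof (intro arg_cong[of _ _ concat] map_cong refl)
    fix u v assume "u \<in> set [0..<k]" "v \<in> set [0..<n]"
    then have "u < k" "v < n" by auto
    then have "Suc u * n \<le> k * n" by (intro mult_le_mono1) simp
    then show "y ! (u * n + v) = take (k * n) y ! (u * n + v)" using \<open>v < n\<close> by simp
  qed
  also have "\<dots> = take (k * n) y" using Suc.prems by (intro Suc.IH) simp
  finally have "rows n k (\<lambda>u v. y ! (u * n + v)) = take (k * n) y" .
  moreover have "map (\<lambda>v. y ! (k * n + v)) [0..<n] = drop (k * n) y"
    using Suc.prems by (intro nth_equalityI) auto
  ultimately show ?case by (simp add: rows_Suc)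
qed

lemma length_matrix_code [simp]: "length (matrix_code n A) = n + 1 + n * n"
  by (simp add: matrix_code_def)

lemma replicate_False_eq:
  "replicate n True @ False # xs = replicate m True @ False # ys \<Longrightarrow> n = m \<and> xs = ys"
proof (induction n arbitrary: m)
  case 0
  then show ?case by (cases m) auto
next
  case (Suc n)
  then show ?case by (cases m) auto
qed

text \<open>The first \<open>False\<close> delimits the number of vertices, which determines the
  length of the matrix; the code is therefore prefix-free.\<close>

lemma matrix_code_eq:
  assumes "matrix_code n A @ xs = matrix_code m B @ ys"
  shows "n = m \<and> (\<forall>u<n. \<forall>v<n. A u v = B u v) \<and> xs = ys"
proof -
  have "replicate n True @ False # (rows n n A @ xs) = replicate m True @ False # (rows m m B @ ys)"
    using assms by (simp add: matrix_code_def)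
  from replicate_False_eq[OF this] have nm: "n = m" "rows n n A @ xs = rows m m B @ ys" by auto
  then have eq: "rows n n A = rows n n B" "xs = ys"
    using append_eq_append_conv[of "rows n n A" "rows n n B" xs ys] by auto
  have "A u v = B u v" if "u < n" "v < n" for u v
    using nth_rows[OF that, of A] nth_rows[OF that, of B] eq(1) by simp
  with nm eq show ?thesis by simp
qed

lemma encode_graph_list:
  assumes "vs = sorted_list_of_set (verts G)"
  shows "encode_graph G = matrix_code (length vs) (\<lambda>u v. {vs ! u, vs ! v} \<in> edges G)"
proof -
  have vs: "map ((!) vs) [0..<length vs] = vs" by (rule map_nth)
  have "map (\<lambda>u. map (\<lambda>v. {u, v} \<in> edges G) vs) vs =
      map (\<lambda>u. map (\<lambda>v. {u, v} \<in> edges G) (map ((!) vs) [0..<length vs])) (map ((!) vs) [0..<length vs])"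
    unfolding vs ..
  also have "\<dots> = map (\<lambda>u. map (\<lambda>v. {vs ! u, vs ! v} \<in> edges G) [0..<length vs]) [0..<length vs]"
    by simp
  finally show ?thesis
    unfolding encode_graph_def matrix_code_def rows_def assms Let_def by simp
qed

lemma matching_matrix_graph:
  assumes G: "ordered_matching G" and vs: "vs = sorted_list_of_set (verts G)"
  shows "matching_matrix (length vs) (\<lambda>u v. {vs ! u, vs ! v} \<in> edges G)"
proof -
  have fin: "finite (verts G)" and e: "\<And>e. e \<in> edges G \<Longrightarrow> e \<subseteq> verts G \<and> card e = 2"
    and ex: "\<And>v. v \<in> verts G \<Longrightarrow> \<exists>!e. e \<in> edges G \<and> v \<in> e"
    using G unfolding ordered_matching_def ordered_graph_def by auto
  have set: "set vs = verts G" "distinct vs" using vs fin by auto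
  show ?thesis
    unfolding matching_matrix_def
  proof (intro allI impI conjI)
    fix u assume u: "u < length vs"
    show "{vs ! u, vs ! u} \<notin> edges G"
    proof
      assume "{vs ! u, vs ! u} \<in> edges G"
      then have "card {vs ! u, vs ! u} = 2" using e by blast
      then show False by simp
    qed
    have "vs ! u \<in> verts G" using nth_mem[OF u] unfolding set .
    then obtain d where d: "d \<in> edges G" "vs ! u \<in> d" and uniq: "\<And>d'. d' \<in> edges G \<Longrightarrow> vs ! u \<in> d' \<Longrightarrow> d' = d"
      using ex[of "vs ! u"] by blast
    obtain b c where bc: "d = {b, c}" using e[OF d(1)] unfolding card_2_iff by blast
    then obtain y where y: "d = {vs ! u, y}" using d(2) by auto
    then have "y \<in> set vs" using e[OF d(1)] set by auto
    then show "\<exists>v<length vs. {vs ! u, vs ! v} \<in> edges G"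
      using d(1) y by (auto simp: in_set_conv_nth)
    show "v = w" if "v < length vs" "w < length vs" "{vs ! u, vs ! v} \<in> edges G \<and> {vs ! u, vs ! w} \<in> edges G" for v w
    proof -
      have "{vs ! u, vs ! v} = {vs ! u, vs ! w}" using uniq[of "{vs ! u, vs ! v}"] uniq[of "{vs ! u, vs ! w}"] that(3) by simp
      then have "vs ! v = vs ! w" by (auto simp: doubleton_eq_iff)
      then show ?thesis using that(1,2) set(2) nth_eq_iff_index_eq by blast
    qed
  qed (auto simp: insert_commute)
qed

definition matrix_graph :: "nat \<Rightarrow> (nat \<Rightarrow> nat \<Rightarrow> bool) \<Rightarrow> nat graph" where
  "matrix_graph n A = \<lparr>verts = {..<n}, edges = {{u, v} | u v. u < n \<and> v < n \<and> A u v}\<rparr>"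

lemma matrix_graph_edge:
  assumes "matching_matrix n A"
  shows "{u, v} \<in> edges (matrix_graph n A) \<longleftrightarrow> u < n \<and> v < n \<and> A u v"
  using assms unfolding matrix_graph_def matching_matrix_def by (auto simp: doubleton_eq_iff)

lemma matrix_graph_matching:
  assumes A: "matching_matrix n A"
  shows "ordered_matching (matrix_graph n A)"
proof -
  have "\<exists>!e. e \<in> edges (matrix_graph n A) \<and> u \<in> e" if u: "u < n" for u
  proof -
    obtain v where v: "v < n" "A u v" using A u unfolding matching_matrix_def by blast
    show ?thesis
    proof (rule ex1I[of _ "{u, v}"])
      show "{u, v} \<in> edges (matrix_graph n A) \<and> u \<in> {u, v}"
        using matrix_graph_edge[OF A] u v by simp
      fix e assume "e \<in> edges (matrix_graph n A) \<and> u \<in> e"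
      then obtain a b where ab: "e = {a, b}" "a < n" "b < n" "A a b" "u = a \<or> u = b"
        unfolding matrix_graph_def by auto
      moreover have "A b a" using A ab(2-4) unfolding matching_matrix_def by blast
      ultimately obtain w where "e = {u, w}" "w < n" "A u w"
        by (metis insert_commute)
      then show "e = {u, v}" using A u v unfolding matching_matrix_def by blast
    qed
  qed
  moreover have "e \<subseteq> {..<n} \<and> card e = 2" if e: "e \<in> edges (matrix_graph n A)" for e
  proof -
    obtain a b where ab: "e = {a, b}" "a < n" "b < n" "A a b"
      using e unfolding matrix_graph_def by auto
    then have "a \<noteq> b" using A unfolding matching_matrix_def by auto
    then show ?thesis using ab by simp
  qed
  ultimately show ?thesis
    unfolding ordered_matching_def ordered_graph_def by (simp add: matrix_graph_def)
qed

lemma rows_cong: "(\<And>u v. u < k \<Longrightarrow> v < n \<Longrightarrow> A u v = B u v) \<Longrightarrow> rows n k A = rows n k B"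
  unfolding rows_def by (intro arg_cong[of _ _ concat] map_cong refl) auto

lemma encode_matrix_graph:
  assumes "matching_matrix n A" shows "encode_graph (matrix_graph n A) = matrix_code n A"
proof -
  have "sorted_list_of_set (verts (matrix_graph n A)) = [0..<n]"
    by (simp add: lessThan_atLeast0 matrix_graph_def)
  then have "encode_graph (matrix_graph n A) =
      matrix_code n (\<lambda>u v. {[0..<n] ! u, [0..<n] ! v} \<in> edges (matrix_graph n A))"
    using encode_graph_list[of "[0..<n]" "matrix_graph n A"] by simp
  also have "\<dots> = matrix_code n A"
    unfolding matrix_code_def using matrix_graph_edge[OF assms] by (auto intro!: rows_cong)
  finally show ?thesis .
qed

theorem problem_iff:
  "x \<in> matching_hom_problem \<longleftrightarrow> (\<exists>n A m B f. x = matrix_code n A @ matrix_code m B \<and>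
     matching_matrix n A \<and> matching_matrix m B \<and> matrix_hom m B n A f)"
proof
  assume "x \<in> matching_hom_problem"
  then obtain M N :: "nat graph" and f where x: "x = encode_graph M @ encode_graph N"
    and M: "ordered_matching M" and N: "ordered_matching N" and f: "ordered_hom f N M"
    unfolding matching_hom_problem_def by blast
  define vs where "vs = sorted_list_of_set (verts M)"
  define ws where "ws = sorted_list_of_set (verts N)"
  have vs: "set vs = verts M" "sorted vs" "distinct vs" and ws: "set ws = verts N" "sorted ws" "distinct ws"
    using M N unfolding vs_def ws_def ordered_matching_def ordered_graph_def by auto
  have "\<exists>i<length vs. vs ! i = f (ws ! u)" if "u < length ws" for u
  proof -
    have "f (ws ! u) \<in> set vs"
      using f that nth_mem[OF that] vs(1) ws(1) unfolding ordered_hom_def by auto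
    then show ?thesis by (simp add: in_set_conv_nth)
  qed
  then obtain h where h: "\<And>u. u < length ws \<Longrightarrow> h u < length vs \<and> vs ! h u = f (ws ! u)" by metis
  have "matrix_hom (length ws) (\<lambda>u v. {ws ! u, ws ! v} \<in> edges N) (length vs) (\<lambda>u v. {vs ! u, vs ! v} \<in> edges M) h"
    unfolding matrix_hom_def
  proof (intro conjI allI impI)
    fix u v assume uv: "u < length ws" "v < length ws" "u \<le> v"
    have "f (ws ! u) \<le> f (ws ! v)"
      using f uv ws nth_mem[of u ws] nth_mem[of v ws] sorted_nth_mono[OF ws(2) uv(3,2)]
      unfolding ordered_hom_def by (auto elim!: mono_onD)
    then have "\<not> vs ! h v < vs ! h u" using h uv by auto
    then show "h u \<le> h v"
      using h uv vs sorted_wrt_nth_less[of "(<)" vs "h v" "h u"] strict_sorted_iff[of vs] by (meson not_le)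
  next
    fix u v assume "u < length ws" "v < length ws" "{ws ! u, ws ! v} \<in> edges N"
    then show "{vs ! h u, vs ! h v} \<in> edges M"
      using h f unfolding ordered_hom_def by auto
  qed (use h in auto)
  then show "\<exists>n A m B f. x = matrix_code n A @ matrix_code m B \<and>
     matching_matrix n A \<and> matching_matrix m B \<and> matrix_hom m B n A f"
    using x encode_graph_list[OF vs_def] encode_graph_list[OF ws_def]
      matching_matrix_graph[OF M vs_def] matching_matrix_graph[OF N ws_def] by metis
next
  assume "\<exists>n A m B f. x = matrix_code n A @ matrix_code m B \<and>
     matching_matrix n A \<and> matching_matrix m B \<and> matrix_hom m B n A f"
  then obtain n A m B f where x: "x = matrix_code n A @ matrix_code m B"
    and A: "matching_matrix n A" and B: "matching_matrix m B" and f: "matrix_hom m B n A f"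
    by blast
  have "ordered_hom f (matrix_graph m B) (matrix_graph n A)"
    using f matrix_graph_edge[OF A] matrix_graph_edge[OF B]
    unfolding ordered_hom_def matrix_hom_def by (auto simp: matrix_graph_def intro!: mono_onI)
  then have hom: "\<exists>f. ordered_hom f (matrix_graph m B) (matrix_graph n A)"
    by (rule exI[of _ f])
  have enc: "x = encode_graph (matrix_graph n A) @ encode_graph (matrix_graph m B)"
    using x encode_matrix_graph[OF A] encode_matrix_graph[OF B] by simp
  show "x \<in> matching_hom_problem"
    unfolding matching_hom_problem_def
    by (rule CollectI, rule exI[of _ "matrix_graph n A"], rule exI[of _ "matrix_graph m B"],
      intro conjI enc matrix_graph_matching A B hom)
qed

lemma problem_code_iff:
  assumes "matching_matrix n A" "matching_matrix m B"
  shows "matrix_code n A @ matrix_code m B \<in> matching_hom_problem \<longleftrightarrow> (\<exists>f. matrix_hom m B n A f)"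
proof
  assume "matrix_code n A @ matrix_code m B \<in> matching_hom_problem"
  then obtain n' A' m' B' f where e: "matrix_code n A @ matrix_code m B = matrix_code n' A' @ matrix_code m' B'"
    and f: "matrix_hom m' B' n' A' f"
    unfolding problem_iff by blast
  from matrix_code_eq[OF e] have n: "n = n'" "\<forall>u<n. \<forall>v<n. A u v = A' u v"
    and "matrix_code m B = matrix_code m' B'" by auto
  then have m: "m = m'" "\<forall>u<m. \<forall>v<m. B u v = B' u v"
    using matrix_code_eq[of m B "[]" m' B' "[]"] by auto
  have "matrix_hom m B n A f"
    using f n m unfolding matrix_hom_def by auto
  then show "\<exists>f. matrix_hom m B n A f" by (rule exI[of _ f])
next
  assume "\<exists>f. matrix_hom m B n A f"
  then show "matrix_code n A @ matrix_code m B \<in> matching_hom_problem"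
    unfolding problem_iff using assms by blast
qed

lemma bits_eq_2: "bits x (int i) = 2 \<longleftrightarrow> i < length x \<and> x ! i"
  by (auto simp: bits_def bit_symbol_def)

text \<open>The view of the verifier, which accesses the input by positions: a word of the right
  length with its delimiters in the right places is a pair of codes, and the matrices are found at
  fixed offsets.\<close>

lemma code_split:
  assumes len: "length x = (n + 1 + n * n) + (m + 1 + m * m)"
    and 1: "\<And>i. i < n \<Longrightarrow> x ! i" "\<not> x ! n"
    and 2: "\<And>i. i < m \<Longrightarrow> x ! ((n + 1 + n * n) + i)" "\<not> x ! ((n + 1 + n * n) + m)"
  shows "x = matrix_code n (\<lambda>u v. x ! (n + (1 + (u * n + v)))) @
    matrix_code m (\<lambda>u v. x ! ((n + 1 + n * n) + (m + (1 + (u * m + v)))))"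
proof -
  have half: "y = matrix_code n (\<lambda>u v. y ! (n + (1 + (u * n + v))))"
    if "length y = n + 1 + n * n" "\<And>i. i < n \<Longrightarrow> y ! i" "\<not> y ! n" for y n
  proof -
    have "rows n n (\<lambda>u v. drop (Suc n) y ! (u * n + v)) = drop (Suc n) y"
      using that(1) by (intro rows_self) simp
    moreover have "drop (Suc n) y ! i = y ! (n + (1 + i))" for i
      using that(1) by (simp add: nth_drop)
    moreover have "take n y = replicate n True"
      using that by (intro nth_equalityI) auto
    ultimately show ?thesis
      unfolding matrix_code_def using that(1,3) id_take_nth_drop[of n y] by simp
  qed
  let ?c = "n + 1 + n * n"
  have "take ?c x = matrix_code n (\<lambda>u v. take ?c x ! (n + (1 + (u * n + v))))"
    using len 1 by (intro half) auto
  also have "\<dots> = matrix_code n (\<lambda>u v. x ! (n + (1 + (u * n + v))))"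
    unfolding matrix_code_def rows_def
  proof (intro arg_cong2[of _ _ _ _ "(@)"] arg_cong[of _ _ concat] map_cong refl)
    fix u v assume "u \<in> set [0..<n]" "v \<in> set [0..<n]"
    then have "u < n" "v < n" by auto
    then have "Suc u * n \<le> n * n" by (intro mult_le_mono1) simp
    then show "take ?c x ! (n + (1 + (u * n + v))) = x ! (n + (1 + (u * n + v)))" using \<open>v < n\<close> by simp
  qed
  finally have t: "take ?c x = \<dots>" .
  have "drop ?c x = matrix_code m (\<lambda>u v. drop ?c x ! (m + (1 + (u * m + v))))"
    using len 2 by (intro half) auto
  also have "(\<lambda>u v. drop ?c x ! (m + (1 + (u * m + v)))) = (\<lambda>u v. x ! (?c + (m + (1 + (u * m + v)))))"
    using len by (simp add: nth_drop)
  finally show ?thesis using t append_take_drop_id[of ?c x] by simp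
qed

text \<open>
  The certificate \<open>g\<close> is the graph of the homomorphism as an \<open>m\<close> by \<open>n\<close> matrix, padded to
  the length of the input.
\<close>

definition hom_certificate :: "bool list \<Rightarrow> bool list \<Rightarrow> nat \<Rightarrow> nat \<Rightarrow> bool" where
  "hom_certificate x g n m \<longleftrightarrow> length x = (n + 1 + n * n) + (m + 1 + m * m) \<and>
     (\<forall>i<n. x ! i) \<and> \<not> x ! n \<and> (\<forall>i<m. x ! ((n + 1 + n * n) + i)) \<and> \<not> x ! ((n + 1 + n * n) + m) \<and>
     matching_matrix n (\<lambda>u v. x ! (n + (1 + (u * n + v)))) \<and>
     matching_matrix m (\<lambda>u v. x ! ((n + 1 + n * n) + (m + (1 + (u * m + v))))) \<and>
     (\<forall>u<m. \<exists>w<n. g ! (u * n + w)) \<and>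
     (\<forall>u<m. \<forall>u'<m. \<forall>w<n. \<forall>w'<n. g ! (u * n + w) \<and> g ! (u' * n + w') \<longrightarrow>
        (u \<le> u' \<longrightarrow> w \<le> w') \<and>
        (x ! ((n + 1 + n * n) + (m + (1 + (u * m + u')))) \<longrightarrow> x ! (n + (1 + (w * n + w')))))"

definition accepted :: "bool list \<Rightarrow> bool list \<Rightarrow> bool" where
  "accepted x g \<longleftrightarrow> (\<exists>n\<le>length x. \<exists>m\<le>length x. hom_certificate x g n m)"

lemma problem_iff_accepted: "x \<in> matching_hom_problem \<longleftrightarrow> (\<exists>g. length g = length x \<and> accepted x g)"
proof
  assume "x \<in> matching_hom_problem"
  then obtain n A m B f where x: "x = matrix_code n A @ matrix_code m B"
    and A: "matching_matrix n A" and B: "matching_matrix m B" and f: "matrix_hom m B n A f"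
    unfolding problem_iff by blast
  let ?c = "n + 1 + n * n"
  define g where "g = map (\<lambda>i. i div n < m \<and> f (i div n) = i mod n) [0..<length x]"
  \<comment> \<open>\<open>m * n\<close> is at most the square of the larger factor, so a relation
    between the two vertex sets fits into a certificate as long as the input.\<close>
  have idx: "u * n + w < length x" if "u < m" "w < n" for u w
  proof -
    have "Suc u * n \<le> m * n" using that by (intro mult_le_mono1) simp
    moreover have "m * n \<le> n * n + m * m"
      by (cases "m \<le> n") (auto intro: trans_le_add1 trans_le_add2 mult_le_mono)
    ultimately show ?thesis using that x by simp
  qed
  have g: "g ! (u * n + w) \<longleftrightarrow> f u = w" if "u < m" "w < n" for u w
    using idx[OF that] that by (simp add: g_def)
  have idxA: "u * n + v < n * n" if "u < n" "v < n" for u v n :: nat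
  proof -
    have "Suc u * n \<le> n * n" using that by (intro mult_le_mono1) simp
    then show ?thesis using that by simp
  qed
  have xA: "x ! (n + (1 + (u * n + v))) = A u v" if "u < n" "v < n" for u v
    unfolding x matrix_code_def using that idxA[OF that] nth_rows[OF that, of A]
    by (simp add: nth_append nth_Cons)
  have xB: "x ! (?c + (m + (1 + (u * m + v)))) = B u v" if "u < m" "v < m" for u v
  proof -
    have "x ! (?c + (m + (1 + (u * m + v)))) = matrix_code m B ! (m + (1 + (u * m + v)))"
      unfolding x by (simp only: length_matrix_code[symmetric, of n A] nth_append_length_plus)
    also have "matrix_code m B ! (m + (1 + (u * m + v))) = B u v"
      unfolding matrix_code_def using that idxA[OF that] nth_rows[OF that, of B]
      by (simp add: nth_append nth_Cons)
    finally show ?thesis .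
  qed
  have "hom_certificate x g n m"
    unfolding hom_certificate_def
  proof (intro conjI)
    show "length x = ?c + (m + 1 + m * m)" using x by simp
    show "\<forall>i<n. x ! i" "\<not> x ! n" unfolding x matrix_code_def by (auto simp: nth_append)
    have "x ! (?c + i) = matrix_code m B ! i" for i
      unfolding x by (simp only: length_matrix_code[symmetric, of n A] nth_append_length_plus)
    then show "\<forall>i<m. x ! (?c + i)" "\<not> x ! (?c + m)" unfolding matrix_code_def by (auto simp: nth_append)
    show "matching_matrix n (\<lambda>u v. x ! (n + (1 + (u * n + v))))"
      by (rule matching_matrix_cong[THEN iffD2, OF _ A]) (rule xA)
    show "matching_matrix m (\<lambda>u v. x ! (?c + (m + (1 + (u * m + v)))))"
      by (rule matching_matrix_cong[THEN iffD2, OF _ B]) (rule xB)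
    show "\<forall>u<m. \<exists>w<n. g ! (u * n + w)" using f g unfolding matrix_hom_def by auto
    show "\<forall>u<m. \<forall>u'<m. \<forall>w<n. \<forall>w'<n. g ! (u * n + w) \<and> g ! (u' * n + w') \<longrightarrow>
        (u \<le> u' \<longrightarrow> w \<le> w') \<and>
        (x ! (?c + (m + (1 + (u * m + u')))) \<longrightarrow> x ! (n + (1 + (w * n + w'))))"
      using f g xA xB unfolding matrix_hom_def by auto
  qed
  moreover have "n \<le> length x" "m \<le> length x" using x by simp_all
  ultimately have "accepted x g"
    unfolding accepted_def by blast
  then show "\<exists>g. length g = length x \<and> accepted x g"
    by (intro exI[of _ g]) (simp add: g_def)
next
  assume "\<exists>g. length g = length x \<and> accepted x g"
  then obtain g where "accepted x g" by blast
  then obtain n m where len: "length x = (n + 1 + n * n) + (m + 1 + m * m)"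
    and x: "\<forall>i<n. x ! i" "\<not> x ! n" "\<forall>i<m. x ! ((n + 1 + n * n) + i)" "\<not> x ! ((n + 1 + n * n) + m)"
    and mm: "matching_matrix n (\<lambda>u v. x ! (n + (1 + (u * n + v))))"
     "matching_matrix m (\<lambda>u v. x ! ((n + 1 + n * n) + (m + (1 + (u * m + v)))))"
    and g: "\<forall>u<m. \<exists>w<n. g ! (u * n + w)"
     "\<forall>u<m. \<forall>u'<m. \<forall>w<n. \<forall>w'<n. g ! (u * n + w) \<and> g ! (u' * n + w') \<longrightarrow>
        (u \<le> u' \<longrightarrow> w \<le> w') \<and>
        (x ! ((n + 1 + n * n) + (m + (1 + (u * m + u')))) \<longrightarrow> x ! (n + (1 + (w * n + w'))))"
    unfolding accepted_def hom_certificate_def by blast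
  \<comment> \<open>The certificate is a relation whose conditions hold for all related pairs, so
    any choice of values is a homomorphism.\<close>
  obtain f where f: "\<And>u. u < m \<Longrightarrow> f u < n \<and> g ! (u * n + f u)" using g(1) by metis
  have hom: "matrix_hom m (\<lambda>u v. x ! ((n + 1 + n * n) + (m + (1 + (u * m + v))))) n
      (\<lambda>u v. x ! (n + (1 + (u * n + v)))) f"
    unfolding matrix_hom_def using f g(2) by blast
  have "x = matrix_code n (\<lambda>u v. x ! (n + (1 + (u * n + v)))) @
    matrix_code m (\<lambda>u v. x ! ((n + 1 + n * n) + (m + (1 + (u * m + v)))))"
    by (rule code_split) (use len x in auto)
  then show "x \<in> matching_hom_problem"
    unfolding problem_iff using mm hom by blast
qed

section \<open>The verifier as a bounded formula\<close>

definition Or :: "fm \<Rightarrow> fm \<Rightarrow> fm" where "Or \<phi> \<psi> = Neg (And (Neg \<phi>) (Neg \<psi>))"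
definition Imp :: "fm \<Rightarrow> fm \<Rightarrow> fm" where "Imp \<phi> \<psi> = Neg (And \<phi> (Neg \<psi>))"
definition Le :: "tm \<Rightarrow> tm \<Rightarrow> fm" where "Le s t = Neg (Less t s)"
definition Eq :: "tm \<Rightarrow> tm \<Rightarrow> fm" where "Eq s t = And (Le s t) (Le t s)"
definition BEx :: "nat \<Rightarrow> tm \<Rightarrow> fm \<Rightarrow> fm" where "BEx d t \<phi> = Ex (And (Less (V d) t) \<phi>)"
definition BAll :: "nat \<Rightarrow> tm \<Rightarrow> fm \<Rightarrow> fm" where "BAll d t \<phi> = Neg (BEx d t (Neg \<phi>))"

lemma sat_macros [simp]:
  "sat x g d e (Or \<phi> \<psi>) \<longleftrightarrow> sat x g d e \<phi> \<or> sat x g d e \<psi>"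
  "sat x g d e (Imp \<phi> \<psi>) \<longleftrightarrow> (sat x g d e \<phi> \<longrightarrow> sat x g d e \<psi>)"
  "sat x g d e (Le s t) \<longleftrightarrow> tval e s \<le> tval e t"
  "sat x g d e (Eq s t) \<longleftrightarrow> tval e s = tval e t"
  by (auto simp: Or_def Imp_def Le_def Eq_def)

lemma fwf_macros [simp]:
  "fwf d (Or \<phi> \<psi>) \<longleftrightarrow> fwf d \<phi> \<and> fwf d \<psi>"
  "fwf d (Imp \<phi> \<psi>) \<longleftrightarrow> fwf d \<phi> \<and> fwf d \<psi>"
  "fwf d (Le s t) \<longleftrightarrow> twf d s \<and> twf d t"
  "fwf d (Eq s t) \<longleftrightarrow> twf d s \<and> twf d t"
  "fwf d (BEx d' t \<phi>) \<longleftrightarrow> d' \<le> d \<and> twf (Suc d) t \<and> fwf (Suc d) \<phi>"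
  "fwf d (BAll d' t \<phi>) \<longleftrightarrow> d' \<le> d \<and> twf (Suc d) t \<and> fwf (Suc d) \<phi>"
  by (auto simp: Or_def Imp_def Le_def Eq_def BEx_def BAll_def)

lemma sat_BEx:
  assumes "twf d t" "tval e t \<le> e 1"
  shows "sat x g d e (BEx d t \<phi>) \<longleftrightarrow> (\<exists>v < tval e t. sat x g (Suc d) (e(d := v)) \<phi>)"
proof -
  have "tval (e(d := v)) t = tval e t" for v
    using assms(1) by (intro tval_cong[of d]) auto
  then show ?thesis
    unfolding BEx_def using assms(2) by (auto intro: less_le_trans)
qed

lemma sat_BAll:
  assumes "twf d t" "tval e t \<le> e 1"
  shows "sat x g d e (BAll d t \<phi>) \<longleftrightarrow> (\<forall>v < tval e t. sat x g (Suc d) (e(d := v)) \<phi>)"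
  unfolding BAll_def using sat_BEx[OF assms] by simp

definition block_len :: "tm \<Rightarrow> tm" where
  "block_len n = Plus (Plus n (C 1)) (Mul n n)"

definition fm_A :: "tm \<Rightarrow> tm \<Rightarrow> fm" where
  "fm_A u v = Sym 0 2 (Plus (V 3) (Plus (C 1) (Plus (Mul u (V 3)) v)))"

definition fm_B :: "tm \<Rightarrow> tm \<Rightarrow> fm" where
  "fm_B u v = Sym 0 2 (Plus (block_len (V 3)) (Plus (V 4) (Plus (C 1) (Plus (Mul u (V 4)) v))))"

definition fm_F :: "tm \<Rightarrow> tm \<Rightarrow> fm" where
  "fm_F u w = Sym 1 2 (Plus (Mul u (V 3)) w)"

definition fm_matching :: "tm \<Rightarrow> (tm \<Rightarrow> tm \<Rightarrow> fm) \<Rightarrow> fm" where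
  "fm_matching n A = BAll 5 n (And (Neg (A (V 5) (V 5)))
     (And (BAll 6 n (Imp (A (V 5) (V 6)) (A (V 6) (V 5))))
     (And (BEx 6 n (A (V 5) (V 6)))
       (BAll 6 n (BAll 7 n (Imp (And (A (V 5) (V 6)) (A (V 5) (V 7))) (Eq (V 6) (V 7))))))))"

definition fm_hom :: fm where
  "fm_hom = BAll 5 (V 4) (BAll 6 (V 4) (BAll 7 (V 3) (BAll 8 (V 3)
     (Imp (And (fm_F (V 5) (V 7)) (fm_F (V 6) (V 8)))
       (And (Imp (Le (V 5) (V 6)) (Le (V 7) (V 8)))
         (Imp (fm_B (V 5) (V 6)) (fm_A (V 7) (V 8))))))))"

definition fm_certificate :: fm where
  "fm_certificate =
     And (Eq (V 0) (Plus (block_len (V 3)) (block_len (V 4))))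
     (And (BAll 5 (V 3) (Sym 0 2 (V 5)))
     (And (Neg (Sym 0 2 (V 3)))
     (And (BAll 5 (V 4) (Sym 0 2 (Plus (block_len (V 3)) (V 5))))
     (And (Neg (Sym 0 2 (Plus (block_len (V 3)) (V 4))))
     (And (fm_matching (V 3) fm_A)
     (And (fm_matching (V 4) fm_B)
     (And (BAll 5 (V 4) (BEx 6 (V 3) (fm_F (V 5) (V 6))))
       fm_hom)))))))"

text \<open>Counter 1 will hold \<open>length x + 1\<close>, so the strict bound \<open>V 1\<close>
  expresses that \<open>n\<close> and \<open>m\<close> are at most \<open>length x\<close>.\<close>

definition fm_accepted :: fm where
  "fm_accepted = BEx 3 (V 1) (BEx 4 (V 1) fm_certificate)"

lemma sat_accepted:
  assumes "length g = length x"
  shows "sat x g 3 (env (Plus (V 0) (C 1)) x) fm_accepted \<longleftrightarrow> accepted x g"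
proof -
  let ?e = "env (Plus (V 0) (C 1)) x"
  have e: "?e 0 = length x" "?e 1 = Suc (length x)" "?e (Suc 0) = Suc (length x)" by (auto simp: env_def)
  let ?c = "\<lambda>n. n + 1 + n * n :: nat"
  have idxA: "u * n + v < n * n" if "u < n" "v < n" for u v n :: nat
  proof -
    have "Suc u * n \<le> n * n" using that by (intro mult_le_mono1) simp
    then show ?thesis using that by simp
  qed
  have body: "sat x g 5 (?e(3 := n, 4 := m)) fm_certificate \<longleftrightarrow> hom_certificate x g n m"
    if nm: "n \<le> length x" "m \<le> length x" for n m
  \<comment> \<open>With a wrong length both sides are false. With the right one all accessed
    positions lie inside the words, where \<open>Sym\<close> and \<open>!\<close> agree; beyond the
    end, \<open>Sym\<close> reads a blank while \<open>!\<close> is unspecified.\<close>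
  proof (cases "length x = ?c n + ?c m")
    case False
    then show ?thesis
      using e by (simp add: fm_certificate_def hom_certificate_def block_len_def)
  next
    case True
    have iA: "n + (1 + (u * n + v)) < length x" if "u < n" "v < n" for u v
      using idxA[OF that] True by simp
    have iB: "?c n + (m + (1 + (u * m + v))) < length x" if "u < m" "v < m" for u v
      using idxA[OF that] True by simp
    have iF: "u * n + w < length g" if "u < m" "w < n" for u w
    proof -
      have "Suc u * n \<le> m * n" using that by (intro mult_le_mono1) simp
      moreover have "m * n \<le> n * n + m * m"
        by (cases "m \<le> n") (auto intro: trans_le_add1 trans_le_add2 mult_le_mono)
      ultimately show ?thesis using that True assms by simp
    qed
    let ?e' = "?e(3 := n, 4 := m)"
    have e': "?e' 0 = length x" "?e' 1 = Suc (length x)" "?e' 3 = n" "?e' 4 = m" using e by auto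
    have A: "sat x g d f (fm_A s t) \<longleftrightarrow> x ! (n + (1 + (tval f s * n + tval f t)))"
      if "f 3 = n" "tval f s < n" "tval f t < n" for d f s t
      using iA[OF that(2,3)] that(1) bits_eq_2[of x "n + (1 + (tval f s * n + tval f t))"]
      by (simp add: fm_A_def)
    have B: "sat x g d f (fm_B s t) \<longleftrightarrow> x ! (?c n + (m + (1 + (tval f s * m + tval f t))))"
      if "f 3 = n" "f 4 = m" "tval f s < m" "tval f t < m" for d f s t
      using iB[OF that(3,4)] that(1,2) bits_eq_2[of x "?c n + (m + (1 + (tval f s * m + tval f t)))"]
      by (simp add: fm_B_def block_len_def)
    have F: "sat x g d f (fm_F s t) \<longleftrightarrow> g ! (tval f s * n + tval f t)"
      if "f 3 = n" "tval f s < m" "tval f t < n" for d f s t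
      using iF[OF that(2,3)] that(1) bits_eq_2[of g "tval f s * n + tval f t"]
      by (simp add: fm_F_def)
    have le: "n \<le> Suc (length x)" "m \<le> Suc (length x)" using nm by auto
    have MA: "sat x g 5 ?e' (fm_matching (V 3) fm_A) \<longleftrightarrow> matching_matrix n (\<lambda>u v. x ! (n + (1 + (u * n + v))))"
      unfolding fm_matching_def matching_matrix_def
      using e e' le by (simp add: sat_BAll sat_BEx A del: One_nat_def cong: conj_cong)
    have MB: "sat x g 5 ?e' (fm_matching (V 4) fm_B) \<longleftrightarrow>
        matching_matrix m (\<lambda>u v. x ! (?c n + (m + (1 + (u * m + v)))))"
      unfolding fm_matching_def matching_matrix_def
      using e e' le by (simp add: sat_BAll sat_BEx B del: One_nat_def cong: conj_cong)
    have X: "i < length x \<Longrightarrow> bits x (int i) = 2 \<longleftrightarrow> x ! i" for i using bits_eq_2 by simp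
    have S1: "sat x g 5 ?e' (BAll 5 (V 3) (Sym 0 2 (V 5))) \<longleftrightarrow> (\<forall>i<n. x ! i)"
      using e e' le True by (simp add: sat_BAll X del: One_nat_def)
    have S2: "sat x g 5 ?e' (BAll 5 (V 4) (Sym 0 2 (Plus (block_len (V 3)) (V 5)))) \<longleftrightarrow> (\<forall>i<m. x ! (?c n + i))"
    proof -
      have "sat x g 6 (?e'(5 := i)) (Sym 0 2 (Plus (block_len (V 3)) (V 5))) \<longleftrightarrow> x ! (?c n + i)" if "i < m" for i
        using X[of "?c n + i"] that True by (simp add: block_len_def)
      then show ?thesis using e e' le by (simp add: sat_BAll del: One_nat_def)
    qed
    have S3: "sat x g 5 ?e' (Neg (Sym 0 2 (V 3))) \<longleftrightarrow> \<not> x ! n"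
      using X[of n] True by simp
    have S4: "sat x g 5 ?e' (Neg (Sym 0 2 (Plus (block_len (V 3)) (V 4)))) \<longleftrightarrow> \<not> x ! (?c n + m)"
      using X[of "?c n + m"] True by (simp add: block_len_def)
    have S5: "sat x g 5 ?e' (BAll 5 (V 4) (BEx 6 (V 3) (fm_F (V 5) (V 6)))) \<longleftrightarrow> (\<forall>u<m. \<exists>w<n. g ! (u * n + w))"
      using e e' le by (simp add: sat_BAll sat_BEx F del: One_nat_def cong: conj_cong)
    have S6: "sat x g 5 ?e' fm_hom \<longleftrightarrow>
       (\<forall>u<m. \<forall>u'<m. \<forall>w<n. \<forall>w'<n. g ! (u * n + w) \<and> g ! (u' * n + w') \<longrightarrow>
        (u \<le> u' \<longrightarrow> w \<le> w') \<and>
        (x ! (?c n + (m + (1 + (u * m + u')))) \<longrightarrow> x ! (n + (1 + (w * n + w')))))"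
      unfolding fm_hom_def
      using e e' le by (simp add: sat_BAll F A B del: One_nat_def cong: conj_cong)
    have S0: "sat x g 5 ?e' (Eq (V 0) (Plus (block_len (V 3)) (block_len (V 4)))) \<longleftrightarrow> length x = ?c n + ?c m"
      using e by (simp add: block_len_def)
    show ?thesis
      unfolding fm_certificate_def hom_certificate_def
      by (simp only: sat.simps(4) S0 S1 S2 S3 S4 S5 S6 MA MB)
  qed
  have outer: "sat x g 3 ?e (BEx 3 (V 1) (BEx 4 (V 1) \<phi>)) \<longleftrightarrow>
      (\<exists>n\<le>length x. \<exists>m\<le>length x. sat x g 5 (?e(3 := n, 4 := m)) \<phi>)" for \<phi>
    using e by (simp add: sat_BEx less_Suc_eq_le)
  show ?thesis
    unfolding fm_accepted_def outer accepted_def using body by (simp only: cong: conj_cong)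
qed

theorem matching_hom_problem_in_NP: "matching_hom_problem \<in> NP"
proof -
  have "fwf 3 fm_accepted"
    by (simp add: fm_accepted_def fm_certificate_def fm_hom_def fm_matching_def fm_A_def fm_B_def fm_F_def block_len_def)
  then have "{x. \<exists>g. length g = length x \<and> sat x g 3 (env (Plus (V 0) (C 1)) x) fm_accepted} \<in> NP"
    by (rule NP_sat) (simp_all add: env_def)
  moreover have "{x. \<exists>g. length g = length x \<and> sat x g 3 (env (Plus (V 0) (C 1)) x) fm_accepted} =
      matching_hom_problem"
    using problem_iff_accepted sat_accepted by blast
  ultimately show ?thesis by simp
qed

section \<open>The reduction\<close>

text \<open>All keys have length 7. Nested loops produce the tuples in lexicographic order, so
  filtering out the keys lists the vertices in their order without any sorting.\<close>

fun tuples :: "nat \<Rightarrow> nat \<Rightarrow> nat list list" where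
  "tuples 0 N = [[]]"
| "tuples (Suc n) N = concat (map (\<lambda>a. map ((#) a) (tuples n N)) [0..<N])"

lemma set_tuples: "set (tuples n N) = {xs. length xs = n \<and> set xs \<subseteq> {..<N}}"
proof (induction n)
  case (Suc n)
  then have "set (tuples (Suc n) N) = {a # xs | a xs. a < N \<and> length xs = n \<and> set xs \<subseteq> {..<N}}"
    by auto
  also have "\<dots> = {xs. length xs = Suc n \<and> set xs \<subseteq> {..<N}}"
    by (auto simp: length_Suc_conv)
  finally show ?case .
qed auto

lemma sorted_tuples: "sorted_wrt (<) (tuples n N)"
proof (induction n)
  case (Suc n)
  have "sorted_wrt (<) (concat (map (\<lambda>a. map ((#) a) (tuples n N)) [0..<m]))" for m
  proof (induction m)
    case (Suc m)
    have "sorted_wrt (<) (map ((#) m) (tuples n N))"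
      using \<open>sorted_wrt (<) (tuples n N)\<close> by (simp add: sorted_wrt_map)
    with Suc show ?case by (auto simp: sorted_wrt_append)
  qed simp
  then show ?case by simp
qed simp

text \<open>Eliminates the vertices in favour of a quantifier-free condition on the seven entries;
  \<open>fm_vertex\<close> is its transcription.\<close>

lemma vertex_code_iff:
  "[x0, x1, x2, x3, x4, x5, x6] \<in> key R ` vertices G D J \<longleftrightarrow>
    (x0 = 0 \<and> x1 < G \<and> (x2 < 4 \<and> x3 = 0 \<and> x4 = 0 \<and> x5 = 0 \<and> x6 = 0 \<or>
       x2 = 4 \<and> x3 < J \<and> x4 < D \<and> x5 < G \<and> x5 \<noteq> x1 \<and> x6 < D)) \<or>
    (x0 = 1 \<and> x1 < x3 \<and> x3 < G \<and> x2 < D \<and> x4 < D \<and> (x5 < 4 \<and> x6 = 0 \<or>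
       x6 < J \<and> (x5 = 4 \<and> (R x1 x2 x3 x4 \<or> x6 \<noteq> x2) \<or> x5 = 6 \<and> \<not> R x1 x2 x3 x4 \<and> x6 = x2 \<or>
         x5 = 7 \<and> (R x1 x2 x3 x4 \<or> x6 \<noteq> x4) \<or> x5 = 5 \<and> \<not> R x1 x2 x3 x4 \<and> x6 = x4)))"
  (is "?x \<in> _ \<longleftrightarrow> ?P \<or> ?Q")
proof
  assume "?x \<in> key R ` vertices G D J"
  then obtain v where v: "?x = key R v" "v \<in> vertices G D J" by (rule imageE)
  then show "?P \<or> ?Q"
  proof (cases v)
    case (Sep b s)
    with v have b: "b \<in> blocks G D" "s < 4" "?x = b @ s # replicate (6 - length b) 0" by auto
    from b(1) show ?thesis
    proof (cases rule: blocks_cases)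
      case (1 g)
      then show ?thesis using b(2,3) by (simp add: eval_nat_numeral)
    next
      case (2 g a g' c)
      then show ?thesis using b(2,3) by (simp add: eval_nat_numeral)
    qed
  qed (auto split: if_splits)
next
  assume "?P \<or> ?Q"
  then consider "?P" "x2 < 4" | "?P" "x2 = 4" | "?Q" "x5 < 4" | "?Q" "x5 = 4 \<or> x5 = 6" | "?Q" "x5 = 7 \<or> x5 = 5"
    by fastforce
  then show "?x \<in> key R ` vertices G D J"
  proof cases
    case 1
    then show ?thesis by (intro image_eqI[of _ _ "Sep [0, x1] x2"]) (auto simp: eval_nat_numeral)
  next
    case 2
    then show ?thesis by (intro image_eqI[of _ _ "U x1 x3 x4 x5 x6"]) auto
  next
    case 3
    then show ?thesis by (intro image_eqI[of _ _ "Sep [1, x1, x2, x3, x4] x5"]) (auto simp: eval_nat_numeral)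
  next
    case 4
    then show ?thesis by (intro image_eqI[of _ _ "W x1 x6 x2 x3 x4"]) auto
  next
    case 5
    then show ?thesis by (intro image_eqI[of _ _ "W x3 x6 x4 x1 x2"]) auto
  qed
qed

definition swapped :: "nat \<Rightarrow> nat \<Rightarrow> bool" where
  "swapped s s' \<longleftrightarrow> s = 0 \<and> s' = 1 \<or> s = 1 \<and> s' = 0 \<or> s = 2 \<and> s' = 3 \<or> s = 3 \<and> s' = 2"

text \<open>Here \<open>x\<close> is the key of a \<open>U\<close> vertex, with group, choice, item,
  other group and other item at 1, 3, 4, 5, 6; \<open>y\<close> is the key of a \<open>W\<close>
  vertex, with the pair at 1 to 4, the rank at 5 and the choice at 6. The parity of the rank
  identifies the group, so adjacency can be recognised without \<open>R\<close>.\<close>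

definition crossing :: "(nat \<Rightarrow> nat) \<Rightarrow> (nat \<Rightarrow> nat) \<Rightarrow> bool" where
  "crossing x y \<longleftrightarrow> x 0 = 0 \<and> x 2 = 4 \<and> y 0 = 1 \<and> y 6 = x 3 \<and>
     (x 1 < x 5 \<and> (y 5 = 4 \<or> y 5 = 6) \<and> y 1 = x 1 \<and> y 2 = x 4 \<and> y 3 = x 5 \<and> y 4 = x 6 \<or>
      x 5 < x 1 \<and> (y 5 = 5 \<or> y 5 = 7) \<and> y 1 = x 5 \<and> y 2 = x 6 \<and> y 3 = x 1 \<and> y 4 = x 4)"

definition edge :: "(nat \<Rightarrow> nat) \<Rightarrow> (nat \<Rightarrow> nat) \<Rightarrow> bool" where
  "edge x y \<longleftrightarrow> (x 0 = 0 \<and> y 0 = 0 \<and> x 1 = y 1 \<and> swapped (x 2) (y 2)) \<or>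
     (x 0 = 1 \<and> y 0 = 1 \<and> x 1 = y 1 \<and> x 2 = y 2 \<and> x 3 = y 3 \<and> x 4 = y 4 \<and> swapped (x 5) (y 5)) \<or>
     crossing x y \<or> crossing y x"

lemma edge_sym: "edge x y \<longleftrightarrow> edge y x"
proof -
  have s: "swapped a b = swapped b a" for a b by (auto simp: swapped_def)
  show ?thesis
    unfolding edge_def s[of "x 2"] s[of "x 5"]
    by (simp only: eq_commute[of "x 1"] eq_commute[of "x 2"] eq_commute[of "x 3"] eq_commute[of "x 4"]
      conj_ac disj_ac)
qed

lemma edge_UW:
  assumes "U g j a g' b \<in> vertices G D J" "W g1 j1 a1 g1' b1 \<in> vertices G D J"
  shows "edge ((!) (key R (U g j a g' b))) ((!) (key R (W g1 j1 a1 g1' b1))) \<longleftrightarrow>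
    W g1 j1 a1 g1' b1 = partner (U g j a g' b)"
proof -
  have "g \<noteq> g'" "g1 \<noteq> g1'" using assms by auto
  then show ?thesis
    by (cases "g < g'"; cases "g1 < g1'") (auto simp: edge_def crossing_def)
qed

lemma key_W: "\<exists>p q r s l. key R (W g j a g' b) = [1, p, q, r, s, l, j] \<and> 4 \<le> l"
  by simp

lemma edge_iff:
  assumes "u \<in> vertices G D J" "v \<in> vertices G D J"
  shows "edge ((!) (key R u)) ((!) (key R v)) \<longleftrightarrow> v = partner u"
proof -
  have sep: "edge ((!) (key R (Sep b s))) ((!) (key R v)) \<longleftrightarrow> v = partner (Sep b s)"
    if bs: "b \<in> blocks G D" "s < 4" and v: "v \<in> vertices G D J" for b s v
  proof (cases v)
    case v': (Sep c t)
    with v have c: "c \<in> blocks G D" "t < 4" by auto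
    from bs(1) c(1) show ?thesis
      unfolding v' using bs(2) c(2)
      by (elim blocks_cases) (auto simp: edge_def swapped_def crossing_def eval_nat_numeral less_Suc_eq)
  next
    case (U g1 j1 a1 g1' b1)
    with bs show ?thesis
      by (auto simp: edge_def swapped_def crossing_def eval_nat_numeral elim!: blocks_cases)
  next
    case (W g1 j1 a1 g1' b1)
    obtain p q r s' l where k: "key R v = [1, p, q, r, s', l, j1]" "4 \<le> l"
      using key_W unfolding W by blast
    from bs have "\<not> edge ((!) (key R (Sep b s))) ((!) (key R v))"
      using k(2) unfolding k(1)
      by (auto simp: edge_def swapped_def crossing_def eval_nat_numeral elim!: blocks_cases)
    then show ?thesis by (simp add: W)
  qed
  have swap: "u = partner v \<longleftrightarrow> v = partner u"
    using partner_partner assms by metis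
  show ?thesis
  proof (cases u)
    case (Sep b s)
    with assms sep[of b s v] show ?thesis by simp
  next
    case u: (U g j a g' b)
    show ?thesis
    proof (cases v)
      case (Sep c t)
      with assms sep[of c t u] edge_sym[of "(!) (key R u)"] swap show ?thesis by simp
    next
      case v: (W g1 j1 a1 g1' b1)
      show ?thesis
        using assms unfolding u v by (rule edge_UW)
    qed (auto simp: u edge_def swapped_def crossing_def)
  next
    case u: (W g j a g' b)
    show ?thesis
    proof (cases v)
      case (Sep c t)
      with assms sep[of c t u] edge_sym[of "(!) (key R u)"] swap show ?thesis by simp
    next
      case v: (U g1 j1 a1 g1' b1)
      have "edge ((!) (key R v)) ((!) (key R u)) \<longleftrightarrow> u = partner v"
        using assms unfolding u v by (intro edge_UW)
      then show ?thesis using edge_sym swap by blast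
    next
      case v: (W g1 j1 a1 g1' b1)
      obtain p q r s l where k: "key R u = [1, p, q, r, s, l, j]" "4 \<le> l"
        using key_W unfolding u by blast
      obtain p' q' r' s' l' where k': "key R v = [1, p', q', r', s', l', j1]" "4 \<le> l'"
        using key_W unfolding v by blast
      have "\<not> edge ((!) (key R u)) ((!) (key R v))"
        using k(2) k'(2) unfolding k(1) k'(1) by (auto simp: edge_def swapped_def crossing_def)
      then show ?thesis by (simp add: u v)
    qed
  qed
qed

definition vertex_list :: "compat \<Rightarrow> nat \<Rightarrow> nat \<Rightarrow> nat \<Rightarrow> nat \<Rightarrow> nat list list" where
  "vertex_list R G D J N = filter (\<lambda>xs. xs \<in> key R ` vertices G D J) (tuples 7 N)"

text \<open>Besides groups, items and choices, the entries are ranks from 0 to 7; hence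
  \<open>8 \<le> N\<close>.\<close>

lemma key_tuple:
  assumes "v \<in> vertices G D J" "G \<le> N" "D \<le> N" "J \<le> N" "8 \<le> N"
  shows "key R v \<in> set (tuples 7 N)"
  using assms unfolding set_tuples
  by (cases v) (auto elim!: blocks_cases)

lemma set_vertex_list:
  assumes "G \<le> N" "D \<le> N" "J \<le> N" "8 \<le> N"
  shows "set (vertex_list R G D J N) = key R ` vertices G D J"
  unfolding vertex_list_def using key_tuple[OF _ assms] by auto

lemma sorted_vertex_list: "sorted_wrt (<) (vertex_list R G D J N)"
  unfolding vertex_list_def by (rule sorted_wrt_filter[OF sorted_tuples])

definition edge_matrix :: "nat list list \<Rightarrow> nat \<Rightarrow> nat \<Rightarrow> bool" where
  "edge_matrix L u v \<longleftrightarrow> edge ((!) (L ! u)) ((!) (L ! v))"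

text \<open>By \<open>edge_iff\<close> the matrix is the graph of \<open>partner\<close>, an
  involution without fixed points.\<close>

lemma matching_vertex_list:
  assumes L: "set L = key R ` vertices G D J" and sorted: "sorted_wrt (<) L"
  shows "matching_matrix (length L) (edge_matrix L)"
proof -
  let ?V = "vertices G D J"
  have "distinct L" using sorted strict_sorted_iff by blast
  have "\<exists>v\<in>?V. L ! i = key R v" if "i < length L" for i
    using nth_mem[OF that] L by auto
  then obtain p where p: "\<And>i. i < length L \<Longrightarrow> p i \<in> ?V \<and> L ! i = key R (p i)" by metis
  have inj: "i = j" if "i < length L" "j < length L" "p i = p j" for i j
    using p that nth_eq_iff_index_eq[OF \<open>distinct L\<close>] by metis
  have E: "edge_matrix L i j \<longleftrightarrow> p j = partner (p i)" if "i < length L" "j < length L" for i j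
  proof -
    have "edge_matrix L i j \<longleftrightarrow> edge ((!) (key R (p i))) ((!) (key R (p j)))"
      using p that by (simp add: edge_matrix_def)
    also have "\<dots> \<longleftrightarrow> p j = partner (p i)"
      by (rule edge_iff) (use p that in blast)+
    finally show ?thesis .
  qed
  have sur: "\<exists>i<length L. p i = v" if "v \<in> ?V" for v
  proof -
    have "key R v \<in> set L" using that L by auto
    then obtain i where i: "i < length L" "L ! i = key R v" by (auto simp: in_set_conv_nth)
    have "p i = v" by (rule key_inj[of _ G D J _ R]) (use i p that in auto)
    with i show ?thesis by blast
  qed
  show ?thesis
    unfolding matching_matrix_def
  proof (intro allI impI conjI)
    fix u assume u: "u < length L"
    show "\<not> edge_matrix L u u" using E[OF u u] partner_neq p[OF u] by metis
    show "\<exists>v<length L. edge_matrix L u v"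
      using sur[OF partner_vertices] p[OF u] E[OF u] by blast
    fix v assume v: "v < length L"
    show "edge_matrix L v u" if "edge_matrix L u v"
      using E[OF u v] E[OF v u] that p[OF u] partner_partner by metis
    fix w assume w: "w < length L"
    show "v = w" if "edge_matrix L u v \<and> edge_matrix L u w"
      using E[OF u v] E[OF u w] that inj[OF v w] by simp
  qed
qed

text \<open>A strictly sorted list is an order isomorphism between its indices and its
  entries.\<close>

lemma hom_iff_morphism:
  fixes L :: "'a :: linorder list" and L' :: "'b :: linorder list"
  assumes "sorted_wrt (<) L" "sorted_wrt (<) L'"
  shows "(\<exists>f. matrix_hom (length L) (\<lambda>u v. E (L ! u) (L ! v)) (length L') (\<lambda>u v. E' (L' ! u) (L' ! v)) f) \<longleftrightarrow>
    (\<exists>f. morphism (set L) (set L') E E' f)"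
proof
  have less: "L ! u < L ! v \<longleftrightarrow> u < v" if "u < length L" "v < length L" for u v
    using sorted_wrt_nth_less[OF assms(1)] that by (metis less_imp_not_less linorder_neqE_nat less_irrefl)
  have less': "L' ! u < L' ! v \<longleftrightarrow> u < v" if "u < length L'" "v < length L'" for u v
    using sorted_wrt_nth_less[OF assms(2)] that by (metis less_imp_not_less linorder_neqE_nat less_irrefl)
  {
    assume "\<exists>f. matrix_hom (length L) (\<lambda>u v. E (L ! u) (L ! v)) (length L') (\<lambda>u v. E' (L' ! u) (L' ! v)) f"
    then obtain f where f: "matrix_hom (length L) (\<lambda>u v. E (L ! u) (L ! v)) (length L') (\<lambda>u v. E' (L' ! u) (L' ! v)) f"
      by (elim exE)
    have "\<exists>i<length L. L ! i = x" if "x \<in> set L" for x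
      using that by (auto simp: in_set_conv_nth)
    then obtain ix where ix: "\<And>x. x \<in> set L \<Longrightarrow> ix x < length L \<and> L ! ix x = x" by metis
    have "ix x \<le> ix y" if "x \<in> set L" "y \<in> set L" "x \<le> y" for x y
      using ix[OF that(1)] ix[OF that(2)] less[of "ix y" "ix x"] that(3) by (metis not_le)
    then have "morphism (set L) (set L') E E' (\<lambda>x. L' ! f (ix x))"
      using f ix less' unfolding morphism_def matrix_hom_def
      by (auto intro!: mono_onI simp: not_less[symmetric] simp del: not_less)
    then show "\<exists>f. morphism (set L) (set L') E E' f" by (rule exI[of _ "\<lambda>x. L' ! f (ix x)"])
  }
  {
    assume "\<exists>f. morphism (set L) (set L') E E' f"
    then obtain f where f: "morphism (set L) (set L') E E' f" by (elim exE)
    have "\<exists>i<length L'. L' ! i = f (L ! u)" if "u < length L" for u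
    proof -
      have "f (L ! u) \<in> set L'" using f nth_mem[OF that] unfolding morphism_def by blast
      then show ?thesis by (simp add: in_set_conv_nth)
    qed
    then obtain h where h: "\<And>u. u < length L \<Longrightarrow> h u < length L' \<and> L' ! h u = f (L ! u)" by metis
    have mono: "h u \<le> h v" if "u < length L" "v < length L" "u \<le> v" for u v
    proof -
      have "L ! u \<le> L ! v" using less[of v u] that by (metis not_le)
      then have "f (L ! u) \<le> f (L ! v)"
        using f that unfolding morphism_def by (auto elim!: mono_onD)
      then have "\<not> L' ! h v < L' ! h u" using h that by auto
      then show ?thesis using less' h that by (metis not_le)
    qed
    have "matrix_hom (length L) (\<lambda>u v. E (L ! u) (L ! v)) (length L') (\<lambda>u v. E' (L' ! u) (L' ! v)) h"
      unfolding matrix_hom_def using h mono f nth_mem unfolding morphism_def by auto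
    then show "\<exists>f. matrix_hom (length L) (\<lambda>u v. E (L ! u) (L ! v)) (length L') (\<lambda>u v. E' (L' ! u) (L' ! v)) f"
      by (rule exI[of _ h])
  }
qed

lemma morphism_cong:
  assumes "\<And>u v. u \<in> S \<Longrightarrow> v \<in> S \<Longrightarrow> E u v = F u v" "\<And>u v. u \<in> T \<Longrightarrow> v \<in> T \<Longrightarrow> E' u v = F' u v"
  shows "morphism S T E E' f \<longleftrightarrow> morphism S T F F' f"
  unfolding morphism_def using assms by (auto simp: image_subset_iff)

definition graph_code :: "nat list list \<Rightarrow> bool list" where
  "graph_code L = matrix_code (length L) (edge_matrix L)"

text \<open>The target is encoded first, since the problem asks for a homomorphism from the second
  matching to the first.\<close>

theorem solvable_iff_codes:
  assumes D: "0 < D" and N: "G \<le> N" "D \<le> N" "8 \<le> N"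
  shows "graph_code (vertex_list R G D D N) @ graph_code (vertex_list (\<lambda>_ _ _ _. True) G D 1 N)
    \<in> matching_hom_problem \<longleftrightarrow> solvable G D R"
proof -
  let ?T = "\<lambda>_ _ _ _. True"
  let ?L = "vertex_list R G D D N" and ?L' = "vertex_list ?T G D 1 N"
  have set: "set ?L = key R ` vertices G D D" "set ?L' = key ?T ` vertices G D 1"
    using N by (auto simp: set_vertex_list)
  have adj: "edge ((!) x) ((!) y) \<longleftrightarrow> adjacent R' (vertices G D J) x y"
    if xy: "x \<in> key R' ` vertices G D J" "y \<in> key R' ` vertices G D J" for x y R' J
  proof -
    obtain u v where uv: "u \<in> vertices G D J" "v \<in> vertices G D J" "x = key R' u" "y = key R' v"
      using xy by blast
    have "edge ((!) x) ((!) y) \<longleftrightarrow> v = partner u"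
      unfolding uv by (rule edge_iff) fact+
    also have "\<dots> \<longleftrightarrow> adjacent R' (vertices G D J) x y"
    proof
      assume "v = partner u"
      then show "adjacent R' (vertices G D J) x y" unfolding adjacent_def using uv by blast
    next
      assume "adjacent R' (vertices G D J) x y"
      then obtain w where w: "w \<in> vertices G D J" "x = key R' w" "y = key R' (partner w)"
        unfolding adjacent_def by blast
      have "u = w" by (rule key_inj[OF uv(1) w(1), of R']) (use uv w in simp)
      moreover have "v = partner w" by (rule key_inj[OF uv(2) partner_vertices[OF w(1)], of R']) (use uv w in simp)
      ultimately show "v = partner u" by simp
    qed
    finally show ?thesis .
  qed
  have mc: "morphism (key ?T ` vertices G D 1) (key R ` vertices G D D)
      (\<lambda>x y. edge ((!) x) ((!) y)) (\<lambda>x y. edge ((!) x) ((!) y)) f \<longleftrightarrow>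
    morphism (key ?T ` vertices G D 1) (key R ` vertices G D D)
      (adjacent ?T (vertices G D 1)) (adjacent R (vertices G D D)) f" for f
    by (rule morphism_cong; rule adj; assumption)
  have "graph_code ?L @ graph_code ?L' \<in> matching_hom_problem \<longleftrightarrow>
      (\<exists>f. matrix_hom (length ?L') (edge_matrix ?L') (length ?L) (edge_matrix ?L) f)"
    unfolding graph_code_def
    by (rule problem_code_iff matching_vertex_list set sorted_vertex_list)+
  also have "\<dots> \<longleftrightarrow> (\<exists>f. morphism (set ?L') (set ?L) (\<lambda>x y. edge ((!) x) ((!) y)) (\<lambda>x y. edge ((!) x) ((!) y)) f)"
    unfolding edge_matrix_def[abs_def]
    by (rule hom_iff_morphism[OF sorted_vertex_list sorted_vertex_list])
  also have "\<dots> \<longleftrightarrow> (\<exists>f. morphism (key ?T ` vertices G D 1) (key R ` vertices G D D)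
      (adjacent ?T (vertices G D 1)) (adjacent R (vertices G D D)) f)"
    unfolding set mc ..
  also have "\<dots> \<longleftrightarrow> solvable G D R"
    by (rule solvable_iff_morphism[OF D, symmetric])
  finally show ?thesis .
qed

section \<open>Compatibility of items as a bounded formula\<close>

definition Const :: "bool \<Rightarrow> fm" where
  "Const b = (if b then Less (C 0) (C 1) else Less (C 0) (C 0))"

lemma sat_Const [simp]: "sat x g d e (Const b) \<longleftrightarrow> b"
  by (simp add: Const_def)

lemma fwf_Const [simp]: "fwf d (Const b)"
  by (simp add: Const_def)

text \<open>Actions and tapes of the fixed machine are finite in number independently of the input.
  Quantifiers over them are unrolled into conjunctions.\<close>

definition Conj :: "fm list \<Rightarrow> fm" where
  "Conj \<phi>s = foldr And \<phi>s (Const True)"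

lemma sat_Conj [simp]: "sat x g d e (Conj \<phi>s) \<longleftrightarrow> (\<forall>\<phi>\<in>set \<phi>s. sat x g d e \<phi>)"
  unfolding Conj_def by (induction \<phi>s) auto

lemma fwf_Conj [simp]: "fwf d (Conj \<phi>s) \<longleftrightarrow> (\<forall>\<phi>\<in>set \<phi>s. fwf d \<phi>)"
  unfolding Conj_def by (induction \<phi>s) auto

lemma sat_Conj_upt: "sat x g d e (Conj (map \<phi> [0..<n])) \<longleftrightarrow> (\<forall>i<n. sat x g d e (\<phi> i))"
  by auto

lemma sat_Conj_pairs:
  "sat x g d e (Conj (map (\<lambda>(i, j). \<phi> i j) (List.product [0..<m] [0..<n]))) \<longleftrightarrow>
    (\<forall>i<m. \<forall>j<n. sat x g d e (\<phi> i j))"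
  by auto

primrec tpow :: "tm \<Rightarrow> nat \<Rightarrow> tm" where
  "tpow t 0 = C 1"
| "tpow t (Suc i) = Mul t (tpow t i)"

lemma tval_tpow [simp]: "tval e (tpow t i) = tval e t ^ i"
  by (induction i) auto

lemma twf_tpow [simp]: "twf d t \<Longrightarrow> twf d (tpow t i)"
  by (induction i) auto

lemma tm_of_poly: "\<exists>t. twf 1 t \<and> (\<forall>e. tval e t = poly (p :: nat poly) (e 0))"
proof (induction p)
  case 0
  show ?case by (intro exI[of _ "C 0"]) simp
next
  case (pCons a p)
  then obtain t where "twf 1 t" "\<forall>e. tval e t = poly p (e 0)" by blast
  then show ?case by (intro exI[of _ "Plus (C a) (Mul (V 0) t)"]) simp
qed

lemma twf_Suc: "twf d t \<Longrightarrow> twf (Suc d) t"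
  by (rule twf_mono) auto

lemma tval_upd: "twf d t \<Longrightarrow> d \<le> i \<Longrightarrow> tval (e(i := v)) t = tval e t"
  by (rule tval_cong) auto

lemma dig_unique:
  assumes "rest < P ^ i" "v < P" "a = (q * P + v) * P ^ i + rest"
  shows "v = dig P a i"
proof -
  have "P ^ i \<noteq> 0" using assms(1) by (cases "P ^ i") auto
  then have "a div P ^ i = q * P + v" using assms(1) unfolding assms(3) by (intro div_nat_eqI) (simp_all add: algebra_simps)
  then show ?thesis using assms(2) by (simp add: dig_def)
qed

lemma dig_split: "a = (a div P ^ i div P * P + dig P a i) * P ^ i + a mod P ^ i"
  unfolding dig_def by (simp add: div_mult_mod_eq)

text \<open>
  Binds variable \<open>d\<close> to the \<open>i\<close>-th digit of \<open>a\<close>; the quotient and the remainder are quantified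
  only to express this.
\<close>

definition With_digit :: "nat \<Rightarrow> tm \<Rightarrow> nat \<Rightarrow> tm \<Rightarrow> fm \<Rightarrow> fm" where
  "With_digit d P i a \<phi> = Ex (And
     (Ex (Ex (And (Eq a (Plus (Mul (Plus (Mul (V (d + 1)) P) (V d)) (tpow P i)) (V (d + 2))))
        (And (Less (V (d + 2)) (tpow P i)) (Less (V d) P))))) \<phi>)"

text \<open>The digit, the quotient and the remainder are all at most \<open>a\<close>, hence below
  the bound of the quantifiers.\<close>

lemma sat_With_digit:
  assumes wf: "twf d a" "twf d P" and "2 \<le> d" and P: "0 < tval e P" and a: "tval e a < e 1"
  shows "sat x g d e (With_digit d P i a \<phi>) \<longleftrightarrow>
    sat x g (Suc d) (e(d := dig (tval e P) (tval e a) i)) \<phi>"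
proof -
  let ?P = "tval e P" and ?a = "tval e a"
  let ?body = "\<lambda>v q r. ?a = (q * ?P + v) * ?P ^ i + r \<and> r < ?P ^ i \<and> v < ?P"
  have "tval (e(d := v, Suc d := q, Suc (Suc d) := r)) t = tval e t" if "twf d t" for t v q r
    using that by (simp add: tval_upd)
  then have "sat x g d e (With_digit d P i a \<phi>) \<longleftrightarrow>
      (\<exists>v<e 1. (\<exists>q<e 1. \<exists>r<e 1. ?body v q r) \<and> sat x g (Suc d) (e(d := v)) \<phi>)"
    unfolding With_digit_def using wf \<open>2 \<le> d\<close> by simp
  also have "\<dots> \<longleftrightarrow> sat x g (Suc d) (e(d := dig ?P ?a i)) \<phi>"
  proof
    assume "\<exists>v<e 1. (\<exists>q<e 1. \<exists>r<e 1. ?body v q r) \<and> sat x g (Suc d) (e(d := v)) \<phi>"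
    then obtain v q r where "?body v q r" "sat x g (Suc d) (e(d := v)) \<phi>" by blast
    then show "sat x g (Suc d) (e(d := dig ?P ?a i)) \<phi>" using dig_unique by blast
  next
    assume s: "sat x g (Suc d) (e(d := dig ?P ?a i)) \<phi>"
    have b: "?body (dig ?P ?a i) (?a div ?P ^ i div ?P) (?a mod ?P ^ i)"
      using P by (intro conjI dig_split) (simp_all add: dig_def)
    have "?a div ?P ^ i \<le> ?a" by simp
    moreover have "?a div ?P ^ i div ?P \<le> ?a div ?P ^ i" "dig ?P ?a i \<le> ?a div ?P ^ i" "?a mod ?P ^ i \<le> ?a"
      unfolding dig_def by simp_all
    ultimately have "?a div ?P ^ i div ?P < e 1" "dig ?P ?a i < e 1" "?a mod ?P ^ i < e 1"
      using a by linarith+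
    with b s show "\<exists>v<e 1. (\<exists>q<e 1. \<exists>r<e 1. ?body v q r) \<and> sat x g (Suc d) (e(d := v)) \<phi>"
      by blast
  qed
  finally show ?thesis .
qed

lemma fwf_With_digit:
  assumes "twf d a" "twf d P" "fwf (Suc d) \<phi>"
  shows "fwf d (With_digit d P i a \<phi>)"
  using assms unfolding With_digit_def by (simp add: twf_Suc)

context tableau
begin

text \<open>Terms have no subtraction. A position below \<open>T\<close> is a negative cell and
  hence blank; otherwise the cell is the number \<open>V d\<close> that gives the position when
  added to \<open>T\<close>.\<close>

definition fm_init :: "nat \<Rightarrow> tm \<Rightarrow> nat \<Rightarrow> tm \<Rightarrow> nat \<Rightarrow> fm" where
  "fm_init d tT j p c = (if j = 0 then Or (And (Less p tT) (Const (c = 0)))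
     (Ex (And (Eq p (Plus tT (V d))) (Sym 0 c (V d)))) else Const (c = 0))"

lemma sat_fm_init:
  assumes "twf d p" "twf d tT" "2 \<le> d" "tval e p < e 1"
  shows "sat x g d e (fm_init d tT j p c) \<longleftrightarrow> init_cells x j (int (tval e p) - int (tval e tT)) = c"
proof -
  have u: "tval (e(d := v)) p = tval e p" "tval (e(d := v)) tT = tval e tT" for v
    using assms by (simp_all add: tval_upd)
  show ?thesis
  proof (cases "tval e p < tval e tT")
    case True
    then have "bits x (int (tval e p) - int (tval e tT)) = 0" by (simp add: bits_eq_0)
    then show ?thesis using True unfolding fm_init_def by (auto simp: init_cells_def u)
  next
    case False
    define y where "y = tval e p - tval e tT"
    have y: "tval e p = tval e tT + y" "y < e 1" "int (tval e p) - int (tval e tT) = int y"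
      using False assms(4) by (auto simp: y_def)
    show ?thesis
      unfolding fm_init_def using y by (auto simp: init_cells_def u)
  qed
qed

lemma fwf_fm_init: "twf d p \<Longrightarrow> twf d tT \<Longrightarrow> fwf d (fm_init d tT j p c)"
  unfolding fm_init_def by (simp add: twf_Suc)

text \<open>The action \<open>i\<close> is a number and not a term, because
  \<open>fm_actions\<close> distinguishes all pairs of actions. The look-ups in the transition table
  thus happen when the formula is built.\<close>

definition fm_admissible :: "tm \<Rightarrow> tm \<Rightarrow> nat \<Rightarrow> fm" where
  "fm_admissible tT t i = And
     (Imp (Eq t (C 0)) (Const ((if i = r then start M else src i) = (if i = r then accepting M else start M))))
     (Imp (Eq (Plus t (C 1)) tT) (Const (i = r)))"

definition fm_admissible_tape :: "nat \<Rightarrow> tm \<Rightarrow> tm \<Rightarrow> nat \<Rightarrow> nat \<Rightarrow> tm \<Rightarrow> tm \<Rightarrow> fm" where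
  "fm_admissible_tape d tT t i j p l = And (Imp (Eq t (C 0)) (Eq p tT))
     (if i < r then Imp (Le t l) (fm_init d tT j p (rd i j)) else Const True)"

definition fm_consistent :: "tm \<Rightarrow> tm \<Rightarrow> nat \<Rightarrow> nat \<Rightarrow> fm" where
  "fm_consistent s t i i' = Imp (Eq t (Plus s (C 1)))
     (Const ((i = r \<longrightarrow> i' = r) \<and> (i < r \<longrightarrow> dst i = (if i' = r then accepting M else src i'))))"

definition fm_shift :: "direction \<Rightarrow> tm \<Rightarrow> tm \<Rightarrow> fm" where
  "fm_shift D p p' = (case D of Left \<Rightarrow> Eq p (Plus p' (C 1)) | Stay \<Rightarrow> Eq p p' | Right \<Rightarrow> Eq p' (Plus p (C 1)))"

lemma sat_fm_shift: "sat x g d e (fm_shift D p p') \<longleftrightarrow> int (tval e p') = int (tval e p) + offset D"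
  by (cases D) (auto simp: fm_shift_def)

definition fm_consistent_tape :: "tm \<Rightarrow> tm \<Rightarrow> nat \<Rightarrow> nat \<Rightarrow> nat \<Rightarrow> tm \<Rightarrow> tm \<Rightarrow> tm \<Rightarrow> fm" where
  "fm_consistent_tape s t i i' j p p' l' = And
     (if i < r then Imp (Eq t (Plus s (C 1))) (fm_shift (mv i j) p p') else Const True)
     (if i' < r then And (Imp (Eq l' s) (And (Eq p p') (Const (wr i j = rd i' j))))
        (Imp (Or (Less l' s) (Le t l')) (Neg (Eq p p'))) else Const True)"

definition fm_tape :: "nat \<Rightarrow> tm \<Rightarrow> tm \<Rightarrow> tm \<Rightarrow> nat \<Rightarrow> nat \<Rightarrow> nat \<Rightarrow> tm \<Rightarrow> tm \<Rightarrow> tm \<Rightarrow> tm \<Rightarrow> fm" where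
  "fm_tape d tT s t i i' j p l p' l' = And (fm_admissible_tape d tT s i j p l)
     (And (fm_admissible_tape d tT t i' j p' l') (fm_consistent_tape s t i i' j p p' l'))"

text \<open>Variables \<open>d\<close> and \<open>d + 1\<close> already hold the two actions; the
  four digits of tape \<open>j\<close> follow them.\<close>

definition fm_tapes :: "nat \<Rightarrow> tm \<Rightarrow> tm \<Rightarrow> tm \<Rightarrow> tm \<Rightarrow> tm \<Rightarrow> tm \<Rightarrow> nat \<Rightarrow> nat \<Rightarrow> nat \<Rightarrow> fm" where
  "fm_tapes d tT tP s a t b i i' j =
     With_digit (d + 2) tP (2 * j + 1) a (With_digit (d + 3) tP (2 * j + 2) a
       (With_digit (d + 4) tP (2 * j + 1) b (With_digit (d + 5) tP (2 * j + 2) b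
         (fm_tape (d + 6) tT s t i i' j (V (d + 2)) (V (d + 3)) (V (d + 4)) (V (d + 5))))))"

definition fm_actions :: "nat \<Rightarrow> tm \<Rightarrow> tm \<Rightarrow> tm \<Rightarrow> tm \<Rightarrow> tm \<Rightarrow> tm \<Rightarrow> fm" where
  "fm_actions d tT tP s a t b = And (And (Le (V d) (C r)) (Le (V (d + 1)) (C r)))
     (Conj (map (\<lambda>(i, i'). Imp (And (Eq (V d) (C i)) (Eq (V (d + 1)) (C i')))
        (And (And (fm_admissible tT s i) (And (fm_admissible tT t i') (fm_consistent s t i i')))
          (Conj (map (fm_tapes d tT tP s a t b i i') [0..<k]))))
        (List.product [0..<Suc r] [0..<Suc r])))"

definition fm_compatible :: "nat \<Rightarrow> tm \<Rightarrow> tm \<Rightarrow> tm \<Rightarrow> tm \<Rightarrow> tm \<Rightarrow> tm \<Rightarrow> fm" where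
  "fm_compatible d tT tP s a t b =
     With_digit d tP 0 a (With_digit (d + 1) tP 0 b (fm_actions d tT tP s a t b))"

lemma fwf_fm_compatible:
  assumes "twf d tT" "twf d tP" "twf d s" "twf d a" "twf d t" "twf d b"
  shows "fwf d (fm_compatible d tT tP s a t b)"
proof -
  have wf: "twf (d + n) tT" "twf (d + n) tP" "twf (d + n) s" "twf (d + n) a" "twf (d + n) t" "twf (d + n) b" for n
    using assms by (auto intro: twf_mono)
  have shift: "fwf (d + 6) (fm_shift D (V (d + 2)) (V (d + 4)))" for D
    by (cases D) (simp_all add: fm_shift_def)
  have tape: "fwf (d + 6) (fm_tape (d + 6) tT s t i i' j (V (d + 2)) (V (d + 3)) (V (d + 4)) (V (d + 5)))" for i i' j
    unfolding fm_tape_def fm_admissible_tape_def fm_consistent_tape_def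
    using wf[of 6] shift by (simp add: fwf_fm_init)
  have digits: "fwf (d + 2) (fm_tapes d tT tP s a t b i i' j)" for i i' j
    unfolding fm_tapes_def
    using tape wf[of 2] wf[of 3] wf[of 4] wf[of 5]
    by (auto intro!: fwf_With_digit simp: eval_nat_numeral)
  have "fwf (d + 2) (And (fm_admissible tT s i) (And (fm_admissible tT t i') (fm_consistent s t i i')))" for i i'
    unfolding fm_admissible_def fm_consistent_def using wf[of 2] by simp
  then show ?thesis
    unfolding fm_compatible_def fm_actions_def using assms wf[of 1] digits
    by (auto intro!: fwf_With_digit simp: twf_Suc)
qed

lemma sat_fm_tape:
  assumes "twf d p" "twf d p'" "twf d tT" "2 \<le> d" "tval e p < e 1" "tval e p' < e 1" "tval e tT = T"
  shows "sat x g d e (fm_tape d tT s t i i' j p l p' l') \<longleftrightarrow>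
    ((tval e s = 0 \<longrightarrow> tval e p = T) \<and>
      (i < r \<longrightarrow> tval e s \<le> tval e l \<longrightarrow> init_cells x j (int (tval e p) - int T) = rd i j)) \<and>
    ((tval e t = 0 \<longrightarrow> tval e p' = T) \<and>
      (i' < r \<longrightarrow> tval e t \<le> tval e l' \<longrightarrow> init_cells x j (int (tval e p') - int T) = rd i' j)) \<and>
    (i < r \<longrightarrow> tval e t = Suc (tval e s) \<longrightarrow> int (tval e p') = int (tval e p) + offset (mv i j)) \<and>
    (i' < r \<longrightarrow> (tval e l' = tval e s \<longrightarrow> tval e p = tval e p' \<and> wr i j = rd i' j) \<and>
      (tval e l' < tval e s \<or> tval e t \<le> tval e l' \<longrightarrow> tval e p \<noteq> tval e p'))"
  using assms unfolding fm_tape_def fm_admissible_tape_def fm_consistent_tape_def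
  by (simp add: sat_fm_init sat_fm_shift)

text \<open>The formula decodes the digits of a tape once and states all conditions on them
  together, whereas \<open>compatible\<close> collects the conditions of each item and of the pair
  separately.\<close>

lemma conj_bounded_all_shuffle:
  "(p \<and> q \<and> (a \<and> b \<and> c) \<and> (\<forall>j<n. f j \<and> g j \<and> h j \<and> h' j)) \<longleftrightarrow>
   (p \<and> a \<and> (\<forall>j<n. f j)) \<and> (q \<and> b \<and> (\<forall>j<n. g j)) \<and> c \<and> (\<forall>j<n. h j \<and> h' j)" for n :: nat
  by blast

lemma admissible_iff:
  "admissible x t a \<longleftrightarrow> act a \<le> r \<and>
     ((t = 0 \<longrightarrow> (if act a = r then start M else src (act a)) = (if act a = r then accepting M else start M)) \<and>
      (Suc t = T \<longrightarrow> act a = r)) \<and>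
     (\<forall>j<k. (t = 0 \<longrightarrow> pos j a = T) \<and>
       (act a < r \<longrightarrow> t \<le> lst j a \<longrightarrow> init_cells x j (int (pos j a) - int T) = rd (act a) j))"
  unfolding admissible_def by blast

lemma consistent_iff:
  "consistent s a t b \<longleftrightarrow>
     (Suc s = t \<longrightarrow> (act a = r \<longrightarrow> act b = r) \<and>
        (act a < r \<longrightarrow> dst (act a) = (if act b = r then accepting M else src (act b)))) \<and>
     (\<forall>j<k. (act a < r \<longrightarrow> t = Suc s \<longrightarrow> int (pos j b) = int (pos j a) + offset (mv (act a) j)) \<and>
       (act b < r \<longrightarrow> (lst j b = s \<longrightarrow> pos j a = pos j b \<and> wr (act a) j = rd (act b) j) \<and>
        (lst j b < s \<or> t \<le> lst j b \<longrightarrow> pos j a \<noteq> pos j b)))"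
  unfolding consistent_def by blast

lemmas compatible_iff = compatible_def admissible_iff consistent_iff

lemma sat_fm_compatible:
  assumes wf: "twf d tT" "twf d tP" "twf d s" "twf d a" "twf d t" "twf d b" and d: "2 \<le> d"
    and tT: "tval e tT = T" and tP: "tval e tP = P" and le: "P \<le> e 1"
    and ab: "tval e a < e 1" "tval e b < e 1"
  shows "sat x g d e (fm_compatible d tT tP s a t b) \<longleftrightarrow>
    compatible x (tval e s) (tval e a) (tval e t) (tval e b)"
proof -
  let ?s = "tval e s" and ?a = "tval e a" and ?t = "tval e t" and ?b = "tval e b"
  have P0: "0 < P" using P by simp
  have wfn: "twf (d + n) tT" "twf (d + n) tP" "twf (d + n) s" "twf (d + n) a" "twf (d + n) t" "twf (d + n) b" for n
    using wf by (auto intro: twf_mono)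
  define e2 where "e2 = e(d := act ?a, d + 1 := act ?b)"
  have e2: "tval e2 z = tval e z" if "twf d z" for z
    using that unfolding e2_def by (simp add: tval_upd)
  have e2': "e2 1 = e 1" "e2 d = act ?a" "e2 (d + 1) = act ?b" using d by (auto simp: e2_def)
  have digP: "dig P z n < e 1" for z n
    using less_le_trans[OF mod_less_divisor[OF P0] le] by (simp add: dig_def)
  define e6 where "e6 j = e2(d + 2 := pos j ?a, d + 3 := lst j ?a, d + 4 := pos j ?b, d + 5 := lst j ?b)" for j
  have e6: "tval (e6 j) z = tval e z" if "twf d z" for z j
    using that e2[OF that] unfolding e6_def by (simp add: tval_upd)
  have e6': "e6 j 1 = e 1" "e6 j (d + 2) = pos j ?a" "e6 j (d + 3) = lst j ?a"
    "e6 j (d + 4) = pos j ?b" "e6 j (d + 5) = lst j ?b" for j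
    using d e2'(1) by (auto simp: e6_def)
  have step: "sat x g n f (With_digit n tP m z \<phi>) \<longleftrightarrow> sat x g (Suc n) (f(n := dig P (tval e z) m)) \<phi>"
    if "d \<le> n" "f 1 = e 1" "tval f tP = P" "tval f z = tval e z" "twf d z" "tval e z < e 1" for n f m z \<phi>
    using that d P0 twf_mono[OF wf(2) that(1)] twf_mono[OF that(5,1)] by (subst sat_With_digit) auto
  have digits: "sat x g (d + 2) e2 (With_digit (d + 2) tP (2 * j + 1) a (With_digit (d + 3) tP (2 * j + 2) a
       (With_digit (d + 4) tP (2 * j + 1) b (With_digit (d + 5) tP (2 * j + 2) b \<phi>)))) \<longleftrightarrow>
     sat x g (d + 6) (e6 j) \<phi>" for j \<phi>
  proof -
    have S: "Suc (d + 2) = d + 3" "Suc (d + 3) = d + 4" "Suc (d + 4) = d + 5" "Suc (d + 5) = d + 6" by simp_all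
    have u: "tval (f(n := v)) z = tval f z" if "d \<le> n" "twf d z" for f n v z
      using that by (simp add: tval_upd)
    show ?thesis
      unfolding e6_def pos_def lst_def
      by (simp only: step S u e2 e2' wf ab tP fun_upd_other le_add1)
  qed
  have tape: "sat x g (d + 6) (e6 j) (fm_tape (d + 6) tT s t i i' j (V (d + 2)) (V (d + 3)) (V (d + 4)) (V (d + 5))) \<longleftrightarrow>
    ((?s = 0 \<longrightarrow> pos j ?a = T) \<and>
      (i < r \<longrightarrow> ?s \<le> lst j ?a \<longrightarrow> init_cells x j (int (pos j ?a) - int T) = rd i j)) \<and>
    ((?t = 0 \<longrightarrow> pos j ?b = T) \<and>
      (i' < r \<longrightarrow> ?t \<le> lst j ?b \<longrightarrow> init_cells x j (int (pos j ?b) - int T) = rd i' j)) \<and>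
    (i < r \<longrightarrow> ?t = Suc ?s \<longrightarrow> int (pos j ?b) = int (pos j ?a) + offset (mv i j)) \<and>
    (i' < r \<longrightarrow> (lst j ?b = ?s \<longrightarrow> pos j ?a = pos j ?b \<and> wr i j = rd i' j) \<and>
      (lst j ?b < ?s \<or> ?t \<le> lst j ?b \<longrightarrow> pos j ?a \<noteq> pos j ?b))" for i i' j
  proof -
    have p: "pos j z < e 1" for z unfolding pos_def by (rule digP)
    have w: "twf (d + 6) (V (d + 2))" "twf (d + 6) (V (d + 4))" "2 \<le> d + 6" by simp_all
    note tape = sat_fm_tape[where d = "d + 6" and p = "V (d + 2)" and p' = "V (d + 4)" and tT = tT and
      e = "e6 j" and s = s and t = t and l = "V (d + 3)" and l' = "V (d + 5)" and i = i and
      i' = i' and j = j and x = x and g = g,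
      unfolded tval.simps e6' e6[OF wf(1)] e6[OF wf(3)] e6[OF wf(5)] tT]
    show ?thesis
      by (rule tape; (rule w | rule wfn | rule p | rule refl))
  qed
  have "sat x g d e (fm_compatible d tT tP s a t b) \<longleftrightarrow> act ?a \<le> r \<and> act ?b \<le> r \<and>
     (\<forall>i\<le>r. \<forall>i'\<le>r. act ?a = i \<and> act ?b = i' \<longrightarrow>
       sat x g (d + 2) e2 (And (fm_admissible tT s i) (And (fm_admissible tT t i') (fm_consistent s t i i'))) \<and>
       (\<forall>j<k. sat x g (d + 6) (e6 j) (fm_tape (d + 6) tT s t i i' j (V (d + 2)) (V (d + 3)) (V (d + 4)) (V (d + 5)))))"
  proof -
    have "sat x g d e (fm_compatible d tT tP s a t b) \<longleftrightarrow> sat x g (d + 2) e2 (fm_actions d tT tP s a t b)"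
      unfolding fm_compatible_def e2_def act_def
      by (subst step, use wf ab tP in simp_all, subst step)
        (use wf ab tP d in \<open>simp_all add: tval_upd\<close>)
    then show ?thesis
      unfolding fm_actions_def sat.simps(4) sat_Conj_pairs sat_Conj_upt fm_tapes_def digits sat_macros tval.simps e2' less_Suc_eq_le
        conj_assoc .
  qed
  \<comment> \<open>Only the conjunct for the actual actions of \<open>?a\<close> and
    \<open>?b\<close> imposes a condition.\<close>
  also have "\<dots> \<longleftrightarrow> act ?a \<le> r \<and> act ?b \<le> r \<and>
      (let i = act ?a; i' = act ?b in
       sat x g (d + 2) e2 (And (fm_admissible tT s i) (And (fm_admissible tT t i') (fm_consistent s t i i'))) \<and>
       (\<forall>j<k. sat x g (d + 6) (e6 j) (fm_tape (d + 6) tT s t i i' j (V (d + 2)) (V (d + 3)) (V (d + 4)) (V (d + 5)))))"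
    unfolding Let_def by blast
  also have "\<dots> \<longleftrightarrow> compatible x ?s ?a ?t ?b"
  proof -
    have A: "sat x g (d + 2) e2 (fm_admissible tT z i) \<longleftrightarrow>
        (tval e z = 0 \<longrightarrow> (if i = r then start M else src i) = (if i = r then accepting M else start M)) \<and>
        (Suc (tval e z) = T \<longrightarrow> i = r)" if "twf d z" for z i
      unfolding fm_admissible_def by (simp only: sat.simps(4) sat_macros tval.simps sat_Const
        e2[OF that] e2[OF wf(1)] tT Suc_eq_plus1)
    have B: "sat x g (d + 2) e2 (fm_consistent s t i i') \<longleftrightarrow> (Suc ?s = ?t \<longrightarrow>
        (i = r \<longrightarrow> i' = r) \<and> (i < r \<longrightarrow> dst i = (if i' = r then accepting M else src i')))" for i i'
      unfolding fm_consistent_def by (simp only: sat_macros tval.simps sat_Const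
        e2[OF wf(3)] e2[OF wf(5)] Suc_eq_plus1 eq_commute[of ?t])
    show ?thesis
      unfolding Let_def sat.simps(4) A[OF wf(3)] A[OF wf(5)] B tape compatible_iff
      by (rule conj_bounded_all_shuffle)
  qed
  finally show ?thesis .
qed

end

text \<open>
  Entry \<open>i\<close> of the key is the loop variable \<open>b + 2 * i\<close>, as every loop uses two counters.
\<close>

definition fm_vertex :: "nat \<Rightarrow> tm \<Rightarrow> tm \<Rightarrow> tm \<Rightarrow> fm \<Rightarrow> fm" where
  "fm_vertex b tG tD tJ \<phi> = (let x0 = V b; x1 = V (b + 2); x2 = V (b + 4); x3 = V (b + 6);
       x4 = V (b + 8); x5 = V (b + 10); x6 = V (b + 12) in
     Or (And (Eq x0 (C 0)) (And (Less x1 tG)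
          (Or (And (Less x2 (C 4)) (And (Eq x3 (C 0)) (And (Eq x4 (C 0)) (And (Eq x5 (C 0)) (Eq x6 (C 0))))))
            (And (Eq x2 (C 4)) (And (Less x3 tJ) (And (Less x4 tD)
              (And (Less x5 tG) (And (Neg (Eq x5 x1)) (Less x6 tD)))))))))
       (And (Eq x0 (C 1)) (And (Less x1 x3) (And (Less x3 tG) (And (Less x2 tD) (And (Less x4 tD)
          (Or (And (Less x5 (C 4)) (Eq x6 (C 0)))
            (And (Less x6 tJ) (Or (And (Eq x5 (C 4)) (Or \<phi> (Neg (Eq x6 x2))))
              (Or (And (Eq x5 (C 6)) (And (Neg \<phi>) (Eq x6 x2)))
              (Or (And (Eq x5 (C 7)) (Or \<phi> (Neg (Eq x6 x4))))
                (And (Eq x5 (C 5)) (And (Neg \<phi>) (Eq x6 x4))))))))))))))"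

lemma sat_fm_vertex:
  assumes "sat x g d e \<phi> \<longleftrightarrow> R (e (b + 2)) (e (b + 4)) (e (b + 6)) (e (b + 8))"
  shows "sat x g d e (fm_vertex b tG tD tJ \<phi>) \<longleftrightarrow>
    [e b, e (b + 2), e (b + 4), e (b + 6), e (b + 8), e (b + 10), e (b + 12)] \<in>
      key R ` vertices (tval e tG) (tval e tD) (tval e tJ)"
  unfolding vertex_code_iff fm_vertex_def Let_def
  by (simp only: sat.simps sat_macros tval.simps assms)

lemma fwf_fm_vertex:
  "b + 12 < d \<Longrightarrow> twf d tG \<Longrightarrow> twf d tD \<Longrightarrow> twf d tJ \<Longrightarrow> fwf d \<phi> \<Longrightarrow> fwf d (fm_vertex b tG tD tJ \<phi>)"
  unfolding fm_vertex_def Let_def by simp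

section \<open>Printing the adjacency matrices\<close>

definition fm_swapped :: "tm \<Rightarrow> tm \<Rightarrow> fm" where
  "fm_swapped s s' = Or (And (Eq s (C 0)) (Eq s' (C 1))) (Or (And (Eq s (C 1)) (Eq s' (C 0)))
     (Or (And (Eq s (C 2)) (Eq s' (C 3))) (And (Eq s (C 3)) (Eq s' (C 2)))))"

definition fm_crossing :: "(nat \<Rightarrow> tm) \<Rightarrow> (nat \<Rightarrow> tm) \<Rightarrow> fm" where
  "fm_crossing x y = And (Eq (x 0) (C 0)) (And (Eq (x 2) (C 4)) (And (Eq (y 0) (C 1)) (And (Eq (y 6) (x 3))
     (Or (And (Less (x 1) (x 5)) (And (Or (Eq (y 5) (C 4)) (Eq (y 5) (C 6)))
           (And (Eq (y 1) (x 1)) (And (Eq (y 2) (x 4)) (And (Eq (y 3) (x 5)) (Eq (y 4) (x 6)))))))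
         (And (Less (x 5) (x 1)) (And (Or (Eq (y 5) (C 5)) (Eq (y 5) (C 7)))
           (And (Eq (y 1) (x 5)) (And (Eq (y 2) (x 6)) (And (Eq (y 3) (x 1)) (Eq (y 4) (x 4)))))))))))"

definition fm_edge :: "(nat \<Rightarrow> tm) \<Rightarrow> (nat \<Rightarrow> tm) \<Rightarrow> fm" where
  "fm_edge x y = Or (And (Eq (x 0) (C 0)) (And (Eq (y 0) (C 0)) (And (Eq (x 1) (y 1)) (fm_swapped (x 2) (y 2)))))
     (Or (And (Eq (x 0) (C 1)) (And (Eq (y 0) (C 1)) (And (Eq (x 1) (y 1)) (And (Eq (x 2) (y 2))
           (And (Eq (x 3) (y 3)) (And (Eq (x 4) (y 4)) (fm_swapped (x 5) (y 5))))))))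
       (Or (fm_crossing x y) (fm_crossing y x)))"

lemma sat_fm_edge:
  "sat x g d e (fm_edge u v) \<longleftrightarrow> edge (\<lambda>i. tval e (u i)) (\<lambda>i. tval e (v i))"
  unfolding fm_edge_def fm_crossing_def fm_swapped_def edge_def crossing_def swapped_def
  by (simp only: sat.simps sat_macros tval.simps)

lemma fwf_fm_edge: "(\<And>i. i < 7 \<Longrightarrow> twf d (u i)) \<Longrightarrow> (\<And>i. i < 7 \<Longrightarrow> twf d (v i)) \<Longrightarrow> fwf d (fm_edge u v)"
  unfolding fm_edge_def fm_crossing_def fm_swapped_def by simp

lemma edge_cong: "(\<And>i. i < 7 \<Longrightarrow> x i = x' i) \<Longrightarrow> (\<And>i. i < 7 \<Longrightarrow> y i = y' i) \<Longrightarrow> edge x y = edge x' y'"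
  unfolding edge_def crossing_def by simp

text \<open>The environment inside nested \<open>For\<close> loops whose variables have the values
  \<open>xs\<close>, including the counters of remaining rounds.\<close>

fun bind :: "nat \<Rightarrow> nat list \<Rightarrow> (nat \<Rightarrow> nat) \<Rightarrow> nat \<Rightarrow> nat" where
  "bind d [] e = e"
| "bind d (v # xs) e = bind (d + 2) xs (e(d := e 1 - v, d + 1 := v))"

lemma bind_below: "i < d \<Longrightarrow> bind d xs e i = e i"
  by (induction d xs e rule: bind.induct) auto

lemma bind_nth: "i < length xs \<Longrightarrow> bind d xs e (d + 1 + 2 * i) = xs ! i"
proof (induction xs arbitrary: d e i)
  case (Cons v xs)
  show ?case
  proof (cases i)
    case 0
    then show ?thesis by (simp add: bind_below)
  next
    case (Suc i')
    have "bind (d + 2) xs (e(d := e 1 - v, d + 1 := v)) (d + 2 + 1 + 2 * i') = xs ! i'"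
      by (rule Cons.IH) (use Cons.prems Suc in simp)
    moreover have "d + 1 + 2 * Suc i' = d + 2 + 1 + 2 * i'" by simp
    ultimately show ?thesis unfolding Suc bind.simps nth_Cons_Suc by (simp only:)
  qed
qed simp

fun fors :: "nat \<Rightarrow> gen \<Rightarrow> gen" where
  "fors 0 G = G"
| "fors (Suc n) G = For (fors n G)"

lemma gwf_fors [simp]: "gwf d (fors n G) \<longleftrightarrow> gwf (d + 2 * n) G"
  by (induction n arbitrary: d) auto

lemma concat_map_concat: "concat (map f (concat xss)) = concat (map (\<lambda>xs. concat (map f xs)) xss)"
  by (induction xss) auto

lemma outs_fors:
  "1 < d \<Longrightarrow> outs x d e (fors n G) = concat (map (\<lambda>xs. outs x (d + 2 * n) (bind d xs e) G) (tuples n (e 1)))"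
proof (induction n arbitrary: d e)
  case (Suc n)
  have "outs x (d + 2) (e(d := e 1 - v, d + 1 := v)) (fors n G) =
      concat (map (\<lambda>xs. outs x (d + 2 * Suc n) (bind d (v # xs) e) G) (tuples n (e 1)))" for v
  proof -
    let ?e = "e(d := e 1 - v, d + 1 := v)"
    have "outs x (d + 2) ?e (fors n G) =
        concat (map (\<lambda>xs. outs x (d + 2 + 2 * n) (bind (d + 2) xs ?e) G) (tuples n (?e 1)))"
      by (rule Suc.IH) (use Suc.prems in simp)
    moreover have "?e 1 = e 1" "d + 2 + 2 * n = d + 2 * Suc n" using Suc.prems by simp_all
    ultimately show ?thesis unfolding bind.simps by (simp only:)
  qed
  then show ?case
    by (simp add: concat_map_concat o_def del: bind.simps)
qed simp

definition graph_gen :: "fm \<Rightarrow> fm \<Rightarrow> fm \<Rightarrow> gen" where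
  "graph_gen \<phi> \<psi> \<epsilon> = App (fors 7 (Guard \<phi> (Emit (Const True))))
     (App (Emit (Const False)) (fors 7 (Guard \<phi> (fors 7 (Guard \<psi> (Emit \<epsilon>))))))"

lemma concat_map_filter: "concat (map (\<lambda>x. if p x then f x else []) xs) = concat (map f (filter p xs))"
  by (induction xs) auto

lemma graph_code_eq:
  "graph_code L = replicate (length L) True @ [False] @
    concat (map (\<lambda>x. map (\<lambda>y. edge ((!) x) ((!) y)) L) L)"
proof -
  have L: "map ((!) L) [0..<length L] = L" by (rule map_nth)
  have "concat (map (\<lambda>x. map (\<lambda>y. edge ((!) x) ((!) y)) L) L) =
     concat (map (\<lambda>x. map (\<lambda>y. edge ((!) x) ((!) y)) (map ((!) L) [0..<length L])) (map ((!) L) [0..<length L]))"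
    unfolding L ..
  then show ?thesis
    unfolding graph_code_def matrix_code_def rows_def edge_matrix_def by (simp add: o_def)
qed

lemma outs_graph_gen:
  assumes \<phi>: "\<And>xs. xs \<in> set (tuples 7 (e 1)) \<Longrightarrow> sat x [] 17 (bind 3 xs e) \<phi> \<longleftrightarrow> p xs"
    and \<psi>: "\<And>xs ys. xs \<in> set (tuples 7 (e 1)) \<Longrightarrow> ys \<in> set (tuples 7 (e 1)) \<Longrightarrow>
      sat x [] 31 (bind 17 ys (bind 3 xs e)) \<psi> \<longleftrightarrow> p ys"
    and \<epsilon>: "\<And>xs ys. xs \<in> set (tuples 7 (e 1)) \<Longrightarrow> ys \<in> set (tuples 7 (e 1)) \<Longrightarrow>
      sat x [] 31 (bind 17 ys (bind 3 xs e)) \<epsilon> \<longleftrightarrow> edge ((!) xs) ((!) ys)"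
  shows "outs x 3 e (graph_gen \<phi> \<psi> \<epsilon>) = graph_code (filter p (tuples 7 (e 1)))"
proof -
  let ?S = "tuples 7 (e 1)"
  have "outs x 3 e (fors 7 (Guard \<phi> (Emit (Const True)))) =
      concat (map (\<lambda>xs. if p xs then [True] else []) ?S)"
    using \<phi> by (subst outs_fors) (auto intro!: arg_cong[of _ _ concat])
  also have "\<dots> = replicate (length (filter p ?S)) True"
    unfolding concat_map_filter by (induction "filter p ?S") (simp_all add: concat_map_singleton map_replicate_const)
  finally have 1: "outs x 3 e (fors 7 (Guard \<phi> (Emit (Const True)))) = replicate (length (filter p ?S)) True" .
  have inner: "outs x 17 (bind 3 xs e) (fors 7 (Guard \<psi> (Emit \<epsilon>))) = map (\<lambda>ys. edge ((!) xs) ((!) ys)) (filter p ?S)"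
    if xs: "xs \<in> set ?S" for xs
  proof -
    have "bind 3 xs e 1 = e 1" by (rule bind_below) simp
    then have "outs x 17 (bind 3 xs e) (fors 7 (Guard \<psi> (Emit \<epsilon>))) =
        concat (map (\<lambda>ys. if p ys then [edge ((!) xs) ((!) ys)] else []) ?S)"
      using \<psi>[OF xs] \<epsilon>[OF xs] by (subst outs_fors) (auto intro!: arg_cong[of _ _ concat])
    then show ?thesis unfolding concat_map_filter by (simp add: concat_map_singleton)
  qed
  have "outs x 3 e (fors 7 (Guard \<phi> (fors 7 (Guard \<psi> (Emit \<epsilon>))))) =
      concat (map (\<lambda>xs. if p xs then map (\<lambda>ys. edge ((!) xs) ((!) ys)) (filter p ?S) else []) ?S)"
    using \<phi> inner by (subst outs_fors) (auto intro!: arg_cong[of _ _ concat])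
  also have "\<dots> = concat (map (\<lambda>xs. map (\<lambda>ys. edge ((!) xs) ((!) ys)) (filter p ?S)) (filter p ?S))"
    by (rule concat_map_filter)
  finally show ?thesis
    unfolding graph_gen_def graph_code_eq outs.simps 1 by simp
qed

text \<open>Seven loops take 14 counters. From depth 3 on, the entries of the first vertex are the
  variables 4, 6, ..., 16, which leads to depth 17; those of the second are 18, 20, ..., 30, which
  leads to depth 31.\<close>

definition vertex_gen :: "tm \<Rightarrow> tm \<Rightarrow> tm \<Rightarrow> (nat \<Rightarrow> nat \<Rightarrow> fm) \<Rightarrow> gen" where
  "vertex_gen tG tD tJ \<phi> = graph_gen (fm_vertex 4 tG tD tJ (\<phi> 17 4)) (fm_vertex 18 tG tD tJ (\<phi> 31 18))
     (fm_edge (\<lambda>i. V (4 + 2 * i)) (\<lambda>i. V (18 + 2 * i)))"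

lemma gwf_vertex_gen:
  assumes "twf 1 tG" "twf 1 tD" "twf 1 tJ" "fwf 17 (\<phi> 17 4)" "fwf 31 (\<phi> 31 18)"
  shows "gwf 3 (vertex_gen tG tD tJ \<phi>)"
proof -
  have t: "twf 17 tG" "twf 17 tD" "twf 17 tJ" "twf 31 tG" "twf 31 tD" "twf 31 tJ"
    using assms(1-3) by (auto elim: twf_mono)
  show ?thesis
    unfolding vertex_gen_def graph_gen_def
    using assms(4,5) t by (auto intro!: fwf_fm_vertex fwf_fm_edge)
qed

text \<open>Entries 2 and 4 of a pair vertex are the two items. Their bounds in the assumption on
  \<open>R\<close> are what the decoding of digits requires.\<close>

lemma outs_vertex_gen:
  assumes wf: "twf 1 tG" "twf 1 tD" "twf 1 tJ"
    and R: "\<And>d b f. (d = 17 \<and> b = 4) \<or> (d = 31 \<and> b = 18) \<Longrightarrow> f 0 = e 0 \<Longrightarrow> f 1 = e 1 \<Longrightarrow>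
      f (b + 4) < e 1 \<Longrightarrow> f (b + 8) < e 1 \<Longrightarrow>
      sat x [] d f (\<phi> d b) \<longleftrightarrow> R (f (b + 2)) (f (b + 4)) (f (b + 6)) (f (b + 8))"
  shows "outs x 3 e (vertex_gen tG tD tJ \<phi>) =
    graph_code (vertex_list R (tval e tG) (tval e tD) (tval e tJ) (e 1))"
proof -
  have tv: "tval f t = tval e t" if "twf 1 t" "f 0 = e 0" for f t
    using that by (intro tval_cong[of 1]) auto
  have vertex: "sat x [] d f (fm_vertex b tG tD tJ (\<phi> d b)) \<longleftrightarrow> xs \<in> key R ` vertices (tval e tG) (tval e tD) (tval e tJ)"
    if db: "(d = 17 \<and> b = 4) \<or> (d = 31 \<and> b = 18)" and f: "f 0 = e 0" "f 1 = e 1"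
      and xs: "xs \<in> set (tuples 7 (e 1))" and fx: "\<And>i. i < 7 \<Longrightarrow> f (b + 2 * i) = xs ! i" for d b f xs
  proof -
    have len: "length xs = 7" using xs unfolding set_tuples by auto
    have sub: "xs ! i < e 1" if "i < 7" for i
    proof -
      have "xs ! i \<in> set xs" using len that by simp
      moreover have "set xs \<subseteq> {..<e 1}" using xs unfolding set_tuples by simp
      ultimately show ?thesis by blast
    qed
    have fs: "f b = xs ! 0" "f (b + 2) = xs ! 1" "f (b + 4) = xs ! 2" "f (b + 6) = xs ! 3"
      "f (b + 8) = xs ! 4" "f (b + 10) = xs ! 5" "f (b + 12) = xs ! 6"
      using fx[of 0] fx[of 1] fx[of 2] fx[of 3] fx[of 4] fx[of 5] fx[of 6] by simp_all
    have l: "[xs ! 0, xs ! 1, xs ! 2, xs ! 3, xs ! 4, xs ! 5, xs ! 6] = xs"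
      using len by (auto simp: eval_nat_numeral length_Suc_conv)
    have "sat x [] d f (\<phi> d b) \<longleftrightarrow> R (f (b + 2)) (f (b + 4)) (f (b + 6)) (f (b + 8))"
      by (rule R) (use db f sub[of 2] sub[of 4] in \<open>auto simp: fs\<close>)
    from sat_fm_vertex[where e = f and b = b and R = R and tG = tG and tD = tD and tJ = tJ, OF this] show ?thesis
      unfolding fs l tv[where f = f, OF wf(1) f(1)] tv[where f = f, OF wf(2) f(1)] tv[where f = f, OF wf(3) f(1)] .
  qed
  have len: "length xs = 7" if "xs \<in> set (tuples 7 (e 1))" for xs
    using that unfolding set_tuples by auto
  show ?thesis
    unfolding vertex_gen_def vertex_list_def
  proof (rule outs_graph_gen)
    fix xs assume xs: "xs \<in> set (tuples 7 (e 1))"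
    show "sat x [] 17 (bind 3 xs e) (fm_vertex 4 tG tD tJ (\<phi> 17 4)) \<longleftrightarrow>
        xs \<in> key R ` vertices (tval e tG) (tval e tD) (tval e tJ)"
      by (rule vertex) (use xs len[OF xs] bind_nth[of _ xs 3 e] in \<open>auto simp: bind_below\<close>)
    fix ys assume ys: "ys \<in> set (tuples 7 (e 1))"
    show "sat x [] 31 (bind 17 ys (bind 3 xs e)) (fm_vertex 18 tG tD tJ (\<phi> 31 18)) \<longleftrightarrow>
        ys \<in> key R ` vertices (tval e tG) (tval e tD) (tval e tJ)"
      by (rule vertex) (use ys len[OF ys] bind_nth[of _ ys 17 "bind 3 xs e"] in \<open>auto simp: bind_below\<close>)
    have 1: "bind 17 ys (bind 3 xs e) (4 + 2 * i) = xs ! i" if "i < 7" for i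
      using that bind_nth[of i xs 3 e] len[OF xs] bind_below[of "4 + 2 * i" 17 ys "bind 3 xs e"] by simp
    have 2: "bind 17 ys (bind 3 xs e) (18 + 2 * i) = ys ! i" if "i < 7" for i
      using that bind_nth[of i ys 17 "bind 3 xs e"] len[OF ys] by simp
    show "sat x [] 31 (bind 17 ys (bind 3 xs e)) (fm_edge (\<lambda>i. V (4 + 2 * i)) (\<lambda>i. V (18 + 2 * i))) \<longleftrightarrow>
        edge ((!) xs) ((!) ys)"
      unfolding sat_fm_edge by (rule edge_cong) (simp_all only: tval.simps 1 2)
  qed
qed

theorem matching_hom_problem_NP_hard: "NP_hard matching_hom_problem"
  unfolding NP_hard_def
proof
  fix A assume "A \<in> NP"
  then obtain M and p :: "nat poly" where tm: "turing_machine M"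
    and bound: "\<And>x n c. (step M ^^ n) (initial M x) c \<Longrightarrow> n \<le> poly p (length x)"
    and A: "A = {x. accepts M x}"
    unfolding NP_def by blast
  have "finite (transitions M)" using tm by (simp add: turing_machine_def)
  then obtain trs where trs: "set trs = transitions M"
    using finite_list by blast
  obtain tp where tp: "twf 1 tp" "\<And>e. tval e tp = poly p (e 0)"
    using tm_of_poly by blast
  \<comment> \<open>The constant 2 is the slack demanded by \<open>accepts_imp_solvable\<close>.
    Below, the base \<open>tP\<close> exceeds both \<open>2 * T\<close> and the number of
    transitions, and an item has one digit for the action and two for each tape.\<close>
  define tT where "tT = Plus tp (C 2)"
  define tP where "tP = Plus (Mul (C 2) tT) (C (length trs + 1))"
  define tD where "tD = tpow tP (2 * tapes M + 1)"
  \<comment> \<open>A sum bounds all its summands at once: the length of the input, the items, the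
    times, the digits and, by the constant 8, the ranks.\<close>
  define B where "B = Plus (V 0) (Plus tD (Plus tT (Plus tP (C 8))))"
  have wf: "twf 1 tT" "twf 1 tP" "twf 1 tD" "twf 1 B"
    using tp(1) by (simp_all add: tT_def tP_def tD_def B_def)
  define \<phi> where "\<phi> d b = tableau.fm_compatible M trs d tT tP (V (b + 2)) (V (b + 4)) (V (b + 6)) (V (b + 8))"
    for d b
  define T where "T x = poly p (length x) + 2" for x :: "bool list"
  define P where "P x = 2 * T x + (length trs + 1)" for x
  define D where "D x = P x ^ (2 * tapes M + 1)" for x
  have tab: "tableau M trs (T x) (P x)" for x
    by unfold_locales (auto simp: tm trs T_def P_def)
  have tv: "tval f tT = T x" "tval f tP = P x" "tval f tD = D x" if "f 0 = length x" for f x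
    using that by (simp_all add: tT_def tP_def tD_def tp T_def P_def D_def)
  have env: "env B x 0 = length x" "env B x 1 = length x + (D x + (T x + (P x + 8)))" for x
    using tv[of "(\<lambda>_. 0)(0 := length x)" x] by (simp_all add: env_def B_def)
  define G where "G = App (vertex_gen tT tD tD \<phi>) (vertex_gen tT tD (C 1) (\<lambda>_ _. Const True))"
  have twf: "twf n t" if "twf 1 t" "1 \<le> n" for n t
    using that twf_mono by blast
  have "fwf d (\<phi> d b)" if "b + 8 < d" for d b
  proof -
    interpret tableau M trs "T []" "P []" by (rule tab)
    show ?thesis
      unfolding \<phi>_def by (rule fwf_fm_compatible) (use that twf[OF wf(1)] twf[OF wf(2)] in auto)
  qed
  then have gwf: "gwf 3 G"
    unfolding G_def using wf by (auto intro!: gwf_vertex_gen)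
  have code: "outs x 3 (env B x) G =
      graph_code (vertex_list (tableau.compatible M trs (T x) (P x) x) (T x) (D x) (D x) (env B x 1)) @
      graph_code (vertex_list (\<lambda>_ _ _ _. True) (T x) (D x) 1 (env B x 1))" for x
  proof -
    interpret tableau M trs "T x" "P x" by (rule tab)
    have "outs x 3 (env B x) (vertex_gen tT tD tD \<phi>) =
        graph_code (vertex_list (compatible x) (tval (env B x) tT) (tval (env B x) tD) (tval (env B x) tD) (env B x 1))"
    proof (rule outs_vertex_gen[OF wf(1,3,3)])
      fix d b :: nat and f :: "nat \<Rightarrow> nat"
      assume db: "d = 17 \<and> b = 4 \<or> d = 31 \<and> b = 18" and f: "f 0 = env B x 0" "f 1 = env B x 1"
        "f (b + 4) < env B x 1" "f (b + 8) < env B x 1"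
      have f0: "f 0 = length x" using f(1) env by simp
      have "sat x [] d f (\<phi> d b) \<longleftrightarrow>
          compatible x (tval f (V (b + 2))) (tval f (V (b + 4))) (tval f (V (b + 6))) (tval f (V (b + 8)))"
        unfolding \<phi>_def
        by (rule sat_fm_compatible) (use db f env tv[where x = x and f = f, OF f0] twf[OF wf(1)] twf[OF wf(2)] in auto)
      then show "sat x [] d f (\<phi> d b) \<longleftrightarrow> compatible x (f (b + 2)) (f (b + 4)) (f (b + 6)) (f (b + 8))"
        by simp
    qed
    moreover have "outs x 3 (env B x) (vertex_gen tT tD (C 1) (\<lambda>_ _. Const True)) =
        graph_code (vertex_list (\<lambda>_ _ _ _. True) (tval (env B x) tT) (tval (env B x) tD) (tval (env B x) (C 1)) (env B x 1))"
      by (rule outs_vertex_gen[OF wf(1,3)]) simp_all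
    ultimately show ?thesis
      unfolding G_def using tv[where x = x and f = "env B x", OF env(1)] by simp
  qed
  have "x \<in> A \<longleftrightarrow> outs x 3 (env B x) G \<in> matching_hom_problem" for x
  proof -
    interpret tableau M trs "T x" "P x" by (rule tab)
    have "0 < D x" by (simp add: D_def P_def)
    have "outs x 3 (env B x) G \<in> matching_hom_problem \<longleftrightarrow> solvable (T x) (D x) (compatible x)"
      unfolding code
      by (rule solvable_iff_codes) (simp_all add: env(2) \<open>0 < D x\<close> del: One_nat_def)
    also have "\<dots> \<longleftrightarrow> accepts M x"
      unfolding D_def using solvable_imp_accepts accepts_imp_solvable bound by (fastforce simp: T_def)
    finally show ?thesis using A by simp
  qed
  moreover have "polytime_computable (\<lambda>x. outs x 3 (env B x) G)"
    by (rule polytime_computable_outs[OF gwf wf(4)]) (simp add: env(2) del: One_nat_def)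
  ultimately show "polytime_reducible A matching_hom_problem"
    unfolding polytime_reducible_def by blast
qed

theorem theorem2: "NP_complete matching_hom_problem"
  unfolding NP_complete_def using matching_hom_problem_in_NP matching_hom_problem_NP_hard ..

end
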